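(* Let $(\mathcal G,\mathcal O(I))$ be a perfectly oriented PBDTP plabic graph with source set $I=\{i_1<\dots<i_k\}$, and let $\epsilon$ be any signature on $\mathcal G$. Then: (1) for almost every collection of real edge weights $w_{U,V}$, Lam's system of relations on the signed network $(\mathcal G,\mathcal O(I),w,\epsilon)$ has a unique solution $z_{U,e}$ in $\mathbb R^n$ (for prescribed half-edge vectors at the boundary sinks); (2) assign the canonical basis vectors $E_j$ to the half-edge vectors at the boundary sinks $b_j$, and let $A$ be the $k\times n$ matrix whose $r$-th row is $A[r]=E_{i_r}-z_{b_{i_r},e_{i_r}}$, where $z_{b_{i_r},e_{i_r}}$ is the half-edge vector at the boundary source $b_{i_r}$, $r\in[k]$. If, moreover, $A$ is totally non-negative (all maximal minors $\ge 0$) for almost every collection of positive weights, then (a) $\epsilon$ is equivalent to the geometric signature; (b) Lam's system possesses a unique solution for every choice of positive weights; (c) $A$ coincides with Postnikov's boundary measurement matrix for the base $I$.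
   Context: A plabic graph is a finite planar directed graph in a closed disc, no component disjoint from the boundary, with $n$ degree-one boundary vertices $b_1,\dots,b_n$ labelled clockwise on a common arc of the boundary circle, internal vertices of degree $2$ or $3$ in the open disc, edges straight segments, and a perfect orientation: each internal vertex has exactly one incoming edge (white) or exactly one outgoing edge (black), bivalent vertices being assigned a colour. Sources/sinks: boundary vertices with outgoing/incoming edge; $I$ = set of source indices, $\bar I=[n]\setminus I$. PBDTP: every edge lies on a directed path starting and ending at boundary vertices. Signatures and Lam's relations: a signature assigns $\epsilon_e=\epsilon_{U,V}=\epsilon_{V,U}\in\{0,1\}$ to each edge. Lam's system for half-edge vectors $z_{U,e}\in\mathbb R^n$ (one for each edge $e$ and endpoint $U$): (i) $z_{U,e}=(-1)^{\epsilon_{U,V}}w_{U,V}z_{V,e}$ for each edge $e$ directed from $U$ to $V$; (ii) $\sum_e z_{V,e}=0$ over the edges at each internal white $V$; (iii) $z_{V,e}=z_{V,e'}$ for all edges at each internal black $V$. Equivalence of signatures: $\epsilon,\hat\epsilon$ are equivalent if there is $\eta:\{\text{internal vertices}\}\to\{0,1\}$ with $\hat\epsilon_{U,V}\equiv\epsilon_{U,V}+\eta(U)+\eta(V)$ on edges between internal vertices and $\hat\epsilon_{U,V}\equiv\epsilon_{U,V}+\eta(U)$ on edges from internal $U$ to a boundary vertex (mod 2). Geometric signature: a gauge ray direction is a direction $\mathfrak l$ such that rays from boundary vertices in direction $\mathfrak l$ enter the disc, no edge is parallel to $\mathfrak l$, and no such ray passes through an internal vertex; $s(f,g)=1,0,-1$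 according as $\det(f,g)>0,=0,<0$; $\mathrm{wind}(e,f)=1$ if $s(e,f)=s(e,\mathfrak l)=s(\mathfrak l,f)=1$, $-1$ if all are $-1$, else $0$; $\mathrm{int}(e)$ = number of intersections of $e$ with the rays from the sources in direction $\mathfrak l$, times $s(\mathfrak l,e)$. The geometric signature is (mod 2): for $e$ from internal $V$ to a sink: $\mathrm{int}(e)$ if $V$ black, $1+\mathrm{int}(e)+\mathrm{wind}(e_1,e)$ if $V$ white with incoming $e_1$; for $e$ from a source to internal $V$: $1+\mathrm{int}(e)+\mathrm{wind}(e,e')$ if $V$ black with outgoing $e'$, $1+\mathrm{int}(e)$ if $V$ white; for internal $e=(U,V)$: $\mathrm{int}(e)$ ($U$ black, $V$ white); $1+\mathrm{int}(e)+\mathrm{wind}(e_1,e)$ ($U,V$ white, $e_1$ incoming at $U$); $1+\mathrm{int}(e)+\mathrm{wind}(e_1,e)+\mathrm{wind}(e,e_5)$ ($U$ white, $V$ black, $e_1$ incoming at $U$, $e_5$ outgoing at $V$); $\mathrm{int}(e)+\mathrm{wind}(e,e_5)$ ($U,V$ black, $e_5$ outgoing at $V$). (Its equivalence class does not depend on $\mathfrak l$.) Boundary measurement matrix: for $i\in I$, $j\in\bar I$, $M_{ij}=\sum_P(-1)^{\mathrm{Wind}(P)}w(P)$ over directed walks $P$ from $b_i$ to $b_j$, $w(P)$ the product of weights with multiplicity, $\mathrm{Wind}(P)$ Postnikov's topological winding index; the boundary measurement matrix is the $k\times n$ matrix with identity in the columns $I$ and entries $(-1)^{\sigma(i_r,j)}M_{i_rj}$,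 $\sigma(i_r,j)$ the number of elements of $I$ strictly between $i_r$ and $j$. *)

theory Defs
  imports "HOL-Analysis.Analysis" "HOL-Library.Multiset"
    "Jordan_Normal_Form.Determinant" "Jordan_Normal_Form.DL_Submatrix"
begin

hide_const (open) Determinants.det Finite_Cartesian_Product.vec
hide_type (open) Finite_Cartesian_Product.vec

section \<open>Plabic graphs\<close>

text \<open>
  Points of the plane are complex numbers. Edges are straight segments, and planarity leaves at
  most one edge between two vertices, so a directed edge is the pair (tail, head).
  Boundary vertices are indexed by 0, ..., n - 1 instead of 1, ..., n.
\<close>

type_synonym edge = "complex \<times> complex"

record plabic =
  centre :: complex
  radius :: real
  nb :: nat
  bv :: "nat \<Rightarrow> complex"
  internal :: "complex set"
  black :: "complex set"
  edges :: "edge set"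

definition white :: "plabic \<Rightarrow> complex set" where
  "white G = internal G - black G"

definition vertices :: "plabic \<Rightarrow> complex set" where
  "vertices G = internal G \<union> bv G ` {..<nb G}"

definition edges_at :: "plabic \<Rightarrow> complex \<Rightarrow> edge set" where
  "edges_at G V = {e \<in> edges G. fst e = V \<or> snd e = V}"

definition in_edges :: "plabic \<Rightarrow> complex \<Rightarrow> edge set" where
  "in_edges G V = {e \<in> edges G. snd e = V}"

definition out_edges :: "plabic \<Rightarrow> complex \<Rightarrow> edge set" where
  "out_edges G V = {e \<in> edges G. fst e = V}"

definition seg :: "edge \<Rightarrow> complex set" where
  "seg e = closed_segment (fst e) (snd e)"

text \<open>
  The common arc carrying the boundary vertices is shorter than a half circle. This is what makes
  it possible for rays in one direction to enter the disc from all boundary vertices, and it lets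
  the labels run along the arc in the clockwise sense without wrapping around the circle.
\<close>

definition clockwise_on_arc :: "plabic \<Rightarrow> bool" where
  "clockwise_on_arc G \<longleftrightarrow> (\<exists>\<theta> :: nat \<Rightarrow> real.
     (\<forall>j < nb G. bv G j = centre G + of_real (radius G) * cis (\<theta> j)) \<and>
     (\<forall>i j. i < j \<and> j < nb G \<longrightarrow> \<theta> j < \<theta> i \<and> \<theta> i - \<theta> j < pi))"

text \<open>
  Every edge has an internal endpoint: signatures and their equivalence treat only edges between
  internal vertices and edges joining an internal vertex to a boundary vertex.
\<close>

definition plabic_graph :: "plabic \<Rightarrow> bool" where
  "plabic_graph G \<longleftrightarrow>
     0 < radius G \<and> clockwise_on_arc G \<and>
     finite (internal G) \<and> internal G \<subseteq> ball (centre G) (radius G) \<and> black G \<subseteq> internal G \<and>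
     edges G \<subseteq> vertices G \<times> vertices G \<and>
     (\<forall>e \<in> edges G. fst e \<noteq> snd e \<and> (fst e \<in> internal G \<or> snd e \<in> internal G)) \<and>
     (\<forall>e \<in> edges G. \<forall>f \<in> edges G. e \<noteq> f \<longrightarrow>
        seg e \<inter> seg f \<subseteq> {fst e, snd e} \<inter> {fst f, snd f}) \<and>
     (\<forall>j < nb G. card (edges_at G (bv G j)) = 1) \<and>
     (\<forall>V \<in> internal G. card (edges_at G V) = 2 \<or> card (edges_at G V) = 3) \<and>
     (\<forall>V \<in> white G. card (in_edges G V) = 1) \<and>
     (\<forall>V \<in> black G. card (out_edges G V) = 1) \<and>
     (\<forall>V \<in> internal G. \<exists>j < nb G. (V, bv G j) \<in> (edges G \<union> (edges G)\<inverse>)\<^sup>*)"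

definition sources :: "plabic \<Rightarrow> nat set" where
  "sources G = {j. j < nb G \<and> out_edges G (bv G j) \<noteq> {}}"

definition sinks :: "plabic \<Rightarrow> nat set" where
  "sinks G = {..<nb G} - sources G"

definition boundary_edge :: "plabic \<Rightarrow> nat \<Rightarrow> edge" where
  "boundary_edge G j = (THE e. e \<in> edges_at G (bv G j))"

text \<open>Directed paths may revisit vertices and edges, as in the sums over walks below.\<close>

definition walk :: "plabic \<Rightarrow> nat \<Rightarrow> nat \<Rightarrow> edge list \<Rightarrow> bool" where
  "walk G i j p \<longleftrightarrow> p \<noteq> [] \<and> set p \<subseteq> edges G \<and> successively (\<lambda>e f. snd e = fst f) p \<and>
     fst (hd p) = bv G i \<and> snd (last p) = bv G j"

definition PBDTP :: "plabic \<Rightarrow> bool" where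
  "PBDTP G \<longleftrightarrow> (\<forall>e \<in> edges G. \<exists>i < nb G. \<exists>j < nb G. \<exists>p. walk G i j p \<and> e \<in> set p)"

section \<open>Signatures\<close>

text \<open>
  Each unordered pair of adjacent vertices carries exactly one directed edge, so a signature with
  \<open>\<epsilon>\<^sub>U\<^sub>V = \<epsilon>\<^sub>V\<^sub>U\<close> is a function of the directed edge.
\<close>

definition signature :: "plabic \<Rightarrow> (edge \<Rightarrow> nat) \<Rightarrow> bool" where
  "signature G \<epsilon> \<longleftrightarrow> (\<forall>e \<in> edges G. \<epsilon> e \<in> {0, 1})"

definition equivalent_signatures ::
  "plabic \<Rightarrow> (edge \<Rightarrow> nat) \<Rightarrow> (edge \<Rightarrow> nat) \<Rightarrow> bool" where
  "equivalent_signatures G \<epsilon> \<epsilon>' \<longleftrightarrow> (\<exists>\<eta> :: complex \<Rightarrow> nat.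
     (\<forall>V \<in> internal G. \<eta> V \<in> {0, 1}) \<and>
     (\<forall>(U, V) \<in> edges G. U \<in> internal G \<and> V \<in> internal G \<longrightarrow>
        \<epsilon>' (U, V) mod 2 = (\<epsilon> (U, V) + \<eta> U + \<eta> V) mod 2) \<and>
     (\<forall>(U, V) \<in> edges G. U \<in> internal G \<and> V \<notin> internal G \<longrightarrow>
        \<epsilon>' (U, V) mod 2 = (\<epsilon> (U, V) + \<eta> U) mod 2) \<and>
     (\<forall>(U, V) \<in> edges G. U \<notin> internal G \<and> V \<in> internal G \<longrightarrow>
        \<epsilon>' (U, V) mod 2 = (\<epsilon> (U, V) + \<eta> V) mod 2))"

section \<open>The geometric signature\<close>

definition evec :: "edge \<Rightarrow> complex" where
  "evec e = snd e - fst e"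

definition orient :: "complex \<Rightarrow> complex \<Rightarrow> int" where
  "orient f g = (let d = Re f * Im g - Im f * Re g in if d > 0 then 1 else if d = 0 then 0 else -1)"

definition ray :: "complex \<Rightarrow> complex \<Rightarrow> complex set" where
  "ray p l = {p + of_real t * l | t. t \<ge> 0}"

definition gauge_direction :: "plabic \<Rightarrow> complex \<Rightarrow> bool" where
  "gauge_direction G l \<longleftrightarrow>
     (\<forall>j < nb G. ray (bv G j) l \<inter> ball (centre G) (radius G) \<noteq> {}) \<and>
     (\<forall>e \<in> edges G. orient l (evec e) \<noteq> 0) \<and>
     (\<forall>j < nb G. ray (bv G j) l \<inter> internal G = {})"

definition wind :: "complex \<Rightarrow> edge \<Rightarrow> edge \<Rightarrow> int" where
  "wind l e f = (let e = evec e; f = evec f in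
     if orient e f = 1 \<and> orient e l = 1 \<and> orient l f = 1 then 1
     else if orient e f = -1 \<and> orient e l = -1 \<and> orient l f = -1 then -1
     else 0)"

text \<open>
  Intersections are taken in the interior of the edge: the edge at a source does not count
  the starting point of the ray from that source.
\<close>

definition ray_crossings :: "plabic \<Rightarrow> complex \<Rightarrow> edge \<Rightarrow> int" where
  "ray_crossings G l e =
     int (card {i \<in> sources G. ray (bv G i) l \<inter> open_segment (fst e) (snd e) \<noteq> {}})
       * orient l (evec e)"

definition geometric_exponent :: "plabic \<Rightarrow> complex \<Rightarrow> edge \<Rightarrow> int" where
  "geometric_exponent G l e =
     (let U = fst e; V = snd e; c = ray_crossings G l e;
          e1 = (THE f. f \<in> in_edges G U); e2 = (THE f. f \<in> out_edges G V)
      in if V \<notin> internal G then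
           (if U \<in> black G then c else 1 + c + wind l e1 e)
         else if U \<notin> internal G then
           (if V \<in> black G then 1 + c + wind l e e2 else 1 + c)
         else if U \<in> black G then
           (if V \<in> black G then c + wind l e e2 else c)
         else
           (if V \<in> black G then 1 + c + wind l e1 e + wind l e e2 else 1 + c + wind l e1 e))"

definition geometric_signature :: "plabic \<Rightarrow> complex \<Rightarrow> edge \<Rightarrow> nat" where
  "geometric_signature G l e = nat (geometric_exponent G l e mod 2)"

section \<open>Lam's system of relations\<close>

definition half_edges :: "plabic \<Rightarrow> (complex \<times> edge) set" where
  "half_edges G = {(U, e). e \<in> edges_at G U}"

text \<open>
  A family of half-edge vectors is an extensional function on the half-edges, so that
  uniqueness of solutions can be expressed by \<open>\<exists>!\<close>.
\<close>

definition lam_system ::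
  "plabic \<Rightarrow> (edge \<Rightarrow> real) \<Rightarrow> (edge \<Rightarrow> nat) \<Rightarrow> (complex \<times> edge \<Rightarrow> real vec) \<Rightarrow> bool" where
  "lam_system G w \<epsilon> z \<longleftrightarrow>
     z \<in> half_edges G \<rightarrow>\<^sub>E carrier_vec (nb G) \<and>
     (\<forall>(U, V) \<in> edges G.
        z (U, (U, V)) = ((-1) ^ \<epsilon> (U, V) * w (U, V)) \<cdot>\<^sub>v z (V, (U, V))) \<and>
     (\<forall>V \<in> white G.
        finsum_vec TYPE(real) (nb G) (\<lambda>e. z (V, e)) (edges_at G V) = 0\<^sub>v (nb G)) \<and>
     (\<forall>V \<in> black G. \<forall>e \<in> edges_at G V. \<forall>e' \<in> edges_at G V. z (V, e) = z (V, e'))"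

definition lam_solution ::
  "plabic \<Rightarrow> (edge \<Rightarrow> real) \<Rightarrow> (edge \<Rightarrow> nat) \<Rightarrow> (nat \<Rightarrow> real vec) \<Rightarrow>
    (complex \<times> edge \<Rightarrow> real vec) \<Rightarrow> bool" where
  "lam_solution G w \<epsilon> x z \<longleftrightarrow>
     lam_system G w \<epsilon> z \<and> (\<forall>j \<in> sinks G. z (bv G j, boundary_edge G j) = x j)"

definition lam_uniquely_solvable ::
  "plabic \<Rightarrow> (edge \<Rightarrow> real) \<Rightarrow> (edge \<Rightarrow> nat) \<Rightarrow> bool" where
  "lam_uniquely_solvable G w \<epsilon> \<longleftrightarrow>
     (\<forall>x \<in> sinks G \<rightarrow> carrier_vec (nb G). \<exists>!z. lam_solution G w \<epsilon> x z)"

definition lam_matrix :: "plabic \<Rightarrow> (complex \<times> edge \<Rightarrow> real vec) \<Rightarrow> real mat" where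
  "lam_matrix G z = mat_of_rows (nb G)
     (map (\<lambda>i. unit_vec (nb G) i - z (bv G i, boundary_edge G i)) (sorted_list_of_set (sources G)))"

definition totally_nonnegative :: "real mat \<Rightarrow> bool" where
  "totally_nonnegative A \<longleftrightarrow>
     (\<forall>J \<subseteq> {..<dim_col A}. card J = dim_row A \<longrightarrow> 0 \<le> det (submatrix A UNIV J))"

definition weight_measure :: "plabic \<Rightarrow> (edge \<Rightarrow> real) measure" where
  "weight_measure G = PiM (edges G) (\<lambda>_. lborel)"

definition positive_weights :: "plabic \<Rightarrow> (edge \<Rightarrow> real) \<Rightarrow> bool" where
  "positive_weights G w \<longleftrightarrow> (\<forall>e \<in> edges G. 0 < w e)"

section \<open>Postnikov's boundary measurement matrix\<close>

text \<open>
  The path is closed up by the counterclockwise boundary arc from its last to its first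
  endpoint, the corners are smoothed by turning through the exterior angle (which lies strictly
  between \<open>-pi\<close> and \<open>pi\<close>), and \<open>Wind\<close> is the number of full counterclockwise turns of the tangent
  vector along this closed curve, minus one. The total turning is an integer multiple of \<open>2 * pi\<close>.
\<close>

definition total_turning :: "plabic \<Rightarrow> nat \<Rightarrow> nat \<Rightarrow> edge list \<Rightarrow> real" where
  "total_turning G i j p =
     (\<Sum>k < length p - 1. Arg (evec (p ! Suc k) / evec (p ! k)))
     + Arg (\<i> * (bv G j - centre G) / evec (last p))
     + Arg2pi ((bv G i - centre G) / (bv G j - centre G))
     + Arg (evec (hd p) / (\<i> * (bv G i - centre G)))"

definition Wind :: "plabic \<Rightarrow> nat \<Rightarrow> nat \<Rightarrow> edge list \<Rightarrow> int" where
  "Wind G i j p = \<lfloor>total_turning G i j p / (2 * pi)\<rfloor> - 1"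

text \<open>
  With directed cycles present the sum over walks is infinite and need not converge. As in
  Postnikov's definition it is the formal power series in the edge weights with the coefficients
  below (a monomial is a multiset of edges, each coefficient is a finite sum). This series is
  a rational function, and its value at given weights is the value of that rational function.
\<close>

definition walk_series :: "plabic \<Rightarrow> nat \<Rightarrow> nat \<Rightarrow> edge multiset \<Rightarrow> real" where
  "walk_series G i j m = (\<Sum>p | walk G i j p \<and> mset p = m. (-1) powi Wind G i j p)"

definition mpoly_value :: "('a multiset \<Rightarrow> real) \<Rightarrow> ('a \<Rightarrow> real) \<Rightarrow> real" where
  "mpoly_value P w = (\<Sum>m | P m \<noteq> 0. P m * (\<Prod>e \<in># m. w e))"

definition series_has_value :: "('a multiset \<Rightarrow> real) \<Rightarrow> ('a \<Rightarrow> real) \<Rightarrow> real \<Rightarrow> bool" where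
  "series_has_value S w v \<longleftrightarrow> (\<exists>P Q :: 'a multiset \<Rightarrow> real.
     finite {m. P m \<noteq> 0} \<and> finite {m. Q m \<noteq> 0} \<and>
     (\<forall>m. P m = (\<Sum>a | a \<subseteq># m. Q a * S (m - a))) \<and>
     mpoly_value Q w \<noteq> 0 \<and> v = mpoly_value P w / mpoly_value Q w)"

definition boundary_measurement :: "plabic \<Rightarrow> (edge \<Rightarrow> real) \<Rightarrow> nat \<Rightarrow> nat \<Rightarrow> real" where
  "boundary_measurement G w i j = (THE v. series_has_value (walk_series G i j) w v)"

definition boundary_measurement_matrix :: "plabic \<Rightarrow> (edge \<Rightarrow> real) \<Rightarrow> real mat" where
  "boundary_measurement_matrix G w = mat_of_rows (nb G)
     (map (\<lambda>i. vec (nb G) (\<lambda>j.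
          if j \<in> sources G then (if j = i then 1 else 0)
          else (-1) ^ card {s \<in> sources G. min i j < s \<and> s < max i j}
                 * boundary_measurement G w i j))
       (sorted_list_of_set (sources G)))"

end

(* Eliminating the vectors at the tails of the edges turns Lam's system into (1 - T) y = b, where T
   is indexed by edges and has signed edge weights as entries, so that generic solvability is the
   nonvanishing of the polynomial det (1 - T), whose constant term is 1.

   Suppose that the matrix A is totally nonnegative for almost all positive weights. Each entry of A
   is, up to sign, a minor, and it is a quotient of two polynomials that are affine in the weight of
   any single edge. If the denominator det (1 - T) vanished at a positive value of such a weight, the
   numerator would vanish there as well, and the entry would not depend on that weight; for generic
   weights this is impossible when a boundary walk runs through the edge. Hence det (1 - T) increases
   in every weight and is at least 1 on the closed positive orthant. Weights concentrated on a simple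
   cycle or on a simple boundary walk then show that the signature determines the sign of every
   simple cycle and of every simple boundary walk.

   The geometric signature gives the same signs, because the numbers of crossings with the rays
   telescope along a walk and because a simple closed polygon sweeps across a given direction an odd
   number of times. Two signatures that agree on all boundary walks differ by a gauge
   transformation: use as gauge the difference of the signs along a walk from the boundary.
   Finally, the walk series satisfies the same linear system over a ring of formal power series,
   where Cramer's rule expresses it by the polynomials above. *)

theory Submission
  imports Defs
begin

unbundle no vec_syntax


section \<open>Determinants over finite index sets\<close>

text \<open>Vertices have degree at most 3, so no vertex has two incoming and two outgoing edges.
  Hence a path with distinct edges meets no inner vertex twice. This has two effects: for weights
  concentrated on such a path the continuation of each edge is unique, so the linear system can be
  solved along the path, and by planarity the path, once closed up, is a simple polygon.

  The parity of the sweeps is Hopf's secant argument in discrete form. For each \<open>d\<close> the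
  secants \<open>p (i + d) - p i\<close> of the polygon form a loop. Simplicity excludes vanishing
  convex combinations in the strip between the loops \<open>d\<close> and \<open>d + 1\<close>, so
  all loops have the same parity. The loop \<open>d = 1\<close> consists of the edges, and near
  \<open>d = n / 2\<close> the secants come in antipodal pairs, which makes the parity odd.

  In Postnikov's index all angles are measured from the gauge direction. The multiples of
  \<open>2 * pi\<close> lost in taking principal arguments then have the parity of the sweeps across
  that direction, the same parity that enters the geometric signature. The two signs thus agree on
  every walk, simple or not, which the comparison with the walk series requires.\<close>

definition enum_list :: "'b set \<Rightarrow> 'b list" where
  "enum_list E = (SOME xs. set xs = E \<and> distinct xs)"

lemma enum_list:
  assumes "finite E"
  shows "set (enum_list E) = E" "distinct (enum_list E)"
proof -
  have "\<exists>xs. set xs = E \<and> distinct xs"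
    using finite_distinct_list[OF assms] by blast
  from someI_ex[OF this] show "set (enum_list E) = E" "distinct (enum_list E)"
    unfolding enum_list_def by auto
qed

text \<open>The enumeration makes edges usable as row and column indices. Its choice is harmless,
  since a simultaneous permutation of rows and columns preserves the determinant.\<close>

definition set_mat :: "'b set \<Rightarrow> ('b \<Rightarrow> 'b \<Rightarrow> 'a) \<Rightarrow> 'a mat" where
  "set_mat E M = mat (length (enum_list E)) (length (enum_list E))
     (\<lambda>(i, j). M (enum_list E ! i) (enum_list E ! j))"

definition set_det :: "'b set \<Rightarrow> ('b \<Rightarrow> 'b \<Rightarrow> 'a::comm_ring_1) \<Rightarrow> 'a" where
  "set_det E M = det (set_mat E M)"

lemma set_mat_carrier:
  "set_mat E M \<in> carrier_mat (length (enum_list E)) (length (enum_list E))"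
  by (simp add: set_mat_def)

lemma enum_list_nth:
  "finite E \<Longrightarrow> i < length (enum_list E) \<Longrightarrow> enum_list E ! i \<in> E"
  using enum_list(1) nth_mem by blast

lemma enum_list_eq_iff:
  assumes "finite E" "i < length (enum_list E)" "j < length (enum_list E)"
  shows "enum_list E ! i = enum_list E ! j \<longleftrightarrow> i = j"
  by (rule nth_eq_iff_index_eq[OF enum_list(2)[OF assms(1)] assms(2,3)])

lemma enum_list_index:
  assumes "finite E" "a \<in> E"
  obtains i where "i < length (enum_list E)" "enum_list E ! i = a"
  using assms enum_list(1)[OF assms(1)] by (metis in_set_conv_nth)

lemma sum_enum_list:
  fixes h :: "'b \<Rightarrow> 'a::comm_monoid_add"
  assumes "finite E"
  shows "(\<Sum>i<length (enum_list E). h (enum_list E ! i)) = sum h E"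
  using sum_list_distinct_conv_sum_set[OF enum_list(2)[OF assms], of h] enum_list(1)[OF assms]
  by (simp add: sum_list_sum_nth atLeast0LessThan)

text \<open>In this form the determinant is visibly a polynomial in the entries, so polynomiality
  and evaluation pass from the entries to the determinant.\<close>

lemma set_det_leibniz:
  "set_det E M = (\<Sum>p | p permutes {0..<length (enum_list E)}. signof p *
     (\<Prod>i = 0..<length (enum_list E). M (enum_list E ! i) (enum_list E ! p i)))"
proof -
  have "set_det E M = (\<Sum>p | p permutes {0..<length (enum_list E)}. signof p *
     (\<Prod>i = 0..<length (enum_list E). set_mat E M $$ (i, p i)))"
    unfolding set_det_def by (rule det_def'[OF set_mat_carrier])
  also have "\<dots> = (\<Sum>p | p permutes {0..<length (enum_list E)}. signof p *
     (\<Prod>i = 0..<length (enum_list E). M (enum_list E ! i) (enum_list E ! p i)))"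
    by (intro sum.cong refl arg_cong2[where f = "(*)"] prod.cong)
       (auto simp: set_mat_def dest: permutes_in_image)
  finally show ?thesis .
qed

lemma set_mat_cong:
  assumes "finite E" "\<And>a b. a \<in> E \<Longrightarrow> b \<in> E \<Longrightarrow> M a b = N a b"
  shows "set_mat E M = set_mat E N"
  unfolding set_mat_def using assms enum_list_nth[OF assms(1)] by (intro cong_mat) auto

lemma set_det_cong:
  assumes "finite E" "\<And>a b. a \<in> E \<Longrightarrow> b \<in> E \<Longrightarrow> M a b = N a b"
  shows "set_det E M = set_det E N"
  unfolding set_det_def by (rule arg_cong[where f = det, OF set_mat_cong[OF assms]])

lemma set_det_unit:
  assumes "finite E" shows "set_det E (\<lambda>a b. if a = b then 1 else 0) = (1 :: 'a::comm_ring_1)"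
proof -
  have "set_mat E (\<lambda>a b. if a = b then 1 else 0) = (1\<^sub>m (length (enum_list E)) :: 'a mat)"
    unfolding set_mat_def
    by (rule eq_matI) (simp_all add: enum_list_eq_iff[OF assms])
  then show ?thesis by (simp add: set_det_def)
qed

lemma set_mat_mult_vec:
  fixes M :: "'b \<Rightarrow> 'b \<Rightarrow> 'a::comm_ring_1"
  assumes "finite E"
  shows "set_mat E M *\<^sub>v vec (length (enum_list E)) (\<lambda>i. y (enum_list E ! i))
     = vec (length (enum_list E)) (\<lambda>i. \<Sum>f\<in>E. M (enum_list E ! i) f * y f)"
proof (rule eq_vecI)
  fix i assume "i < dim_vec (vec (length (enum_list E)) (\<lambda>i. \<Sum>f\<in>E. M (enum_list E ! i) f * y f))"
  then have i: "i < length (enum_list E)" by simp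
  show "(set_mat E M *\<^sub>v vec (length (enum_list E)) (\<lambda>i. y (enum_list E ! i))) $ i
     = vec (length (enum_list E)) (\<lambda>i. \<Sum>f\<in>E. M (enum_list E ! i) f * y f) $ i"
    using i sum_enum_list[OF assms, of "\<lambda>f. M (enum_list E ! i) f * y f"]
    by (simp add: set_mat_def scalar_prod_def atLeast0LessThan)
qed (simp add: set_mat_def)

text \<open>Stated without division, over any commutative ring: it is applied to real weights and to
  formal power series alike.\<close>

lemma set_det_cramer:
  fixes M :: "'b \<Rightarrow> 'b \<Rightarrow> 'a::comm_ring_1"
  assumes fin: "finite E" and sol: "\<And>e. e \<in> E \<Longrightarrow> (\<Sum>f\<in>E. M e f * y f) = b e" and a: "a \<in> E"
  shows "set_det E (\<lambda>e f. if f = a then b e else M e f) = set_det E M * y a"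
proof -
  let ?n = "length (enum_list E)" and ?es = "enum_list E"
  obtain k where k: "k < ?n" "?es ! k = a" using enum_list_index[OF fin a] .
  let ?y = "vec ?n (\<lambda>i. y (?es ! i))"
  have *: "replace_col (set_mat E M) (set_mat E M *\<^sub>v ?y) k
     = set_mat E (\<lambda>e f. if f = a then b e else M e f)"
    unfolding set_mat_mult_vec[OF fin]
  proof (rule eq_matI)
    fix i j assume "i < dim_row (set_mat E (\<lambda>e f. if f = a then b e else M e f))"
      "j < dim_col (set_mat E (\<lambda>e f. if f = a then b e else M e f))"
    then have ij: "i < ?n" "j < ?n" by (auto simp: set_mat_def)
    have "?es ! j = a \<longleftrightarrow> j = k" using enum_list_eq_iff[OF fin ij(2) k(1)] k(2) by simp
    then show "replace_col (set_mat E M) (vec ?n (\<lambda>i. \<Sum>f\<in>E. M (?es ! i) f * y f)) k $$ (i, j)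
      = set_mat E (\<lambda>e f. if f = a then b e else M e f) $$ (i, j)"
      using ij sol[OF enum_list_nth[OF fin ij(1)]] by (simp add: replace_col_def set_mat_def)
  qed (simp_all add: replace_col_def set_mat_def)
  have "det (replace_col (set_mat E M) (set_mat E M *\<^sub>v ?y) k) = ?y $ k * det (set_mat E M)"
    by (rule cramer_lemma_mat[OF set_mat_carrier _ k(1)]) simp
  then show ?thesis unfolding * set_det_def using k by (simp add: mult.commute)
qed

lemma set_det_solvable:
  fixes M :: "'b \<Rightarrow> 'b \<Rightarrow> 'a::field"
  assumes fin: "finite E" and nz: "set_det E M \<noteq> 0"
  obtains y where "\<And>e. e \<in> E \<Longrightarrow> (\<Sum>f\<in>E. M e f * y f) = b e"
proof -
  let ?n = "length (enum_list E)" and ?es = "enum_list E"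
  let ?A = "set_mat E M" and ?b = "vec ?n (\<lambda>i. b (?es ! i))"
  have "?A \<in> Units (ring_mat TYPE('a) ?n undefined)"
    by (rule det_non_zero_imp_unit[OF set_mat_carrier nz[unfolded set_det_def]])
  then obtain B where B: "B \<in> carrier_mat ?n ?n" "?A * B = 1\<^sub>m ?n"
    unfolding Units_def ring_mat_def by auto
  define v where "v = B *\<^sub>v ?b"
  have v: "v \<in> carrier_vec ?n" unfolding v_def using B(1) by (simp add: mult_mat_vec_carrier)
  have Av: "?A *\<^sub>v v = ?b"
    unfolding v_def
    by (subst assoc_mult_mat_vec[symmetric, OF set_mat_carrier B(1)]) (simp_all add: B(2))
  define y where "y f = v $ (THE i. i < ?n \<and> ?es ! i = f)" for f
  have y: "y (?es ! i) = v $ i" if "i < ?n" for i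
  proof -
    have "(THE k. k < ?n \<and> ?es ! k = ?es ! i) = i"
      using that nth_eq_iff_index_eq[OF enum_list(2)[OF fin]] by (intro the_equality) auto
    then show ?thesis by (simp add: y_def)
  qed
  have "v = vec ?n (\<lambda>i. y (?es ! i))" using v y by (intro eq_vecI) auto
  then have eq: "vec ?n (\<lambda>i. \<Sum>f\<in>E. M (?es ! i) f * y f) = ?b"
    using Av set_mat_mult_vec[OF fin, of M y] by simp
  show thesis
  proof (rule that[of y])
    fix e assume "e \<in> E"
    from enum_list_index[OF fin this] obtain i where "i < ?n" "?es ! i = e" .
    with arg_cong[OF eq, of "\<lambda>v. v $ i"] show "(\<Sum>f\<in>E. M e f * y f) = b e" by simp
  qed
qed

lemma set_det_nonzeroI:
  fixes M :: "'b \<Rightarrow> 'b \<Rightarrow> 'a::field"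
  assumes fin: "finite E"
    and inj: "\<And>y. (\<And>e. e \<in> E \<Longrightarrow> (\<Sum>f\<in>E. M e f * y f) = 0) \<Longrightarrow> \<forall>e\<in>E. y e = 0"
  shows "set_det E M \<noteq> 0"
proof
  let ?n = "length (enum_list E)" and ?es = "enum_list E"
  assume "set_det E M = 0"
  then obtain v where v: "v \<in> carrier_vec ?n" "v \<noteq> 0\<^sub>v ?n" "set_mat E M *\<^sub>v v = 0\<^sub>v ?n"
    unfolding set_det_def using det_0_iff_vec_prod_zero_field[OF set_mat_carrier] by blast
  define y where "y f = v $ (THE i. i < ?n \<and> ?es ! i = f)" for f
  have y: "y (?es ! i) = v $ i" if "i < ?n" for i
  proof -
    have "(THE k. k < ?n \<and> ?es ! k = ?es ! i) = i"
      using that nth_eq_iff_index_eq[OF enum_list(2)[OF fin]] by (intro the_equality) auto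
    then show ?thesis by (simp add: y_def)
  qed
  have vy: "v = vec ?n (\<lambda>i. y (?es ! i))" using v y by (intro eq_vecI) auto
  have eq: "vec ?n (\<lambda>i. \<Sum>f\<in>E. M (?es ! i) f * y f) = 0\<^sub>v ?n"
    using v(3) set_mat_mult_vec[OF fin, of M y] vy by simp
  have "\<forall>e\<in>E. y e = 0"
  proof (rule inj)
    fix e assume "e \<in> E"
    from enum_list_index[OF fin this] obtain i where "i < ?n" "?es ! i = e" .
    with arg_cong[OF eq, of "\<lambda>v. v $ i"] show "(\<Sum>f\<in>E. M e f * y f) = 0" by simp
  qed
  then have "v = 0\<^sub>v ?n" unfolding vy using enum_list_nth[OF fin] by (intro eq_vecI) auto
  with v(2) show False by simp
qed

text \<open>Laplace expansion along column \<open>a\<close>: the cofactors come from the other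
  columns, so the determinant is linear in this one.\<close>

lemma set_det_col_affine:
  fixes M :: "'b \<Rightarrow> 'b \<Rightarrow> 'a::comm_ring_1"
  assumes fin: "finite E" and a: "a \<in> E"
  shows "set_det E (\<lambda>e f. if f = a then p e + t * q e else M e f)
    = set_det E (\<lambda>e f. if f = a then p e else M e f)
      + t * set_det E (\<lambda>e f. if f = a then q e else M e f)"
proof -
  let ?n = "length (enum_list E)" and ?es = "enum_list E"
  obtain k where k: "k < ?n" "?es ! k = a" using enum_list_index[OF fin a] .
  let ?N = "\<lambda>r. set_mat E (\<lambda>e f. if f = a then r e else M e f)"
  have del: "mat_delete (?N r) i k = mat_delete (?N r') i k" for r r' i
  proof -
    have "?es ! j \<noteq> a" if "j < ?n" "j \<noteq> k" for j
      using enum_list_eq_iff[OF fin that(1) k(1)] k(2) that(2) by simp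
    then show ?thesis unfolding mat_delete_def set_mat_def by (intro cong_mat) simp_all
  qed
  have cof: "cofactor (?N r) i k = cofactor (?N p) i k" for r i
    unfolding cofactor_def by (simp only: del[of r i p])
  have ex: "det (?N r) = (\<Sum>i<?n. r (?es ! i) * cofactor (?N p) i k)" for r
  proof -
    have "det (?N r) = (\<Sum>i<?n. ?N r $$ (i, k) * cofactor (?N r) i k)"
      by (rule laplace_expansion_column[OF set_mat_carrier k(1)])
    also have "\<dots> = (\<Sum>i<?n. r (?es ! i) * cofactor (?N p) i k)"
      using k by (intro sum.cong refl arg_cong2[where f = "(*)"] cof) (auto simp: set_mat_def)
    finally show ?thesis .
  qed
  show ?thesis unfolding set_det_def ex[of p] ex[of q] ex[of "\<lambda>e. p e + t * q e"]
    by (simp add: sum_distrib_left sum.distrib algebra_simps)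
qed

section \<open>Polynomial functions\<close>

text \<open>The inductive closure lets continuity, measurability and restriction to a line be proved
  by rule induction, with polynomials treated as functions of the weights.\<close>

inductive polyfun :: "'a set \<Rightarrow> (('a \<Rightarrow> real) \<Rightarrow> real) \<Rightarrow> bool" for E where
  const: "polyfun E (\<lambda>w. c)"
| var: "a \<in> E \<Longrightarrow> polyfun E (\<lambda>w. w a)"
| add: "polyfun E f \<Longrightarrow> polyfun E g \<Longrightarrow> polyfun E (\<lambda>w. f w + g w)"
| mult: "polyfun E f \<Longrightarrow> polyfun E g \<Longrightarrow> polyfun E (\<lambda>w. f w * g w)"

lemma polyfun_sum: "(\<And>x. x \<in> A \<Longrightarrow> polyfun E (f x)) \<Longrightarrow> polyfun E (\<lambda>w. \<Sum>x\<in>A. f x w)"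
  by (induction A rule: infinite_finite_induct) (auto intro: polyfun.intros)

lemma polyfun_prod: "(\<And>x. x \<in> A \<Longrightarrow> polyfun E (f x)) \<Longrightarrow> polyfun E (\<lambda>w. \<Prod>x\<in>A. f x w)"
  by (induction A rule: infinite_finite_induct) (auto intro: polyfun.intros)

lemma polyfun_set_det:
  assumes "finite E" "\<And>a b. a \<in> E \<Longrightarrow> b \<in> E \<Longrightarrow> polyfun F (\<lambda>w. M w a b)"
  shows "polyfun F (\<lambda>w. set_det E (M w))"
  unfolding set_det_leibniz
proof (intro polyfun_sum polyfun.mult polyfun_prod polyfun.const assms(2))
  fix p i assume "p \<in> {p. p permutes {0..<length (enum_list E)}}" "i \<in> {0..<length (enum_list E)}"
  then show "enum_list E ! i \<in> E" "enum_list E ! p i \<in> E"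
    using permutes_in_image[of p "{0..<length (enum_list E)}" i] by (auto intro!: enum_list_nth[OF assms(1)])
qed

lemma polyfun_cong: "polyfun E h \<Longrightarrow> (\<And>a. a \<in> E \<Longrightarrow> v a = w a) \<Longrightarrow> h v = h w"
  by (induction rule: polyfun.induct) auto

lemma polyfun_continuous: "polyfun E h \<Longrightarrow> continuous_on UNIV h"
proof (induction rule: polyfun.induct)
  case (var a)
  show ?case by (rule continuous_on_product_coordinates)
qed (auto intro!: continuous_intros)

lemma polyfun_line:
  assumes "polyfun E h"
  shows "\<exists>q :: real poly. \<forall>t. h (\<lambda>a. u a + t * v a) = poly q t"
  using assms
proof (induction rule: polyfun.induct)
  case (const c) show ?case by (rule exI[of _ "[:c:]"]) simp
next
  case (var a) show ?case by (rule exI[of _ "[:u a, v a:]"]) simp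
next
  case (add f g) then show ?case by (metis poly_add)
next
  case (mult f g) then show ?case by (metis poly_mult)
qed

lemma polyfun_subst:
  assumes "polyfun (insert b E) h"
  shows "polyfun E (\<lambda>w. h (w(b := t)))"
  using assms
proof (induction rule: polyfun.induct)
  case (var a) show ?case using var by (cases "a = b") (auto intro: polyfun.intros)
qed (auto intro: polyfun.intros)

lemma polyfun_measurable: "polyfun E h \<Longrightarrow> h \<in> borel_measurable (PiM E (\<lambda>_. lborel))"
proof (induction rule: polyfun.induct)
  case (var a)
  have "(\<lambda>w. w a) \<in> measurable (PiM E (\<lambda>_. lborel)) lborel"
    by (rule measurable_component_singleton[OF var])
  then show ?case by simp
qed auto

text \<open>Fubini, one variable at a time: for almost all values of the other variables
  \<open>h\<close> is a nonzero univariate polynomial in the last one, with finitely many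
  roots.\<close>

lemma polyfun_AE_nonzero:
  assumes "finite E" "polyfun E h" "h w0 \<noteq> 0"
  shows "AE w in PiM E (\<lambda>_. lborel). h w \<noteq> 0"
  using assms
proof (induction E arbitrary: h w0 rule: finite_induct)
  case empty
  have "h w \<noteq> 0" for w using polyfun_cong[OF empty(1), of w w0] empty(2) by simp
  then show ?case by simp
next
  case (insert b E)
  interpret product_sigma_finite "\<lambda>_. lborel :: real measure" by unfold_locales
  have q: "polyfun E (\<lambda>w. h (w(b := w0 b)))" by (rule polyfun_subst[OF insert.prems(1)])
  have AE1: "AE w in PiM E (\<lambda>_. lborel). h (w(b := w0 b)) \<noteq> 0"
    by (rule insert.IH[OF q, of w0]) (use insert.prems(2) in simp)
  have meas: "{w \<in> space (PiM (insert b E) (\<lambda>_. lborel)). h w = 0} \<in> sets (PiM (insert b E) (\<lambda>_. lborel))"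
    using polyfun_measurable[OF insert.prems(1)] by measurable
  let ?Z = "{w \<in> space (PiM (insert b E) (\<lambda>_. lborel)). h w = 0}"
  have "emeasure (PiM (insert b E) (\<lambda>_. lborel)) ?Z
      = (\<integral>\<^sup>+ w. indicator ?Z w \<partial>PiM (insert b E) (\<lambda>_. lborel))"
    by (rule nn_integral_indicator[OF meas, symmetric])
  also have "\<dots> = (\<integral>\<^sup>+ w. \<integral>\<^sup>+ t. indicator ?Z (w(b := t)) \<partial>lborel \<partial>PiM E (\<lambda>_. lborel))"
    by (rule product_nn_integral_insert[OF insert.hyps(1,2)]) (use meas in measurable)
  also have "\<dots> = (\<integral>\<^sup>+ w. 0 \<partial>PiM E (\<lambda>_. lborel :: real measure))"
  proof (rule nn_integral_cong_AE)
    show "AE w in PiM E (\<lambda>_. lborel). (\<integral>\<^sup>+ t. indicator ?Z (w(b := t)) \<partial>lborel) = 0"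
      using AE1
    proof eventually_elim
      case (elim w)
      obtain r where r: "\<And>t. h (\<lambda>a. (w(b := 0)) a + t * (if a = b then 1 else 0)) = poly r t"
        using polyfun_line[OF insert.prems(1), of "w(b := 0)" "\<lambda>a. if a = b then 1 else 0"] by blast
      have r': "h (w(b := t)) = poly r t" for t
      proof -
        have "(\<lambda>a. (w(b := 0)) a + t * (if a = b then 1 else 0)) = w(b := t)" by auto
        then show ?thesis using r[of t] by simp
      qed
      have "r \<noteq> 0" using elim r' by auto
      then have fin: "finite {t. poly r t = 0}" by (rule poly_roots_finite)
      have "(\<integral>\<^sup>+ t. indicator ?Z (w(b := t)) \<partial>lborel) \<le> (\<integral>\<^sup>+ t. indicator {t. poly r t = 0} t \<partial>lborel)"
        by (intro nn_integral_mono) (auto simp: indicator_def r')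
      also have "\<dots> = emeasure lborel {t. poly r t = 0}"
        by (rule nn_integral_indicator) (use fin in \<open>simp add: finite_imp_closed\<close>)
      also have "\<dots> = 0" using fin by (simp add: emeasure_lborel_countable countable_finite)
      finally show ?case by simp
    qed
  qed
  finally have "emeasure (PiM (insert b E) (\<lambda>_. lborel)) ?Z = 0" by simp
  then show ?case by (subst AE_iff_measurable[OF meas]) auto
qed

text \<open>Two limits along lines. From an interior point the line towards \<open>w0\<close> meets
  the zeros of \<open>d\<close> only finitely often; from a boundary point the direction
  \<open>(1, ..., 1)\<close> leads into the interior. Nonnegativity passes to both limits.\<close>

lemma polyfun_dense_nonneg:
  assumes h: "polyfun E h" and d: "polyfun E d" "d w0 \<noteq> 0"
    and pos: "\<And>w. (\<And>a. 0 < w a) \<Longrightarrow> d w \<noteq> 0 \<Longrightarrow> 0 \<le> h w"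
    and fin: "finite E" and w: "\<And>a. 0 \<le> w a"
  shows "0 \<le> h w"
proof -
  have step: "0 \<le> h w" if w: "\<And>a. 0 < w a" for w
  proof -
    obtain r where r: "\<And>t. d (\<lambda>a. w a + t * (w0 a - w a)) = poly r t"
      using polyfun_line[OF d(1), of w "\<lambda>a. w0 a - w a"] by blast
    obtain s where s: "\<And>t. h (\<lambda>a. w a + t * (w0 a - w a)) = poly s t"
      using polyfun_line[OF h, of w "\<lambda>a. w0 a - w a"] by blast
    have "poly r 1 \<noteq> 0" using d(2) r[of 1] by simp
    then have "r \<noteq> 0" by auto
    then have "finite {t. poly r t = 0}" by (rule poly_roots_finite)
    then have ev1: "\<forall>\<^sub>F t in at_right 0. \<forall>x\<in>{t. poly r t = 0}. t \<noteq> x"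
      by (intro eventually_ball_finite ballI eventually_neq_at_within)
    have ev2: "\<forall>\<^sub>F t in at_right 0. \<forall>a\<in>E. 0 < w a + t * (w0 a - w a)"
    proof (intro eventually_ball_finite[OF fin] ballI)
      fix a
      have "((\<lambda>t. w a + t * (w0 a - w a)) \<longlongrightarrow> w a + 0 * (w0 a - w a)) (at_right 0)"
        by (intro tendsto_intros)
      then show "\<forall>\<^sub>F t in at_right 0. 0 < w a + t * (w0 a - w a)"
        using order_tendstoD(1)[of _ "w a" "at_right 0" 0] w[of a] by simp
    qed
    have ev3: "\<forall>\<^sub>F t in at_right 0. (0::real) < t" by (rule eventually_at_right_less)
    have "\<forall>\<^sub>F t in at_right 0. 0 \<le> poly s t"
      using ev1 ev2 ev3
    proof eventually_elim
      case (elim t)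
      let ?u = "\<lambda>a. w a + t * (w0 a - w a)"
      \<comment> \<open>Positivity for small \<open>t\<close> is uniform only on the finite set
        \<open>E\<close>; the other coordinates are reset to 1, which changes neither
        \<open>h\<close> nor \<open>d\<close>.\<close>
      let ?u' = "\<lambda>a. if a \<in> E then ?u a else 1"
      have "h ?u' = h ?u" "d ?u' = d ?u" by (rule polyfun_cong[OF h], simp, rule polyfun_cong[OF d(1)], simp)
      moreover have "0 \<le> h ?u'"
        by (rule pos) (use elim r[of t] \<open>d ?u' = d ?u\<close> in auto)
      ultimately show ?case using s[of t] by simp
    qed
    moreover have "(poly s \<longlongrightarrow> poly s 0) (at_right 0)"
      by (intro tendsto_intros)
    ultimately have "0 \<le> poly s 0"
      using tendsto_lowerbound trivial_limit_at_right_real by blast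
    then show ?thesis using s[of 0] by simp
  qed
  obtain s where s: "\<And>t. h (\<lambda>a. w a + t * 1) = poly s t"
    using polyfun_line[OF h, of w "\<lambda>_. 1"] by blast
  have "\<forall>\<^sub>F t in at_right 0. (0::real) < t" by (rule eventually_at_right_less)
  then have "\<forall>\<^sub>F t in at_right 0. 0 \<le> poly s t"
  proof eventually_elim
    case (elim t)
    have "0 \<le> h (\<lambda>a. w a + t * 1)" by (rule step) (use elim w in \<open>simp add: add_nonneg_pos\<close>)
    then show ?case using s by simp
  qed
  moreover have "(poly s \<longlongrightarrow> poly s 0) (at_right 0)" by (intro tendsto_intros)
  ultimately have "0 \<le> poly s 0"
    using tendsto_lowerbound trivial_limit_at_right_real by blast
  then show ?thesis using s[of 0] by simp
qed

text \<open>A nonempty open box has positive measure, so it is not contained in a null set.\<close>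

lemma AE_PiM_box:
  assumes fin: "finite E" and ae: "AE w in PiM E (\<lambda>_. lborel :: real measure). P w"
    and X: "\<And>a. a \<in> E \<Longrightarrow> open (X a)" "\<And>a. a \<in> E \<Longrightarrow> X a \<noteq> {}"
  obtains w where "w \<in> PiE E X" "P w"
proof -
  interpret product_sigma_finite "\<lambda>_. lborel :: real measure" by unfold_locales
  have "emeasure (PiM E (\<lambda>_. lborel)) (PiE E X) = (\<Prod>a\<in>E. emeasure lborel (X a))"
    by (rule emeasure_PiM[OF fin]) (use X in auto)
  moreover have "emeasure lborel (X a) \<noteq> 0" if a: "a \<in> E" for a
  proof -
    obtain x where "x \<in> X a" using X(2)[OF a] by blast
    then obtain r where "r > 0" "ball x r \<subseteq> X a" using X(1)[OF a] openE by blast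
    then have "{x - r<..<x + r} \<subseteq> X a" by (auto simp: ball_eq_greaterThanLessThan)
    then have "emeasure lborel {x - r<..<x + r} \<le> emeasure lborel (X a)"
      by (rule emeasure_mono) (use X(1)[OF a] in simp)
    moreover have "emeasure lborel {x - r<..<x + r} > 0" using \<open>r > 0\<close> by simp
    ultimately show ?thesis by auto
  qed
  ultimately have pos: "emeasure (PiM E (\<lambda>_. lborel)) (PiE E X) \<noteq> 0" using fin by (simp add: prod_zero_iff)
  have sets: "PiE E X \<in> sets (PiM E (\<lambda>_. lborel))" using fin X by (intro sets_PiM_I_finite) auto
  show thesis
  proof (rule ccontr)
    assume "\<not> thesis"
    then have no: "\<not> P w" if "w \<in> PiE E X" for w using that \<open>\<And>w. w \<in> PiE E X \<Longrightarrow> P w \<Longrightarrow> thesis\<close> by blast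
    from ae obtain N where N: "{w \<in> space (PiM E (\<lambda>_. lborel)). \<not> P w} \<subseteq> N" "emeasure (PiM E (\<lambda>_. lborel)) N = 0"
      "N \<in> sets (PiM E (\<lambda>_. lborel))" by (rule AE_E)
    have "PiE E X \<subseteq> N" using no N(1) sets.sets_into_space[OF sets] by blast
    then have "emeasure (PiM E (\<lambda>_. lborel)) (PiE E X) \<le> 0"
      using emeasure_mono[OF _ N(3)] N(2) by metis
    with pos show False by simp
  qed
qed

text \<open>A negative value would persist on an open box of positive weights by continuity, and
  such a box contains points where the almost sure inequality holds.\<close>

lemma AE_polyfun_nonneg:
  assumes fin: "finite E" and h: "polyfun E h"
    and ae: "AE w in PiM E (\<lambda>_. lborel). (\<forall>a\<in>E. 0 < w a) \<longrightarrow> 0 \<le> h w"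
    and w: "\<And>a. a \<in> E \<Longrightarrow> 0 < w a"
  shows "0 \<le> h w"
proof (rule ccontr)
  assume "\<not> 0 \<le> h w"
  then have wU: "w \<in> h -` {..<0}" by simp
  have "open (h -` {..<0})" using polyfun_continuous[OF h] by (intro open_vimage) auto
  then have "openin (product_topology (\<lambda>_. euclidean) UNIV) (h -` {..<0})"
    unfolding open_fun_def .
  from product_topology_open_contains_basis[OF this wU] obtain X where
    X: "w \<in> (\<Pi>\<^sub>E i\<in>UNIV. X i)" "\<And>i. openin euclidean (X i)" "(\<Pi>\<^sub>E i\<in>UNIV. X i) \<subseteq> h -` {..<0}" by auto
  obtain v where v: "v \<in> (\<Pi>\<^sub>E a\<in>E. X a \<inter> {0<..})" "(\<forall>a\<in>E. 0 < v a) \<longrightarrow> 0 \<le> h v"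
  proof (rule AE_PiM_box[OF fin ae])
    show "open (X a \<inter> {0<..})" for a using X(2)[of a] by (auto intro: open_Int)
    show "X a \<inter> {0<..} \<noteq> {}" if "a \<in> E" for a using X(1) w[OF that] by (auto simp: PiE_iff)
  qed
  \<comment> \<open>The basic open set constrains all coordinates, while \<open>v\<close> is
    controlled only on \<open>E\<close>; outside \<open>E\<close> the values of \<open>w\<close> are
    used.\<close>
  have "(\<lambda>a. if a \<in> E then v a else w a) \<in> (\<Pi>\<^sub>E i\<in>UNIV. X i)" using v(1) X(1) by (auto simp: PiE_iff)
  then have "h (\<lambda>a. if a \<in> E then v a else w a) < 0" using X(3) by auto
  moreover have "h (\<lambda>a. if a \<in> E then v a else w a) = h v" by (rule polyfun_cong[OF h]) simp
  moreover have "0 \<le> h v" using v by (auto simp: PiE_iff)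
  ultimately show False by simp
qed

section \<open>Formal power series with monomials indexed by multisets\<close>

text \<open>Coefficient functions get a type of their own so that they form a
  \<open>comm_ring_1\<close>, the class required by \<open>set_det_cramer\<close>.\<close>

typedef 'a mseries = "UNIV :: ('a multiset \<Rightarrow> real) set"
  morphisms coef mser by auto

lemmas coef_mser [simp] = mser_inverse[OF UNIV_I]

lemma mseries_eqI: "(\<And>m. coef F m = coef G m) \<Longrightarrow> F = G"
  using coef_inject by blast

lemma finite_submultisets [simp]: "finite {a. a \<subseteq># (m :: 'a multiset)}"
proof -
  have "{a. a \<subseteq># m} \<subseteq> (\<lambda>f. Abs_multiset f) ` {f. (\<forall>x. f x \<le> count m x) \<and> (\<forall>x. x \<notin> set_mset m \<longrightarrow> f x = 0)}"
  proof
    fix a assume "a \<in> {a. a \<subseteq># m}"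
    then have "a = Abs_multiset (count a)" "\<forall>x. count a x \<le> count m x"
      by (auto simp: count_inverse subseteq_mset_def)
    moreover from this(2) have "\<forall>x. x \<notin> set_mset m \<longrightarrow> count a x = 0"
      by (metis le_zero_eq not_in_iff)
    ultimately show "a \<in> (\<lambda>f. Abs_multiset f) ` {f. (\<forall>x. f x \<le> count m x) \<and> (\<forall>x. x \<notin> set_mset m \<longrightarrow> f x = 0)}"
      by blast
  qed
  moreover have "finite {f. (\<forall>x. f x \<le> count m x) \<and> (\<forall>x. x \<notin> set_mset m \<longrightarrow> f x = 0)}"
  proof (rule finite_subset)
    let ?N = "Max (insert 0 (count m ` set_mset m))"
    show "{f. (\<forall>x. f x \<le> count m x) \<and> (\<forall>x. x \<notin> set_mset m \<longrightarrow> f x = 0)}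
      \<subseteq> {f. \<forall>x. (x \<in> set_mset m \<longrightarrow> f x \<in> {..?N}) \<and> (x \<notin> set_mset m \<longrightarrow> f x = 0)}"
    proof safe
      fix f x assume f: "\<forall>x. f x \<le> count m x" and x: "x \<in># m"
      have "count m x \<le> ?N" using x by (intro Max_ge) auto
      with f show "f x \<le> ?N" using le_trans by blast
    qed auto
    show "finite {f. \<forall>x. (x \<in> set_mset m \<longrightarrow> f x \<in> {..?N}) \<and> (x \<notin> set_mset m \<longrightarrow> f x = 0)}"
      by (rule finite_set_of_finite_funs) auto
  qed
  ultimately show ?thesis by (rule finite_subset[OF _ finite_imageI])
qed

instantiation mseries :: (type) comm_ring_1
begin

definition "0 = mser (\<lambda>_. 0)"
definition "1 = mser (\<lambda>m. if m = {#} then 1 else 0)"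
definition "F + G = mser (\<lambda>m. coef F m + coef G m)"
definition "- F = mser (\<lambda>m. - coef F m)"
definition "F - G = mser (\<lambda>m. coef F m - coef G m)"
definition "F * G = mser (\<lambda>m. \<Sum>a | a \<subseteq># m. coef F a * coef G (m - a))"

instance
proof
  fix F G H :: "'a mseries"
  show "F * G * H = F * (G * H)"
  proof (rule mseries_eqI)
    fix m
    have "coef (F * G * H) m = (\<Sum>a | a \<subseteq># m. \<Sum>b | b \<subseteq># a. coef F b * coef G (a - b) * coef H (m - a))"
      by (simp add: times_mseries_def sum_distrib_right)
    also have "\<dots> = (\<Sum>(a, b) \<in> (SIGMA a:{a. a \<subseteq># m}. {b. b \<subseteq># a}). coef F b * coef G (a - b) * coef H (m - a))"
      by (subst sum.Sigma) auto
    also have "\<dots> = (\<Sum>(b, c) \<in> (SIGMA b:{b. b \<subseteq># m}. {c. c \<subseteq># m - b}). coef F b * (coef G c * coef H (m - b - c)))"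
    \<comment> \<open>Both sums run over the decompositions of \<open>m\<close> into three parts;
      \<open>a\<close> is the union of the first two.\<close>
    proof (rule sum.reindex_bij_witness[of _ "\<lambda>(b, c). (b + c, b)" "\<lambda>(a, b). (b, a - b)"])
      fix x assume x: "x \<in> (SIGMA a:{a. a \<subseteq># m}. {b. b \<subseteq># a})"
      obtain a b where ab: "x = (a, b)" by (cases x)
      with x have s: "a \<subseteq># m" "b \<subseteq># a" by auto
      then obtain c d where c: "a = b + c" and d: "m = b + c + d" by (metis subset_mset.le_iff_add)
      show "(case case x of (a, b) \<Rightarrow> (b, a - b) of (b, c) \<Rightarrow> (b + c, b)) = x"
        "(case x of (a, b) \<Rightarrow> (b, a - b)) \<in> (SIGMA b:{b. b \<subseteq># m}. {c. c \<subseteq># m - b})"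
        "(case case x of (a, b) \<Rightarrow> (b, a - b) of (b, c) \<Rightarrow> coef F b * (coef G c * coef H (m - b - c)))
          = (case x of (a, b) \<Rightarrow> coef F b * coef G (a - b) * coef H (m - a))"
        unfolding ab c d by (auto simp: add.assoc diff_diff_add_mset mult.assoc)
    next
      fix y assume "y \<in> (SIGMA b:{b. b \<subseteq># m}. {c. c \<subseteq># m - b})"
      then show "(case case y of (b, c) \<Rightarrow> (b + c, b) of (a, b) \<Rightarrow> (b, a - b)) = y"
        "(case y of (b, c) \<Rightarrow> (b + c, b)) \<in> (SIGMA a:{a. a \<subseteq># m}. {b. b \<subseteq># a})"
        by (auto simp: subset_mset.le_diff_conv2 add_ac)
    qed
    also have "\<dots> = (\<Sum>b | b \<subseteq># m. \<Sum>c | c \<subseteq># m - b. coef F b * (coef G c * coef H (m - b - c)))"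
      by (subst sum.Sigma) auto
    also have "\<dots> = coef (F * (G * H)) m"
      by (simp add: times_mseries_def sum_distrib_left)
    finally show "coef (F * G * H) m = coef (F * (G * H)) m" .
  qed
  show "F * G = G * F"
  proof (rule mseries_eqI)
    fix m :: "'a multiset"
    have dd: "m - (m - a) = a" if "a \<subseteq># m" for a
      using that by (intro multiset_eqI) (auto simp: subseteq_mset_def)
    have "(\<Sum>a | a \<subseteq># m. coef F a * coef G (m - a)) = (\<Sum>a | a \<subseteq># m. coef G a * coef F (m - a))"
      by (rule sum.reindex_bij_witness[of _ "\<lambda>a. m - a" "\<lambda>a. m - a"])
         (auto simp: dd mult.commute)
    then show "coef (F * G) m = coef (G * F) m" by (simp add: times_mseries_def)
  qed
  show "1 * F = F"
  proof (rule mseries_eqI)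
    fix m
    have "(\<Sum>a | a \<subseteq># m. (if a = {#} then 1 else 0) * coef F (m - a))
      = (\<Sum>a | a \<subseteq># m. if a = {#} then coef F m else 0)"
      by (intro sum.cong) auto
    then show "coef (1 * F) m = coef F m" by (simp add: times_mseries_def one_mseries_def)
  qed
  show "(F + G) * H = F * H + G * H"
    by (rule mseries_eqI) (simp add: times_mseries_def plus_mseries_def sum.distrib algebra_simps)
  show "(0::'a mseries) \<noteq> 1"
  proof
    assume "(0::'a mseries) = 1"
    then have "coef (0::'a mseries) {#} = coef 1 {#}" by simp
    then show False by (simp add: zero_mseries_def one_mseries_def)
  qed
qed (auto intro!: mseries_eqI simp: plus_mseries_def zero_mseries_def uminus_mseries_def minus_mseries_def)

end

lemma coef_simps [simp]:
  "coef 0 m = 0" "coef 1 m = (if m = {#} then 1 else 0)"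
  "coef (F + G) m = coef F m + coef G m" "coef (- F) m = - coef F m"
  "coef (F - G) m = coef F m - coef G m"
  by (simp_all add: plus_mseries_def zero_mseries_def uminus_mseries_def minus_mseries_def one_mseries_def)

lemma coef_mult: "coef (F * G) m = (\<Sum>a | a \<subseteq># m. coef F a * coef G (m - a))"
  by (simp add: times_mseries_def)

lemma coef_sum: "coef (\<Sum>x\<in>A. F x) m = (\<Sum>x\<in>A. coef (F x) m)"
  by (induction A rule: infinite_finite_induct) auto

section \<open>Polynomials among the series and their values\<close>

definition mlin :: "real \<Rightarrow> 'a \<Rightarrow> 'a mseries" where
  "mlin c e = mser (\<lambda>m. if m = {#e#} then c else 0)"

lemma coef_mlin [simp]: "coef (mlin c e) m = (if m = {#e#} then c else 0)"
  by (simp add: mlin_def)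

lemma coef_mlin_mult: "coef (mlin c e * F) m = (if e \<in># m then c * coef F (m - {#e#}) else 0)"
proof -
  have "coef (mlin c e * F) m = (\<Sum>a | a \<subseteq># m. if a = {#e#} then c * coef F (m - {#e#}) else 0)"
    unfolding coef_mult by (intro sum.cong) auto
  then show ?thesis by simp
qed

definition is_mpoly :: "'a mseries \<Rightarrow> bool" where
  "is_mpoly F \<longleftrightarrow> finite {m. coef F m \<noteq> 0}"

definition mval :: "('a \<Rightarrow> real) \<Rightarrow> 'a mseries \<Rightarrow> real" where
  "mval w F = mpoly_value (coef F) w"

lemma mval_superset:
  assumes "finite A" "{m. coef F m \<noteq> 0} \<subseteq> A"
  shows "mval w F = (\<Sum>m\<in>A. coef F m * (\<Prod>e\<in>#m. w e))"
  unfolding mval_def mpoly_value_def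
  by (rule sum.mono_neutral_left) (use assms in auto)

lemma is_mpoly_add: "is_mpoly F \<Longrightarrow> is_mpoly G \<Longrightarrow> is_mpoly (F + G)"
  unfolding is_mpoly_def
  by (rule finite_subset[of _ "{m. coef F m \<noteq> 0} \<union> {m. coef G m \<noteq> 0}"]) auto

lemma mval_add:
  assumes fin: "is_mpoly F" "is_mpoly G"
  shows "mval w (F + G) = mval w F + mval w G"
proof -
  let ?A = "{m. coef F m \<noteq> 0} \<union> {m. coef G m \<noteq> 0}"
  have A: "finite ?A" using fin by (simp add: is_mpoly_def)
  have "mval w (F + G) = (\<Sum>m\<in>?A. coef (F + G) m * (\<Prod>e\<in>#m. w e))"
    "mval w F = (\<Sum>m\<in>?A. coef F m * (\<Prod>e\<in>#m. w e))" "mval w G = (\<Sum>m\<in>?A. coef G m * (\<Prod>e\<in>#m. w e))"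
    by (rule mval_superset[OF A], auto)+
  then show ?thesis by (simp add: algebra_simps sum.distrib)
qed

lemma is_mpoly_uminus: "is_mpoly F \<Longrightarrow> is_mpoly (- F)"
  by (simp add: is_mpoly_def)

lemma mval_uminus: "mval w (- F) = - mval w F"
  by (simp add: mval_def mpoly_value_def sum_negf)

lemma is_mpoly_simps [simp]:
  "is_mpoly (0::'a mseries)" "is_mpoly (1::'a mseries)" "is_mpoly (mlin c (e::'a))"
proof -
  have "finite {m. coef (1::'a mseries) m \<noteq> 0}" by (rule finite_subset[of _ "{{#}}"]) auto
  moreover have "finite {m. coef (mlin c (e::'a)) m \<noteq> 0}" by (rule finite_subset[of _ "{{#e#}}"]) auto
  ultimately show "is_mpoly (0::'a mseries)" "is_mpoly (1::'a mseries)" "is_mpoly (mlin c e)"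
    by (auto simp: is_mpoly_def)
qed

lemma mval_simps [simp]: "mval w 0 = 0" "mval w 1 = 1" "mval w (mlin c e) = c * w e"
proof -
  show "mval w 0 = 0" by (simp add: mval_def mpoly_value_def)
  have "mval w 1 = (\<Sum>m\<in>{{#}}. coef 1 m * (\<Prod>e\<in>#m. w e))"
    by (rule mval_superset) auto
  then show "mval w 1 = 1" by simp
  have "mval w (mlin c e) = (\<Sum>m\<in>{{#e#}}. coef (mlin c e) m * (\<Prod>e\<in>#m. w e))"
    by (rule mval_superset) auto
  then show "mval w (mlin c e) = c * w e" by simp
qed

lemma mult_support:
  "{m. coef (F * G) m \<noteq> 0} \<subseteq> (\<lambda>(a, b). a + b) ` ({m. coef F m \<noteq> 0} \<times> {m. coef G m \<noteq> 0})"
proof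
  fix m assume "m \<in> {m. coef (F * G) m \<noteq> 0}"
  then obtain a where "a \<in> {a. a \<subseteq># m}" "coef F a * coef G (m - a) \<noteq> 0"
    unfolding coef_mult mem_Collect_eq by (rule sum.not_neutral_contains_not_neutral) blast
  then obtain a where "a \<subseteq># m" "coef F a \<noteq> 0" "coef G (m - a) \<noteq> 0" by auto
  then show "m \<in> (\<lambda>(a, b). a + b) ` ({m. coef F m \<noteq> 0} \<times> {m. coef G m \<noteq> 0})"
    by (intro image_eqI[of _ _ "(a, m - a)"]) auto
qed

lemma is_mpoly_mult: "is_mpoly F \<Longrightarrow> is_mpoly G \<Longrightarrow> is_mpoly (F * G)"
  unfolding is_mpoly_def using mult_support by (rule finite_subset) auto

text \<open>Both sides are the sum over pairs of monomials; on the left the pairs are grouped by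
  their product.\<close>

lemma mval_mult:
  assumes "is_mpoly F" "is_mpoly G"
  shows "mval w (F * G) = mval w F * mval w G"
proof -
  let ?A = "{m. coef F m \<noteq> 0}" and ?B = "{m. coef G m \<noteq> 0}"
  let ?C = "(\<lambda>(a, b). a + b) ` (?A \<times> ?B)"
  let ?W = "\<lambda>m. \<Prod>e\<in>#m. w e"
  have fin: "finite ?A" "finite ?B" "finite ?C" using assms by (auto simp: is_mpoly_def)
  have inner: "coef (F * G) m = (\<Sum>x | x \<in> ?A \<times> ?B \<and> (case x of (a, b) \<Rightarrow> a + b) = m. coef F (fst x) * coef G (snd x))" for m
  proof -
    have "coef (F * G) m = (\<Sum>a | a \<subseteq># m \<and> coef F a \<noteq> 0 \<and> coef G (m - a) \<noteq> 0. coef F a * coef G (m - a))"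
      unfolding coef_mult by (rule sum.mono_neutral_right) auto
    also have "\<dots> = (\<Sum>x | x \<in> ?A \<times> ?B \<and> (case x of (a, b) \<Rightarrow> a + b) = m. coef F (fst x) * coef G (snd x))"
      by (rule sum.reindex_bij_witness[of _ fst "\<lambda>a. (a, m - a)"]) auto
    finally show ?thesis .
  qed
  have "mval w (F * G) = (\<Sum>m\<in>?C. coef (F * G) m * ?W m)"
    by (rule mval_superset[OF fin(3) mult_support])
  also have "\<dots> = (\<Sum>m\<in>?C. \<Sum>x | x \<in> ?A \<times> ?B \<and> (case x of (a, b) \<Rightarrow> a + b) = m.
      (coef F (fst x) * ?W (fst x)) * (coef G (snd x) * ?W (snd x)))"
    unfolding inner sum_distrib_right by (intro sum.cong refl) (auto simp: algebra_simps)
  also have "\<dots> = (\<Sum>x\<in>?A \<times> ?B. (coef F (fst x) * ?W (fst x)) * (coef G (snd x) * ?W (snd x)))"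
    by (rule sum.group) (use fin in auto)
  also have "\<dots> = mval w F * mval w G"
    unfolding mval_def mpoly_value_def sum_product sum.cartesian_product by (simp add: case_prod_unfold)
  finally show ?thesis .
qed

text \<open>Evaluation is a homomorphism only on series of finite support, so finiteness of the
  support is carried along with the value.\<close>

lemma mval_sum:
  assumes "\<And>x. x \<in> A \<Longrightarrow> is_mpoly (F x)"
  shows "is_mpoly (\<Sum>x\<in>A. F x) \<and> mval w (\<Sum>x\<in>A. F x) = (\<Sum>x\<in>A. mval w (F x))"
  using assms
  by (induction A rule: infinite_finite_induct) (auto simp: is_mpoly_add mval_add)

lemma mval_prod:
  assumes "\<And>x. x \<in> A \<Longrightarrow> is_mpoly (F x)"
  shows "is_mpoly (\<Prod>x\<in>A. F x) \<and> mval w (\<Prod>x\<in>A. F x) = (\<Prod>x\<in>A. mval w (F x))"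
  using assms
  by (induction A rule: infinite_finite_induct) (auto simp: is_mpoly_mult mval_mult)

lemma mval_set_det:
  fixes M :: "'b \<Rightarrow> 'b \<Rightarrow> 'a mseries"
  assumes fin: "finite E" and M: "\<And>a b. a \<in> E \<Longrightarrow> b \<in> E \<Longrightarrow> is_mpoly (M a b)"
  shows "is_mpoly (set_det E M) \<and> mval w (set_det E M) = set_det E (\<lambda>a b. mval w (M a b))"
proof -
  let ?n = "length (enum_list E)" and ?es = "enum_list E"
  let ?\<Pi> = "\<lambda>p. \<Prod>i = 0..<?n. M (?es ! i) (?es ! p i)"
  have \<Pi>: "is_mpoly (?\<Pi> p) \<and> mval w (?\<Pi> p) = (\<Prod>i = 0..<?n. mval w (M (?es ! i) (?es ! p i)))"
    if p: "p \<in> {p. p permutes {0..<?n}}" for p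
  proof (rule mval_prod, rule M)
    fix i assume "i \<in> {0..<?n}"
    then show "enum_list E ! i \<in> E" "enum_list E ! p i \<in> E"
      using p permutes_in_image[of p "{0..<?n}" i] by (auto intro!: enum_list_nth[OF fin])
  qed
  have s: "is_mpoly (signof p :: 'a mseries) \<and> mval w (signof p) = signof p" for p :: "nat \<Rightarrow> nat"
    by (auto simp: sign_def is_mpoly_uminus mval_uminus)
  have "is_mpoly (\<Sum>p | p permutes {0..<?n}. signof p * ?\<Pi> p) \<and>
     mval w (\<Sum>p | p permutes {0..<?n}. signof p * ?\<Pi> p)
      = (\<Sum>p | p permutes {0..<?n}. mval w (signof p * ?\<Pi> p))"
    by (rule mval_sum, rule is_mpoly_mult, rule s[THEN conjunct1], rule \<Pi>[THEN conjunct1])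
  moreover have "(\<Sum>p | p permutes {0..<?n}. mval w (signof p * ?\<Pi> p))
     = (\<Sum>p | p permutes {0..<?n}. signof p * (\<Prod>i = 0..<?n. mval w (M (?es ! i) (?es ! p i))))"
    using s \<Pi> by (intro sum.cong) (auto simp: mval_mult)
  ultimately show ?thesis unfolding set_det_leibniz by simp
qed

lemma series_has_value_iff:
  "series_has_value S w v \<longleftrightarrow> (\<exists>P Q. is_mpoly P \<and> is_mpoly Q \<and> P = Q * mser S \<and>
     mval w Q \<noteq> 0 \<and> v = mval w P / mval w Q)"
proof
  assume "series_has_value S w v"
  then obtain P Q where *: "finite {m. P m \<noteq> 0}" "finite {m. Q m \<noteq> 0}"
     "\<forall>m. P m = (\<Sum>a | a \<subseteq># m. Q a * S (m - a))"
     "mpoly_value Q w \<noteq> 0" "v = mpoly_value P w / mpoly_value Q w"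
    unfolding series_has_value_def by blast
  show "\<exists>P Q. is_mpoly P \<and> is_mpoly Q \<and> P = Q * mser S \<and> mval w Q \<noteq> 0 \<and> v = mval w P / mval w Q"
    by (rule exI[of _ "mser P"], rule exI[of _ "mser Q"])
       (use * in \<open>auto simp: is_mpoly_def mval_def coef_mult intro!: mseries_eqI\<close>)
next
  assume "\<exists>P Q. is_mpoly P \<and> is_mpoly Q \<and> P = Q * mser S \<and> mval w Q \<noteq> 0 \<and> v = mval w P / mval w Q"
  then obtain P Q where "is_mpoly P" "is_mpoly Q" "P = Q * mser S" "mval w Q \<noteq> 0" "v = mval w P / mval w Q"
    by blast
  then show "series_has_value S w v"
    unfolding series_has_value_def
    by (intro exI[of _ "coef P"] exI[of _ "coef Q"]) (auto simp: is_mpoly_def mval_def coef_mult)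
qed

text \<open>Cross multiplication: \<open>P * Q' = P' * Q\<close> holds for the series and survives
  evaluation. This justifies the definite description in
  \<open>boundary_measurement\<close>.\<close>

lemma series_value_unique:
  assumes "series_has_value S w v" "series_has_value S w v'"
  shows "v = v'"
proof -
  obtain P Q P' Q' where
    1: "is_mpoly P" "is_mpoly Q" "P = Q * mser S" "mval w Q \<noteq> 0" "v = mval w P / mval w Q" and
    2: "is_mpoly P'" "is_mpoly Q'" "P' = Q' * mser S" "mval w Q' \<noteq> 0" "v' = mval w P' / mval w Q'"
    using assms unfolding series_has_value_iff by blast
  have "P * Q' = P' * Q" unfolding 1(3) 2(3) by (simp add: ac_simps)
  then have "mval w P * mval w Q' = mval w P' * mval w Q"
    using mval_mult 1 2 by metis
  then show ?thesis unfolding 1(5) 2(5) using 1(4) 2(4) by (simp add: frac_eq_eq)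
qed

section \<open>The turning parity of a simple polygon\<close>

definition cdet :: "complex \<Rightarrow> complex \<Rightarrow> real" where
  "cdet f g = Re f * Im g - Im f * Re g"

lemma orient_iff:
  "orient f g = 1 \<longleftrightarrow> cdet f g > 0" "orient f g = -1 \<longleftrightarrow> cdet f g < 0" "orient f g = 0 \<longleftrightarrow> cdet f g = 0"
  by (auto simp: orient_def cdet_def Let_def)

lemma cdet_simps [simp]:
  "cdet (a + b) c = cdet a c + cdet b c" "cdet c (a + b) = cdet c a + cdet c b"
  "cdet (a - b) c = cdet a c - cdet b c" "cdet c (a - b) = cdet c a - cdet c b"
  "cdet (- a) c = - cdet a c" "cdet c (- a) = - cdet c a"
  "cdet (of_real r * a) c = r * cdet a c" "cdet c (of_real r * a) = r * cdet c a"
  "cdet (r *\<^sub>R a) c = r * cdet a c" "cdet c (r *\<^sub>R a) = r * cdet c a"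
  "cdet a a = 0" "cdet 0 a = 0" "cdet a 0 = 0"
  by (simp_all add: cdet_def algebra_simps)

lemma cdet_swap: "cdet b a = - cdet a b"
  by (simp add: cdet_def)

text \<open>Whether the turn from \<open>a\<close> to \<open>b\<close> (by less than a half turn) sweeps across the direction \<open>l\<close>.\<close>

definition sweeps :: "complex \<Rightarrow> complex \<Rightarrow> complex \<Rightarrow> bool" where
  "sweeps l a b \<longleftrightarrow> cdet l a < 0 \<and> 0 < cdet l b \<and> 0 < cdet a b \<or>
     0 < cdet l a \<and> cdet l b < 0 \<and> cdet a b < 0"

definition swsign :: "complex \<Rightarrow> complex \<Rightarrow> complex \<Rightarrow> real" where
  "swsign l a b = (if sweeps l a b then -1 else 1)"

text \<open>The two senses of a sweep give the values 1 and -1, which agree modulo 2.\<close>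

lemma odd_wind: "odd (wind l e f) \<longleftrightarrow> sweeps l (evec e) (evec f)"
  unfolding wind_def Let_def orient_iff sweeps_def using cdet_swap[of l "evec e"] by auto

text \<open>If 0 is outside the convex hull of \<open>a\<close>, \<open>b\<close>, \<open>c\<close>,
  the three vectors lie in an open half-plane. The turn from \<open>a\<close> to \<open>c\<close> is
  then the turn to \<open>b\<close> followed by the turn from \<open>b\<close>, with no full
  rotation in between, and the sweeps add up modulo 2.\<close>

lemma swsign_triangle:
  assumes nz: "cdet l a \<noteq> 0" "cdet l b \<noteq> 0" "cdet l c \<noteq> 0"
    and hull: "\<And>\<alpha> \<beta> \<gamma>. 0 \<le> \<alpha> \<Longrightarrow> 0 \<le> \<beta> \<Longrightarrow> 0 \<le> \<gamma> \<Longrightarrow> 0 < \<alpha> + \<beta> + \<gamma> \<Longrightarrow>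
      \<alpha> *\<^sub>R a + \<beta> *\<^sub>R b + \<gamma> *\<^sub>R c \<noteq> 0"
  shows "swsign l a c = swsign l a b * swsign l b c"
proof -
  have core: "cdet u v > 0 \<longleftrightarrow> cdet u w > 0" "cdet u v \<noteq> 0"
    if X: "cdet m u < 0" "0 < cdet m v" "0 < cdet m w"
      and h: "\<And>\<alpha> \<beta> \<gamma>. 0 \<le> \<alpha> \<Longrightarrow> 0 \<le> \<beta> \<Longrightarrow> 0 \<le> \<gamma> \<Longrightarrow> 0 < \<alpha> + \<beta> + \<gamma> \<Longrightarrow>
      \<alpha> *\<^sub>R u + \<beta> *\<^sub>R v + \<gamma> *\<^sub>R w \<noteq> 0" for m u v w
  proof -
    \<comment> \<open>The linear relation between three plane vectors. If the turns from
      \<open>u\<close> to \<open>v\<close> and to \<open>w\<close> had different senses, its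
      coefficients, or their negatives in \<open>id2\<close>, would be nonnegative, which the hull
      condition excludes.\<close>
    have id: "cdet v w *\<^sub>R u + cdet w u *\<^sub>R v + cdet u v *\<^sub>R w = 0"
      by (simp add: complex_eq_iff cdet_def) (simp add: algebra_simps)
    have id2: "cdet w v *\<^sub>R u + cdet u w *\<^sub>R v + cdet v u *\<^sub>R w = 0"
      by (simp add: complex_eq_iff cdet_def) (simp add: algebra_simps)
    \<comment> \<open>Pairing the relation with \<open>m\<close> determines the sign of the
      remaining coefficient \<open>cdet v w\<close>.\<close>
    have eq: "cdet v w * cdet m u + cdet w u * cdet m v + cdet u v * cdet m w = 0"
      by (simp add: cdet_def) (simp add: algebra_simps)
    have "False" if "cdet u v > 0" "cdet u w \<le> 0"
    proof -
      have "cdet w u * cdet m v \<ge> 0" "cdet u v * cdet m w > 0"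
        using that X by (auto simp: cdet_swap[of w u] mult_nonpos_nonneg)
      with eq have "cdet v w * cdet m u < 0" by linarith
      then have "cdet v w > 0" using X(1) by (simp add: mult_less_0_iff)
      then show False using h[of "cdet v w" "cdet w u" "cdet u v"] id that cdet_swap[of w u] by simp
    qed
    moreover have "False" if "cdet u w > 0" "cdet u v \<le> 0"
    proof -
      have "cdet w u * cdet m v < 0" "cdet u v * cdet m w \<le> 0"
        using that X by (auto simp: cdet_swap[of w u] mult_nonpos_nonneg)
      with eq have "cdet v w * cdet m u > 0" by linarith
      then have "cdet v w < 0" using X(1) by (simp add: zero_less_mult_iff)
      then show False
        using h[of "cdet w v" "cdet u w" "cdet v u"] id2 that cdet_swap[of w v] cdet_swap[of v u] by simp
    qed
    ultimately show "cdet u v > 0 \<longleftrightarrow> cdet u w > 0" by force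
    show "cdet u v \<noteq> 0"
    proof
      assume z: "cdet u v = 0"
      have "cdet m v *\<^sub>R u + (- cdet m u) *\<^sub>R v = 0"
      proof -
        have "cdet m v *\<^sub>R u - cdet m u *\<^sub>R v = cdet u v *\<^sub>R m"
          by (simp add: complex_eq_iff cdet_def) (simp add: algebra_simps)
        then show ?thesis using z by simp
      qed
      then show False using h[of "cdet m v" "- cdet m u" 0] X by simp
    qed
  qed
  have hull': "\<alpha> *\<^sub>R x + \<beta> *\<^sub>R y + \<gamma> *\<^sub>R z \<noteq> 0"
    if "0 \<le> \<alpha>" "0 \<le> \<beta>" "0 \<le> \<gamma>" "0 < \<alpha> + \<beta> + \<gamma>"
      and "(x, y, z) \<in> {(a,b,c),(a,c,b),(b,a,c),(b,c,a),(c,a,b),(c,b,a)}" for \<alpha> \<beta> \<gamma> x y z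
    using that(5) hull[of \<alpha> \<beta> \<gamma>] hull[of \<alpha> \<gamma> \<beta>] hull[of \<beta> \<alpha> \<gamma>] hull[of \<beta> \<gamma> \<alpha>] hull[of \<gamma> \<alpha> \<beta>] hull[of \<gamma> \<beta> \<alpha>] that(1-4)
    by (auto simp: add_ac)
  have c1: "(cdet u v > 0 \<longleftrightarrow> cdet u w > 0) \<and> cdet u v \<noteq> 0"
    if "cdet l u < 0" "0 < cdet l v" "0 < cdet l w"
      "(u, v, w) \<in> {(a,b,c),(a,c,b),(b,a,c),(b,c,a),(c,a,b),(c,b,a)}" for u v w
    using core[of l u v w] hull' that by blast
  \<comment> \<open>Replacing \<open>l\<close> by \<open>-l\<close> exchanges the two sides.\<close>
  have c2: "(cdet u v > 0 \<longleftrightarrow> cdet u w > 0) \<and> cdet u v \<noteq> 0"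
    if "cdet l u > 0" "0 > cdet l v" "0 > cdet l w"
      "(u, v, w) \<in> {(a,b,c),(a,c,b),(b,a,c),(b,c,a),(c,a,b),(c,b,a)}" for u v w
    using core[of "-l" u v w] hull' that by simp
  consider "cdet l a < 0" "cdet l b < 0" "cdet l c < 0" | "cdet l a < 0" "cdet l b < 0" "cdet l c > 0"
    | "cdet l a < 0" "cdet l b > 0" "cdet l c < 0" | "cdet l a < 0" "cdet l b > 0" "cdet l c > 0"
    | "cdet l a > 0" "cdet l b < 0" "cdet l c < 0" | "cdet l a > 0" "cdet l b < 0" "cdet l c > 0"
    | "cdet l a > 0" "cdet l b > 0" "cdet l c < 0" | "cdet l a > 0" "cdet l b > 0" "cdet l c > 0"
    using nz unfolding neq_iff by blast
  then show ?thesis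
  proof cases
    case 1 then show ?thesis by (simp add: swsign_def sweeps_def)
  next
    case 2 then show ?thesis using c2[of c a b] c2[of c b a] cdet_swap[of a c] cdet_swap[of b c]
      by (auto simp: swsign_def sweeps_def)
  next
    case 3 then show ?thesis using c2[of b a c] c2[of b c a] cdet_swap[of a b] cdet_swap[of b c]
      by (auto simp: swsign_def sweeps_def)
  next
    case 4 then show ?thesis using c1[of a b c] c1[of a c b] 
      by (auto simp: swsign_def sweeps_def)
  next
    case 5 then show ?thesis using c2[of a b c] c2[of a c b] 
      by (auto simp: swsign_def sweeps_def)
  next
    case 6 then show ?thesis using c1[of b a c] c1[of b c a] cdet_swap[of a b] cdet_swap[of b c]
      by (auto simp: swsign_def sweeps_def)
  next
    case 7 then show ?thesis using c1[of c a b] c1[of c b a] cdet_swap[of a c] cdet_swap[of b c]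
      by (auto simp: swsign_def sweeps_def)
  next
    case 8 then show ?thesis by (simp add: swsign_def sweeps_def)
  qed
qed

text \<open>If \<open>a\<close> and \<open>b\<close> lie on different sides of the line of
  \<open>l\<close>, the turn passes over \<open>l\<close> or over \<open>-l\<close>; so exactly one
  of the turn and its antipode sweeps across \<open>l\<close>. If they lie on the same side, neither
  does.\<close>

lemma swsign_minus:
  assumes nz: "cdet l a \<noteq> 0" "cdet l b \<noteq> 0"
    and hull: "\<And>\<alpha> \<beta>. 0 \<le> \<alpha> \<Longrightarrow> 0 \<le> \<beta> \<Longrightarrow> 0 < \<alpha> + \<beta> \<Longrightarrow> \<alpha> *\<^sub>R a + \<beta> *\<^sub>R b \<noteq> 0"
  shows "swsign l a b * swsign l (- a) (- b) = sgn (cdet l a) * sgn (cdet l b)"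
proof -
  have id: "cdet l b *\<^sub>R a - cdet l a *\<^sub>R b = cdet a b *\<^sub>R l"
    by (simp add: complex_eq_iff cdet_def) (simp add: algebra_simps)
  have "cdet a b \<noteq> 0" if "cdet l a < 0" "0 < cdet l b"
    using hull[of "cdet l b" "- cdet l a"] id that by auto
  moreover have "cdet a b \<noteq> 0" if "cdet l a > 0" "0 > cdet l b"
  proof
    assume "cdet a b = 0"
    then have "(- cdet l b) *\<^sub>R a + cdet l a *\<^sub>R b = 0" using id by (simp add: algebra_simps)
    then show False using hull[of "- cdet l b" "cdet l a"] that by auto
  qed
  ultimately show ?thesis using nz
    by (cases "cdet l a" "0::real" rule: linorder_cases; cases "cdet l b" "0::real" rule: linorder_cases)
       (auto simp: swsign_def sweeps_def)
qed

lemma prod_periodic_shift: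
  fixes h :: "nat \<Rightarrow> 'a::comm_monoid_mult"
  assumes per: "\<And>i. h (i + n) = h i"
  shows "(\<Prod>i<n. h (i + k)) = (\<Prod>i<n. h i)"
proof (induction k)
  case (Suc k)
  show ?case
  proof (cases n)
    case (Suc m)
    have "(\<Prod>i<Suc m. h (i + Suc k)) = (\<Prod>i<m. h (Suc i + k)) * h (k + n)"
      by (simp add: Suc add_ac)
    also have "\<dots> = (\<Prod>i<Suc m. h (i + k))"
      by (subst prod.lessThan_Suc_shift) (simp add: per mult.commute)
    finally show ?thesis using Suc.IH \<open>n = Suc m\<close> by simp
  qed simp
qed simp

lemma prod_lessThan_add:
  fixes h :: "nat \<Rightarrow> 'a::comm_monoid_mult"
  shows "(\<Prod>i<m + k. h i) = (\<Prod>i<m. h i) * (\<Prod>i<k. h (i + m))"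
  by (induction k) (simp_all add: ac_simps)

text \<open>The corners form an \<open>n\<close>-periodic sequence, so that secants and cyclic
  shifts can be written with plain indices. The two exceptions in \<open>simple\<close> are the
  common corners of neighbouring edges.\<close>

locale simple_polygon =
  fixes p :: "nat \<Rightarrow> complex" and n :: nat
  assumes n3: "3 \<le> n"
    and periodic: "p (i + n) = p i"
    and nondegenerate: "p i \<noteq> p (Suc i)"
    and simple: "\<lbrakk>1 \<le> d; d < n; x \<in> closed_segment (p i) (p (Suc i));
      x \<in> closed_segment (p (i + d)) (p (Suc (i + d)))\<rbrakk>
      \<Longrightarrow> d = 1 \<and> x = p (Suc i) \<or> d = n - 1 \<and> x = p i"
begin

text \<open>The secants of the polygon: for fixed \<open>d\<close> a closed loop in
  \<open>i\<close>, and for \<open>d = 1\<close> the edges.\<close>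

definition diff :: "nat \<Rightarrow> nat \<Rightarrow> complex" where
  "diff d i = p (i + d) - p i"

lemma diff_periodic: "diff d (i + n) = diff d i"
  using periodic[of i] periodic[of "i + d"] by (simp add: diff_def add_ac)

text \<open>A vanishing combination of the corners of a half of the cell \<open>edge i \<times> edge (i + d)\<close>
  is a common point of the two edges.\<close>

lemma no_hull_low:
  assumes d: "1 \<le> d" "Suc d < n" and nn: "0 \<le> \<alpha>" "0 \<le> \<beta>" "0 \<le> \<gamma>" "0 < \<alpha> + \<beta> + \<gamma>"
  shows "\<alpha> *\<^sub>R diff d i + \<beta> *\<^sub>R diff (Suc d) i + \<gamma> *\<^sub>R diff d (Suc i) \<noteq> 0"
proof
  let ?s = "\<alpha> + \<beta> + \<gamma>"
  define u where "u = (\<beta> + \<gamma>) / ?s"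
  define v where "v = \<gamma> / ?s"
  assume z: "\<alpha> *\<^sub>R diff d i + \<beta> *\<^sub>R diff (Suc d) i + \<gamma> *\<^sub>R diff d (Suc i) = 0"
  have uv: "0 \<le> u" "u \<le> 1" "0 \<le> v" "v \<le> 1" "1 - u = \<alpha> / ?s" "1 - v = (\<alpha> + \<beta>) / ?s" "v \<le> u"
    using nn by (auto simp: u_def v_def field_simps)
  have "\<alpha> *\<^sub>R p (i + d) + (\<beta> + \<gamma>) *\<^sub>R p (Suc (i + d)) = (\<alpha> + \<beta>) *\<^sub>R p i + \<gamma> *\<^sub>R p (Suc i)"
    using z by (simp add: diff_def algebra_simps)
  then have "(1 / ?s) *\<^sub>R (\<alpha> *\<^sub>R p (i + d) + (\<beta> + \<gamma>) *\<^sub>R p (Suc (i + d)))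
     = (1 / ?s) *\<^sub>R ((\<alpha> + \<beta>) *\<^sub>R p i + \<gamma> *\<^sub>R p (Suc i))" by simp
  then have eq: "(1 - u) *\<^sub>R p (i + d) + u *\<^sub>R p (Suc (i + d)) = (1 - v) *\<^sub>R p i + v *\<^sub>R p (Suc i)"
    unfolding uv(5,6) unfolding u_def v_def by (simp add: scaleR_add_right)
  define x where "x = (1 - v) *\<^sub>R p i + v *\<^sub>R p (Suc i)"
  have "x \<in> closed_segment (p i) (p (Suc i))" "x \<in> closed_segment (p (i + d)) (p (Suc (i + d)))"
    unfolding x_def in_segment using uv(1-4) eq[symmetric] by blast+
  from simple[OF d(1) _ this] d have "d = 1" "x = p (Suc i)" by auto
  then have "(1 - v) *\<^sub>R (p i - p (Suc i)) = 0" by (simp add: x_def algebra_simps)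
  then have "v = 1" using nondegenerate[of i] by simp
  then have "u = 1" using uv by simp
  then have "p (Suc (i + d)) = p (Suc i)" using eq \<open>v = 1\<close> by simp
  then show False using \<open>d = 1\<close> nondegenerate[of "Suc i"] by simp
qed

text \<open>This triangle is a half of the next cell
  \<open>edge i \<times> edge (i + d + 1)\<close>. Together with the triangle of
  \<open>no_hull_low\<close> it fills the strip between the levels \<open>d\<close> and
  \<open>Suc d\<close>.\<close>

lemma no_hull_high:
  assumes d: "1 \<le> d" "Suc d < n" and nn: "0 \<le> \<alpha>" "0 \<le> \<beta>" "0 \<le> \<gamma>" "0 < \<alpha> + \<beta> + \<gamma>"
  shows "\<alpha> *\<^sub>R diff (Suc d) i + \<beta> *\<^sub>R diff d (Suc i) + \<gamma> *\<^sub>R diff (Suc d) (Suc i) \<noteq> 0"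
proof
  let ?s = "\<alpha> + \<beta> + \<gamma>"
  define u where "u = \<gamma> / ?s"
  define v where "v = (\<beta> + \<gamma>) / ?s"
  let ?J = "i + Suc d"
  assume z: "\<alpha> *\<^sub>R diff (Suc d) i + \<beta> *\<^sub>R diff d (Suc i) + \<gamma> *\<^sub>R diff (Suc d) (Suc i) = 0"
  have uv: "0 \<le> u" "u \<le> 1" "0 \<le> v" "v \<le> 1" "1 - u = (\<alpha> + \<beta>) / ?s" "1 - v = \<alpha> / ?s" "u \<le> v"
    using nn by (auto simp: u_def v_def field_simps)
  have "(\<alpha> + \<beta>) *\<^sub>R p ?J + \<gamma> *\<^sub>R p (Suc ?J) = \<alpha> *\<^sub>R p i + (\<beta> + \<gamma>) *\<^sub>R p (Suc i)"
    using z by (simp add: diff_def algebra_simps)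
  then have "(1 / ?s) *\<^sub>R ((\<alpha> + \<beta>) *\<^sub>R p ?J + \<gamma> *\<^sub>R p (Suc ?J))
     = (1 / ?s) *\<^sub>R (\<alpha> *\<^sub>R p i + (\<beta> + \<gamma>) *\<^sub>R p (Suc i))" by simp
  then have eq: "(1 - u) *\<^sub>R p ?J + u *\<^sub>R p (Suc ?J) = (1 - v) *\<^sub>R p i + v *\<^sub>R p (Suc i)"
    unfolding uv(5,6) unfolding u_def v_def by (simp add: scaleR_add_right)
  define x where "x = (1 - v) *\<^sub>R p i + v *\<^sub>R p (Suc i)"
  have "x \<in> closed_segment (p i) (p (Suc i))" "x \<in> closed_segment (p ?J) (p (Suc ?J))"
    unfolding x_def in_segment using uv(1-4) eq[symmetric] by blast+
  from simple[OF _ _ this] d have "Suc d = n - 1" "x = p i" by auto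
  then have "v *\<^sub>R (p (Suc i) - p i) = 0" by (simp add: x_def algebra_simps)
  then have "v = 0" using nondegenerate[of i] by simp
  then have "u = 0" using uv by simp
  then have "p ?J = p i" using eq \<open>v = 0\<close> by simp
  moreover have "p (Suc ?J) = p i" using \<open>Suc d = n - 1\<close> n3 periodic[of i]
    by (metis One_nat_def Suc_diff_1 Suc_le_lessD add_Suc_right less_le_trans numeral_3_eq_3 zero_less_Suc)
  ultimately show False using nondegenerate[of ?J] by simp
qed

text \<open>The parity, written as a sign, of the number of sweeps of the loop at level
  \<open>d\<close>.\<close>

definition level_sign :: "complex \<Rightarrow> nat \<Rightarrow> real" where
  "level_sign l d = (\<Prod>i<n. swsign l (diff d i) (diff d (Suc i)))"

end

locale generic_polygon = simple_polygon +
  fixes l :: complex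
  assumes generic: "1 \<le> d \<Longrightarrow> d < n \<Longrightarrow> cdet l (diff d i) \<noteq> 0"
begin

lemma level_split_low:
  assumes d: "1 \<le> d" "Suc d < n"
  shows "level_sign l d = (\<Prod>i<n. swsign l (diff d i) (diff (Suc d) i) * swsign l (diff (Suc d) i) (diff d (Suc i)))"
  unfolding level_sign_def
  using d no_hull_low[OF d] by (intro prod.cong refl swsign_triangle generic) auto

text \<open>A discrete homotopy: both loops have the same sign as the zigzag that alternates between
  the two levels. The two expressions for the zigzag differ by a cyclic shift.\<close>

lemma level_Suc:
  assumes d: "1 \<le> d" "Suc d < n"
  shows "level_sign l (Suc d) = level_sign l d"
proof -
  have "level_sign l (Suc d) = (\<Prod>i<n. swsign l (diff (Suc d) i) (diff d (Suc i)) * swsign l (diff d (Suc i)) (diff (Suc d) (Suc i)))"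
    unfolding level_sign_def
    using d no_hull_high[OF d] by (intro prod.cong refl swsign_triangle generic) auto
  also have "\<dots> = (\<Prod>i<n. swsign l (diff (Suc d) i) (diff d (Suc i))) * (\<Prod>i<n. swsign l (diff d (Suc i)) (diff (Suc d) (Suc i)))"
    by (rule prod.distrib)
  also have "(\<Prod>i<n. swsign l (diff d (Suc i)) (diff (Suc d) (Suc i))) = (\<Prod>i<n. swsign l (diff d i) (diff (Suc d) i))"
    using prod_periodic_shift[of "\<lambda>i. swsign l (diff d i) (diff (Suc d) i)" n 1]
    by (simp add: diff_periodic)
  finally show ?thesis unfolding level_split_low[OF d] prod.distrib by simp
qed

lemma level_eq:
  assumes "1 \<le> d" "d < n"
  shows "level_sign l d = level_sign l 1"
  using assms
proof (induction d rule: dec_induct)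
  case (step k)
  then show ?case using level_Suc[of k] by simp
qed simp

text \<open>On the middle level the loop of differences is antipodally symmetric, hence sweeps across
  every direction an odd number of times.\<close>

lemma generic_turning_sign: "level_sign l 1 = -1"
proof (cases "even n")
  case True
  then obtain m where m: "n = 2 * m" by auto
  with n3 have m2: "2 \<le> m" by simp
  have anti: "diff m (i + m) = - diff m i" for i
    using periodic[of i] m by (simp add: diff_def add_ac mult_2)
  have hull: "\<alpha> *\<^sub>R diff m i + \<beta> *\<^sub>R diff m (Suc i) \<noteq> 0"
    if "0 \<le> \<alpha>" "0 \<le> \<beta>" "0 < \<alpha> + \<beta>" for \<alpha> \<beta> i
    using no_hull_low[of m \<alpha> 0 \<beta> i] that m m2 by simp
  have gen: "cdet l (diff m i) \<noteq> 0" for i using generic[of m i] m m2 by simp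
  let ?h = "\<lambda>i. swsign l (diff m i) (diff m (Suc i))"
  let ?\<sigma> = "\<lambda>i. sgn (cdet l (diff m i))"
  have "level_sign l m = (\<Prod>i<m. ?h i) * (\<Prod>i<m. ?h (i + m))"
    unfolding level_sign_def using prod_lessThan_add[of ?h m m] m by (simp add: mult_2)
  also have "\<dots> = (\<Prod>i<m. ?h i * swsign l (- diff m i) (- diff m (Suc i)))"
    unfolding prod.distrib using anti[of "Suc _"] by (simp add: anti)
  also have "\<dots> = (\<Prod>i<m. ?\<sigma> i * ?\<sigma> (Suc i))"
    by (intro prod.cong refl swsign_minus gen hull)
  \<comment> \<open>Every intermediate sign occurs twice; the two that remain belong to antipodal
    secants.\<close>
  also have "\<dots> = ?\<sigma> 0 * ?\<sigma> m"
  proof -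
    have "(\<Prod>i<k. ?\<sigma> i * ?\<sigma> (Suc i)) = ?\<sigma> 0 * ?\<sigma> k" for k
    proof (induction k)
      case 0 show ?case using gen[of 0] by (simp add: sgn_real_def)
    next
      case (Suc k) then show ?case using gen[of k] by (simp add: sgn_real_def)
    qed
    then show ?thesis .
  qed
  also have "\<dots> = -1" using anti[of 0] gen[of 0] by (auto simp: sgn_real_def)
  finally show ?thesis using level_eq[of m] m m2 by simp
next
  \<comment> \<open>For odd \<open>n\<close> no level is its own antipode, but the levels
    \<open>m\<close> and \<open>Suc m\<close> are antipodal to each other, so the zigzag between
    them takes over.\<close>
  case False
  then obtain m where m: "n = 2 * m + 1" by (auto elim: oddE)
  with n3 have m1: "1 \<le> m" by simp
  have anti: "diff (Suc m) i = - diff m (i + Suc m)" for i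
    using periodic[of i] m by (simp add: diff_def add_ac mult_2)
  have anti': "diff m (Suc i) = - diff (Suc m) (i + Suc m)" for i
    using periodic[of "Suc i"] m by (simp add: diff_def add_ac mult_2)
  have hull: "\<alpha> *\<^sub>R diff m i + \<beta> *\<^sub>R diff (Suc m) i \<noteq> 0"
    if "0 \<le> \<alpha>" "0 \<le> \<beta>" "0 < \<alpha> + \<beta>" for \<alpha> \<beta> i
    using no_hull_low[of m \<alpha> \<beta> 0 i] that m m1 by simp
  have gen: "cdet l (diff m i) \<noteq> 0" "cdet l (diff (Suc m) i) \<noteq> 0" for i
    using generic[of m i] generic[of "Suc m" i] m m1 by auto
  let ?A = "diff m" and ?B = "diff (Suc m)"
  let ?\<sigma> = "\<lambda>v. sgn (cdet l v)"
  have "level_sign l m = (\<Prod>i<n. swsign l (?A i) (?B i)) * (\<Prod>i<n. swsign l (?B i) (?A (Suc i)))"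
    using level_split_low[of m] m m1 by (simp add: prod.distrib)
  also have "(\<Prod>i<n. swsign l (?B i) (?A (Suc i))) = (\<Prod>i<n. swsign l (- ?A (i + Suc m)) (- ?B (i + Suc m)))"
    unfolding anti[symmetric] anti'[symmetric] by simp
  also have "\<dots> = (\<Prod>i<n. swsign l (- ?A i) (- ?B i))"
    using prod_periodic_shift[of "\<lambda>i. swsign l (- ?A i) (- ?B i)" n "Suc m"] by (simp add: diff_periodic)
  also have "(\<Prod>i<n. swsign l (?A i) (?B i)) * \<dots> = (\<Prod>i<n. swsign l (?A i) (?B i) * swsign l (- ?A i) (- ?B i))"
    by (simp add: prod.distrib)
  also have "\<dots> = (\<Prod>i<n. ?\<sigma> (?A i) * ?\<sigma> (?B i))"
    by (intro prod.cong refl swsign_minus gen hull)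
  also have "\<dots> = (\<Prod>i<n. ?\<sigma> (?A i)) * (\<Prod>i<n. - ?\<sigma> (?A (i + Suc m)))"
    unfolding prod.distrib anti by (simp add: sgn_minus)
  also have "(\<Prod>i<n. - ?\<sigma> (?A (i + Suc m))) = (\<Prod>i<n. - ?\<sigma> (?A i))"
    using prod_periodic_shift[of "\<lambda>i. - ?\<sigma> (?A i)" n "Suc m"] by (simp add: diff_periodic)
  also have "(\<Prod>i<n. ?\<sigma> (?A i)) * \<dots> = (\<Prod>i<n. -1)"
    unfolding prod.distrib[symmetric] using gen by (intro prod.cong) (auto simp: sgn_real_def)
  also have "\<dots> = -1" using False by simp
  finally show ?thesis using level_eq[of m] m m1 by simp
qed

end

section \<open>From generic directions to directions parallel to no edge\<close>

lemma eventually_generic_direction: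
  assumes l: "l \<noteq> 0" and v: "v \<noteq> 0"
  shows "\<forall>\<^sub>F t in at_right 0. cdet (l + of_real t * (\<i> * l)) v \<noteq> 0 \<and>
     (cdet l v \<noteq> 0 \<longrightarrow> sgn (cdet (l + of_real t * (\<i> * l)) v) = sgn (cdet l v))"
proof (cases "cdet l v = 0")
  case True
  have "cdet (\<i> * l) v \<noteq> 0"
  proof
    assume "cdet (\<i> * l) v = 0"
    then have "Re l * Re v + Im l * Im v = 0" by (simp add: cdet_def)
    moreover have "(Re l * Re v + Im l * Im v)\<^sup>2 + (cdet l v)\<^sup>2 = ((Re l)\<^sup>2 + (Im l)\<^sup>2) * ((Re v)\<^sup>2 + (Im v)\<^sup>2)"
      by (simp add: cdet_def power2_eq_square algebra_simps)
    ultimately show False using True l v by (auto simp: complex_eq_iff sum_power2_eq_zero_iff)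
  qed
  moreover have "\<forall>\<^sub>F t in at_right 0. (0::real) < t" by (rule eventually_at_right_less)
  ultimately show ?thesis using True by (auto elim: eventually_mono)
next
  case False
  have "((\<lambda>t. cdet (l + of_real t * (\<i> * l)) v) \<longlongrightarrow> cdet l v + 0 * cdet (\<i> * l) v) (at_right 0)"
    unfolding cdet_simps by (intro tendsto_intros)
  then have lim: "((\<lambda>t. cdet (l + of_real t * (\<i> * l)) v) \<longlongrightarrow> cdet l v) (at_right 0)" by simp
  show ?thesis
  proof (cases "cdet l v > 0")
    case True
    from order_tendstoD(1)[OF lim this] show ?thesis by eventually_elim (use True in auto)
  next
    case f: False
    with False have "cdet l v < 0" by simp
    from order_tendstoD(2)[OF lim this] show ?thesis by eventually_elim (use \<open>cdet l v < 0\<close> in auto)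
  qed
qed

text \<open>A slight rotation of \<open>l\<close> makes it parallel to no secant while every edge
  stays on its side. The sweeps of the edge loop depend only on these sides and on the turns, so
  they are unchanged.\<close>

lemma (in simple_polygon) turning_sign:
  assumes l: "\<And>i. cdet l (p (Suc i) - p i) \<noteq> 0"
  shows "(\<Prod>i<n. swsign l (p (Suc i) - p i) (p (Suc (Suc i)) - p (Suc i))) = -1"
proof -
  have l0: "l \<noteq> 0" using l[of 0] by auto
  have nz: "diff d i \<noteq> 0" if "1 \<le> d" "d < n" for d i
  proof (cases "Suc d < n")
    case True then show ?thesis using no_hull_low[of d 1 0 0 i] that by simp
  next
    case False
    then have "n = Suc d" using that by simp
    then show ?thesis using nondegenerate[of "i + d"] periodic[of i] by (auto simp: diff_def)
  qed
  have "\<forall>\<^sub>F t in at_right 0. \<forall>(d, i) \<in> {1..<n} \<times> {..<n}. cdet (l + of_real t * (\<i> * l)) (diff d i) \<noteq> 0 \<and>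
     (cdet l (diff d i) \<noteq> 0 \<longrightarrow> sgn (cdet (l + of_real t * (\<i> * l)) (diff d i)) = sgn (cdet l (diff d i)))"
    by (intro eventually_ball_finite) (use nz l0 eventually_generic_direction in auto)
  then obtain t where t: "\<And>d i. 1 \<le> d \<Longrightarrow> d < n \<Longrightarrow> i < n \<Longrightarrow> cdet (l + of_real t * (\<i> * l)) (diff d i) \<noteq> 0 \<and>
     (cdet l (diff d i) \<noteq> 0 \<longrightarrow> sgn (cdet (l + of_real t * (\<i> * l)) (diff d i)) = sgn (cdet l (diff d i)))"
    using eventually_happens'[OF trivial_limit_at_right_real] by fastforce
  define l' where "l' = l + of_real t * (\<i> * l)"
  have mod: "diff d (i mod n) = diff d i" for d i
  proof -
    have "diff d (r + k * n) = diff d r" for r k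
    proof (induction k)
      case (Suc k)
      have "r + Suc k * n = r + k * n + n" by simp
      then show ?case using Suc.IH diff_periodic by metis
    qed simp
    from this[of "i mod n" "i div n"] show ?thesis by simp
  qed
  have gen: "cdet l' (diff d i) \<noteq> 0" if "1 \<le> d" "d < n" for d i
    using t[OF that, of "i mod n"] n3 unfolding l'_def mod by simp
  interpret generic_polygon p n l' by unfold_locales (use gen in auto)
  have sg: "sgn (cdet l' (diff 1 i)) = sgn (cdet l (diff 1 i))" for i
    using t[of 1 "i mod n"] n3 l[of i] unfolding l'_def mod by (simp add: diff_def)
  have "swsign l (diff 1 i) (diff 1 (Suc i)) = swsign l' (diff 1 i) (diff 1 (Suc i))" for i
  proof -
    have "cdet l' (diff 1 i) < 0 \<longleftrightarrow> cdet l (diff 1 i) < 0" "cdet l' (diff 1 i) > 0 \<longleftrightarrow> cdet l (diff 1 i) > 0" for i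
      using sg[of i] by (auto simp: sgn_real_def split: if_splits)
    then show ?thesis by (simp add: swsign_def sweeps_def)
  qed
  then show ?thesis using generic_turning_sign unfolding level_sign_def by (simp add: diff_def)
qed

section \<open>Perfectly oriented graphs\<close>

locale plabic_net =
  fixes G :: plabic
  assumes graph: "plabic_graph G" and paths: "PBDTP G"
begin

lemma graph_facts:
  shows radius_pos: "0 < radius G" and arc: "clockwise_on_arc G"
    and finite_internal: "finite (internal G)"
    and internal_ball: "internal G \<subseteq> ball (centre G) (radius G)"
    and black_internal: "black G \<subseteq> internal G"
    and edges_vertices: "edges G \<subseteq> vertices G \<times> vertices G"
    and edge_internal: "e \<in> edges G \<Longrightarrow> fst e \<noteq> snd e \<and> (fst e \<in> internal G \<or> snd e \<in> internal G)"
    and edges_meet: "e \<in> edges G \<Longrightarrow> f \<in> edges G \<Longrightarrow> e \<noteq> f \<Longrightarrow>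
        seg e \<inter> seg f \<subseteq> {fst e, snd e} \<inter> {fst f, snd f}"
    and boundary_degree: "j < nb G \<Longrightarrow> card (edges_at G (bv G j)) = 1"
    and internal_degree: "V \<in> internal G \<Longrightarrow> card (edges_at G V) = 2 \<or> card (edges_at G V) = 3"
    and white_in: "V \<in> white G \<Longrightarrow> card (in_edges G V) = 1"
    and black_out: "V \<in> black G \<Longrightarrow> card (out_edges G V) = 1"
  using graph unfolding plabic_graph_def by blast+

lemma finite_edges [simp]: "finite (edges G)"
proof (rule finite_subset[OF edges_vertices])
  show "finite (vertices G \<times> vertices G)" using finite_internal by (simp add: vertices_def)
qed

lemma edges_at_eq: "edges_at G V = in_edges G V \<union> out_edges G V"
  by (auto simp: edges_at_def in_edges_def out_edges_def)

lemma in_out_disjoint: "in_edges G V \<inter> out_edges G V = {}"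
  using edge_internal by (auto simp: in_edges_def out_edges_def)

lemma finite_in_out [simp]: "finite (in_edges G V)" "finite (out_edges G V)" "finite (edges_at G V)"
  by (simp_all add: in_edges_def out_edges_def edges_at_def)

lemma card_edges_at: "card (edges_at G V) = card (in_edges G V) + card (out_edges G V)"
  unfolding edges_at_eq by (rule card_Un_disjoint) (simp_all add: in_out_disjoint)

lemma vertex_cases:
  assumes "e \<in> edges G" "V = fst e \<or> V = snd e"
  obtains "V \<in> internal G" | j where "j < nb G" "V = bv G j"
  using assms edges_vertices by (cases e) (auto simp: vertices_def)

lemma card_edges_at_le:
  assumes "e \<in> edges G" "V = fst e \<or> V = snd e"
  shows "card (edges_at G V) \<le> 3"
  using vertex_cases[OF assms] by (metis boundary_degree internal_degree numeral_le_iff one_le_numeral order_refl semiring_norm(69) semiring_norm(72))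

lemma bv_dist: "j < nb G \<Longrightarrow> dist (centre G) (bv G j) = radius G"
  using arc radius_pos by (auto simp: clockwise_on_arc_def dist_norm norm_mult)

lemma bv_not_internal: "j < nb G \<Longrightarrow> bv G j \<notin> internal G"
  using bv_dist internal_ball by fastforce

lemma inj_bv:
  assumes "i < nb G" "j < nb G" "bv G i = bv G j"
  shows "i = j"
proof (rule ccontr)
  assume "i \<noteq> j"
  obtain \<theta> where \<theta>: "\<And>j. j < nb G \<Longrightarrow> bv G j = centre G + of_real (radius G) * cis (\<theta> j)"
    "\<And>i j. i < j \<Longrightarrow> j < nb G \<Longrightarrow> \<theta> j < \<theta> i \<and> \<theta> i - \<theta> j < pi"
    using arc unfolding clockwise_on_arc_def by blast
  define a where "a = min i j"
  define b where "b = max i j"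
  have ab: "a < b" "b < nb G" "bv G a = bv G b" using assms \<open>i \<noteq> j\<close> by (auto simp: a_def b_def min_def max_def)
  then have "cis (\<theta> a) = cis (\<theta> b)" using \<theta>(1)[of a] \<theta>(1)[of b] radius_pos by auto
  then have "cis (\<theta> a - \<theta> b) = 1" by (simp add: cis_divide[symmetric])
  then have "sin (\<theta> a - \<theta> b) = 0" by (metis Im_complex_of_real cis.sel(2) of_real_1)
  moreover have "0 < sin (\<theta> a - \<theta> b)" using \<theta>(2)[OF ab(1,2)] by (intro sin_gt_zero) auto
  ultimately show False by simp
qed

lemma boundary_edge:
  assumes "j < nb G"
  shows "edges_at G (bv G j) = {boundary_edge G j}"
proof -
  obtain e where e: "edges_at G (bv G j) = {e}" using boundary_degree[OF assms] by (auto simp: card_1_singleton_iff)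
  then have "boundary_edge G j = e" unfolding boundary_edge_def by auto
  with e show ?thesis by simp
qed

lemma boundary_edge_eqI: "j < nb G \<Longrightarrow> e \<in> edges G \<Longrightarrow> fst e = bv G j \<or> snd e = bv G j \<Longrightarrow> e = boundary_edge G j"
  using boundary_edge[of j] by (auto simp: edges_at_def)

lemma boundary_edge_in: "j < nb G \<Longrightarrow> boundary_edge G j \<in> edges G"
  using boundary_edge[of j] by (auto simp: edges_at_def)

lemma source_edge:
  assumes "i \<in> sources G"
  shows "i < nb G" "boundary_edge G i \<in> edges G" "fst (boundary_edge G i) = bv G i"
    "e \<in> edges G \<Longrightarrow> snd e \<noteq> bv G i"
proof -
  show i: "i < nb G" using assms by (simp add: sources_def)
  obtain f where f: "f \<in> edges G" "fst f = bv G i" using assms by (auto simp: sources_def out_edges_def)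
  then have "f = boundary_edge G i" using boundary_edge_eqI[OF i] by blast
  with f show "boundary_edge G i \<in> edges G" "fst (boundary_edge G i) = bv G i" by auto
  show "snd e \<noteq> bv G i" if "e \<in> edges G"
  proof
    assume "snd e = bv G i"
    then have "e = f" using boundary_edge_eqI[OF i] that \<open>f = _\<close> by blast
    then show False using edge_internal[OF that] f \<open>snd e = bv G i\<close> by simp
  qed
qed

lemma sink_edge:
  assumes "j \<in> sinks G"
  shows "j < nb G" "boundary_edge G j \<in> edges G" "snd (boundary_edge G j) = bv G j"
    "e \<in> edges G \<Longrightarrow> fst e \<noteq> bv G j"
proof -
  show j: "j < nb G" using assms by (simp add: sinks_def)
  show no: "fst e \<noteq> bv G j" if "e \<in> edges G" for e
    using assms that unfolding sinks_def sources_def out_edges_def by blast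
  show b: "boundary_edge G j \<in> edges G" by (rule boundary_edge_in[OF j])
  have "boundary_edge G j \<in> edges_at G (bv G j)" using boundary_edge[OF j] by simp
  then show "snd (boundary_edge G j) = bv G j" using no[OF b] by (simp add: edges_at_def)
qed

lemma source_tail: "e \<in> edges G \<Longrightarrow> j < nb G \<Longrightarrow> fst e = bv G j \<Longrightarrow> j \<in> sources G"
  unfolding sources_def out_edges_def by blast

lemma sink_head: "e \<in> edges G \<Longrightarrow> j < nb G \<Longrightarrow> snd e = bv G j \<Longrightarrow> j \<in> sinks G"
  using source_edge(4)[of j e] by (auto simp: sinks_def)

text \<open>Two edges in and two out would give degree 4. This is where the bound 3 on the degree
  turns distinct edges into distinct vertices.\<close>

lemma not_two_in_two_out:
  assumes "{e, e', f, f'} \<subseteq> edges G" "snd e = V" "snd e' = V" "fst f = V" "fst f' = V" "e \<noteq> e'"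
  shows "f = f'"
proof (rule ccontr)
  assume "f \<noteq> f'"
  have "card {e, e'} \<le> card (in_edges G V)"
    by (rule card_mono) (use assms in \<open>auto simp: in_edges_def\<close>)
  moreover have "card {f, f'} \<le> card (out_edges G V)"
    by (rule card_mono) (use assms in \<open>auto simp: out_edges_def\<close>)
  ultimately have "card (in_edges G V) \<ge> 2" "card (out_edges G V) \<ge> 2"
    using assms(6) \<open>f \<noteq> f'\<close> by simp_all
  then show False using card_edges_at[of V] card_edges_at_le[of e V] assms \<open>f \<noteq> f'\<close> by auto
qed

section \<open>Directed paths and their shortening\<close>

definition epath :: "edge list \<Rightarrow> bool" where
  "epath p \<longleftrightarrow> p \<noteq> [] \<and> set p \<subseteq> edges G \<and> successively (\<lambda>e f. snd e = fst f) p"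

lemma epath_Cons: "epath (e # p) \<longleftrightarrow> e \<in> edges G \<and> (p = [] \<or> snd e = fst (hd p) \<and> epath p)"
  by (auto simp: epath_def successively_Cons)

lemma epath_append:
  "p \<noteq> [] \<Longrightarrow> q \<noteq> [] \<Longrightarrow> epath (p @ q) \<longleftrightarrow> epath p \<and> epath q \<and> snd (last p) = fst (hd q)"
  by (auto simp: epath_def successively_append_iff)

lemma epath_nth: "epath p \<Longrightarrow> Suc k < length p \<Longrightarrow> snd (p ! k) = fst (p ! Suc k)"
  by (auto simp: epath_def successively_conv_nth)

lemma epath_in: "epath p \<Longrightarrow> e \<in> set p \<Longrightarrow> e \<in> edges G"
  by (auto simp: epath_def)

lemma walk_epath: "walk G i j p \<longleftrightarrow> epath p \<and> fst (hd p) = bv G i \<and> snd (last p) = bv G j"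
  by (auto simp: walk_def epath_def)

lemma walk_ends:
  assumes "walk G i j p" "i < nb G" "j < nb G"
  shows "i \<in> sources G" "j \<in> sinks G" "hd p = boundary_edge G i" "last p = boundary_edge G j"
proof -
  have p: "hd p \<in> edges G" "last p \<in> edges G" "fst (hd p) = bv G i" "snd (last p) = bv G j"
    using assms(1) by (auto simp: walk_def)
  show "i \<in> sources G" "j \<in> sinks G" using source_tail sink_head p assms(2,3) by blast+
  show "hd p = boundary_edge G i" "last p = boundary_edge G j"
    using boundary_edge_eqI p assms(2,3) by blast+
qed

text \<open>The part between two occurrences of an edge can be cut out without changing the
  ends.\<close>

lemma distinct_epath:
  assumes "epath p"
  obtains q where "epath q" "distinct q" "hd q = hd p" "last q = last p"
  using assms
proof (induction "length p" arbitrary: p thesis rule: less_induct)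
  case less
  show ?case
  proof (cases "distinct p")
    case False
    then obtain as x bs cs where p: "p = as @ [x] @ bs @ [x] @ cs" using not_distinct_decomp by blast
    have "epath (as @ [x] @ cs)"
      using less.prems(2) unfolding p epath_def
      by (auto simp: successively_append_iff successively_Cons)
    moreover have "hd (as @ [x] @ cs) = hd p" "last (as @ [x] @ cs) = last p"
      unfolding p by (auto simp: hd_append)
    ultimately show ?thesis using less.hyps[of "as @ [x] @ cs"] less.prems(1) p by auto
  qed (use less.prems in blast)
qed

text \<open>The two halves of a walk through \<open>e\<close> are shortened separately: a walk
  through \<open>e\<close> with distinct edges need not exist.\<close>

lemma edge_reachable:
  assumes "e \<in> edges G"
  obtains i j p q where "i \<in> sources G" "j \<in> sinks G"
    "epath p" "distinct p" "hd p = boundary_edge G i" "last p = e"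
    "epath q" "distinct q" "hd q = e" "last q = boundary_edge G j"
proof -
  obtain i j r where r: "i < nb G" "j < nb G" "walk G i j r" "e \<in> set r"
    using paths assms unfolding PBDTP_def by blast
  then obtain r1 r2 where r12: "r = r1 @ e # r2" by (meson split_list)
  have "epath r" using r(3) by (simp add: walk_epath)
  then have "epath (r1 @ [e])" "epath (e # r2)"
    unfolding r12 epath_def by (auto simp: successively_append_iff successively_Cons)
  moreover have "hd (r1 @ [e]) = boundary_edge G i" "last (e # r2) = boundary_edge G j"
    using walk_ends(3,4)[OF r(3,1,2)] unfolding r12 by (auto simp: hd_append)
  ultimately show thesis
    using that walk_ends(1,2)[OF r(3,1,2)] distinct_epath[of "r1 @ [e]"] distinct_epath[of "e # r2"]
    by (metis last_snoc list.sel(1))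
qed

text \<open>Two path edges leaving one vertex would be preceded by two different path edges entering
  it. The first edge has no predecessor on the path, hence \<open>tl p\<close>.\<close>

lemma next_edge_unique:
  assumes "epath p" "distinct p" "Suc k < length p" "f \<in> set (tl p)" "fst f = snd (p ! k)"
  shows "f = p ! Suc k"
proof -
  obtain l where l: "l < length (tl p)" "tl p ! l = f" using assms(4) by (meson in_set_conv_nth)
  then have l': "Suc l < length p" "p ! Suc l = f" by (auto simp: nth_tl)
  have "l = k"
  proof (rule ccontr)
    assume "l \<noteq> k"
    then have "p ! l \<noteq> p ! k" "p ! Suc l \<noteq> p ! Suc k"
      using l'(1) assms(2,3) by (simp_all add: nth_eq_iff_index_eq)
    moreover have "{p ! l, p ! k, p ! Suc l, p ! Suc k} \<subseteq> edges G"
      using assms(1,3) l'(1) by (auto intro!: epath_in)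
    ultimately show False
      using not_two_in_two_out[of "p ! l" "p ! k" "p ! Suc l" "p ! Suc k" "snd (p ! k)"]
        epath_nth[OF assms(1)] assms(3,5) l' by metis
  qed
  with l' show ?thesis by simp
qed

text \<open>At least one of at most three edges at the head comes in. The bound 2 is why weights up
  to 1/3 keep the transfer matrix contracting.\<close>

lemma card_next_edges: "e \<in> edges G \<Longrightarrow> card {f \<in> edges G. fst f = snd e} \<le> 2"
proof -
  assume e: "e \<in> edges G"
  then have "e \<in> in_edges G (snd e)" by (simp add: in_edges_def)
  then have "card (in_edges G (snd e)) \<ge> 1" using card_0_eq[of "in_edges G (snd e)"] by (metis One_nat_def Suc_leI bot_nat_0.not_eq_extremum empty_iff finite_in_out(1))
  moreover have "card (in_edges G (snd e)) + card (out_edges G (snd e)) \<le> 3"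
    using card_edges_at_le[OF e] card_edges_at by metis
  ultimately show ?thesis unfolding out_edges_def by simp
qed

end

section \<open>The transfer matrix of a signed network\<close>

locale signed_net = plabic_net +
  fixes s :: "edge \<Rightarrow> real"
  assumes s_unit: "s e = 1 \<or> s e = -1"
begin

text \<open>The matrix \<open>1 - T\<close>. Row \<open>e\<close> is the equation at the head of
  \<open>e\<close>: the unknown at \<open>e\<close> minus the weighted unknowns of the edges that
  continue \<open>e\<close>.\<close>

definition tmat :: "(edge \<Rightarrow> real) \<Rightarrow> edge \<Rightarrow> edge \<Rightarrow> real" where
  "tmat w e f = (if e = f then 1 else 0) - (if snd e = fst f then s f * w f else 0)"

definition gdet :: "(edge \<Rightarrow> real) \<Rightarrow> real" where
  "gdet w = set_det (edges G) (tmat w)"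

text \<open>Cramer's numerator. Divided by \<open>gdet\<close> it is the signed sum over paths from
  \<open>a\<close> to \<open>b\<close> of the weights of all edges after the first.\<close>

definition cof :: "edge \<Rightarrow> edge \<Rightarrow> (edge \<Rightarrow> real) \<Rightarrow> real" where
  "cof a b w = set_det (edges G) (\<lambda>e f. if f = a then (if e = b then 1 else 0) else tmat w e f)"

lemma s_nonzero [simp]: "s e \<noteq> 0" using s_unit[of e] by auto

lemma tmat_mult:
  assumes "e \<in> edges G"
  shows "(\<Sum>f\<in>edges G. tmat w e f * y f) = y e - (\<Sum>f | f \<in> edges G \<and> fst f = snd e. s f * w f * y f)"
proof -
  have "(\<Sum>f\<in>edges G. tmat w e f * y f)
    = (\<Sum>f\<in>edges G. (if e = f then y f else 0) - (if fst f = snd e then s f * w f * y f else 0))"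
    by (intro sum.cong) (auto simp: tmat_def algebra_simps)
  also have "\<dots> = y e - (\<Sum>f\<in>edges G. if fst f = snd e then s f * w f * y f else 0)"
    using assms by (simp add: sum_subtractf)
  also have "(\<Sum>f\<in>edges G. if fst f = snd e then s f * w f * y f else 0)
    = (\<Sum>f | f \<in> edges G \<and> fst f = snd e. s f * w f * y f)"
    by (simp add: sum.inter_filter)
  finally show ?thesis .
qed

lemma cof_eq:
  assumes "\<And>e. e \<in> edges G \<Longrightarrow> (\<Sum>f\<in>edges G. tmat w e f * y f) = (if e = b then 1 else 0)" "a \<in> edges G"
  shows "cof a b w = gdet w * y a"
  unfolding cof_def gdet_def using assms by (rule set_det_cramer[OF finite_edges])

lemma polyfun_tmat:
  assumes "f \<in> edges G"
  shows "polyfun (edges G) (\<lambda>w. tmat w e f)"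
proof -
  have "(\<lambda>w. tmat w e f) = (\<lambda>w. (if e = f then 1 else 0) + (if snd e = fst f then - s f else 0) * w f)"
    by (auto simp: tmat_def)
  then show ?thesis by (simp only:) (intro polyfun.add polyfun.mult polyfun.const polyfun.var assms)
qed

lemma polyfun_gdet: "polyfun (edges G) gdet"
  unfolding gdet_def[abs_def] by (rule polyfun_set_det) (auto intro: polyfun_tmat)

lemma polyfun_cof: "polyfun (edges G) (cof a b)"
  unfolding cof_def[abs_def]
proof (rule polyfun_set_det[OF finite_edges])
  fix e f assume "f \<in> edges G"
  then show "polyfun (edges G) (\<lambda>w. if f = a then (if e = b then 1 else 0) else tmat w e f)"
    by (cases "f = a") (simp_all add: polyfun.const polyfun_tmat)
qed

text \<open>The weight of \<open>a\<close> occurs only in column \<open>a\<close>, and there it is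
  affine.\<close>

lemma gdet_affine:
  assumes a: "a \<in> edges G"
  shows "gdet (w(a := t)) = gdet (w(a := 0)) + t * (gdet (w(a := 1)) - gdet (w(a := 0)))"
proof -
  define p where "p e = (if e = a then 1 else 0 :: real)" for e
  define q where "q e = (if snd e = fst a then - s a else 0)" for e :: edge
  have eq: "tmat (w(a := t)) = (\<lambda>e f. if f = a then p e + t * q e else tmat w e f)" for t
    by (intro ext) (auto simp: tmat_def p_def q_def)
  have r: "gdet (w(a := t)) = set_det (edges G) (\<lambda>e f. if f = a then p e else tmat w e f)
      + t * set_det (edges G) (\<lambda>e f. if f = a then q e else tmat w e f)" for t
    unfolding gdet_def eq by (rule set_det_col_affine[OF finite_edges a])
  show ?thesis using r[of 0] r[of 1] r[of t] by simp
qed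

text \<open>As for \<open>gdet\<close>, provided that column \<open>a\<close> has not been replaced
  by the right-hand side.\<close>

lemma cof_affine:
  assumes a: "a \<in> edges G" and ca: "a \<noteq> c"
  shows "cof c b (w(a := t)) = cof c b (w(a := 0)) + t * (cof c b (w(a := 1)) - cof c b (w(a := 0)))"
proof -
  define p where "p e = (if e = a then 1 else 0 :: real)" for e
  define q where "q e = (if snd e = fst a then - s a else 0)" for e :: edge
  define M where "M e f = (if f = c then (if e = b then 1 else 0) else tmat w e f)" for e f
  have eq: "(\<lambda>e f. if f = c then (if e = b then 1 else 0) else tmat (w(a := t)) e f) =
    (\<lambda>e f. if f = a then p e + t * q e else M e f)" for t
    using ca by (intro ext) (auto simp: tmat_def p_def q_def M_def)
  have r: "cof c b (w(a := t)) = set_det (edges G) (\<lambda>e f. if f = a then p e else M e f)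
      + t * set_det (edges G) (\<lambda>e f. if f = a then q e else M e f)" for t
    unfolding cof_def eq by (rule set_det_col_affine[OF finite_edges a])
  show ?thesis using r[of 0] r[of 1] r[of t] by simp
qed

lemma cof_upd_col: "cof a b (w(a := t)) = cof a b w"
  unfolding cof_def by (rule set_det_cong) (auto simp: tmat_def)

text \<open>Maximum principle: a kernel vector of largest absolute value at \<open>e\<close>
  satisfies \<open>\<bar>y e\<bar> \<le> 2 * (1 / 3) * \<bar>y e\<bar>\<close>.\<close>

lemma gdet_nonzero_small:
  assumes w: "\<And>f. f \<in> edges G \<Longrightarrow> \<bar>w f\<bar> \<le> 1 / 3"
  shows "gdet w \<noteq> 0"
  unfolding gdet_def
proof (rule set_det_nonzeroI[OF finite_edges])
  fix y assume "\<And>e. e \<in> edges G \<Longrightarrow> (\<Sum>f\<in>edges G. tmat w e f * y f) = 0"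
  then have y: "y e = (\<Sum>f | f \<in> edges G \<and> fst f = snd e. s f * w f * y f)" if "e \<in> edges G" for e
    using that tmat_mult[OF that, of w y] by simp
  show "\<forall>e\<in>edges G. y e = 0"
  proof (cases "edges G = {}")
    case False
    then have "Max ((\<lambda>e. \<bar>y e\<bar>) ` edges G) \<in> (\<lambda>e. \<bar>y e\<bar>) ` edges G" by (intro Max_in) auto
    then obtain e where e: "e \<in> edges G" "Max ((\<lambda>e. \<bar>y e\<bar>) ` edges G) = \<bar>y e\<bar>" by blast
    have max: "\<bar>y f\<bar> \<le> \<bar>y e\<bar>" if "f \<in> edges G" for f
      unfolding e(2)[symmetric] using that by (intro Max_ge) auto
    have "\<bar>y e\<bar> \<le> (\<Sum>f | f \<in> edges G \<and> fst f = snd e. \<bar>s f * w f * y f\<bar>)"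
      by (subst y[OF e(1)]) (rule sum_abs)
    also have "\<dots> \<le> (\<Sum>f | f \<in> edges G \<and> fst f = snd e. 1 / 3 * \<bar>y e\<bar>)"
    proof (rule sum_mono)
      fix f assume f: "f \<in> {f. f \<in> edges G \<and> fst f = snd e}"
      have "\<bar>s f\<bar> = 1" using s_unit[of f] by auto
      moreover have "\<bar>w f\<bar> * \<bar>y f\<bar> \<le> 1 / 3 * \<bar>y e\<bar>"
        by (rule mult_mono) (use w[of f] max[of f] f in auto)
      ultimately show "\<bar>s f * w f * y f\<bar> \<le> 1 / 3 * \<bar>y e\<bar>" by (simp add: abs_mult)
    qed
    also have "\<dots> = card {f. f \<in> edges G \<and> fst f = snd e} * (1 / 3 * \<bar>y e\<bar>)" by simp
    also have "\<dots> \<le> 2 * (1 / 3 * \<bar>y e\<bar>)"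
      using card_next_edges[OF e(1)] by (intro mult_right_mono) auto
    finally have "y e = 0" by simp
    with max show ?thesis by auto
  qed simp
qed

lemma gdet_solvable:
  assumes "gdet w \<noteq> 0"
  obtains y where "\<And>e. e \<in> edges G \<Longrightarrow> (\<Sum>f\<in>edges G. tmat w e f * y f) = b e"
  using set_det_solvable[OF finite_edges assms[unfolded gdet_def]] by blast

text \<open>For weights supported on the path, the only continuation of \<open>p ! k\<close> that
  can carry weight is \<open>p ! Suc k\<close>. The assumption on \<open>hd p\<close> rules out a
  weighted return to the first edge.\<close>

lemma trail_value:
  assumes p: "epath p" "distinct p"
    and w: "\<And>f. f \<notin> set p \<Longrightarrow> w f = 0"
    and hd: "w (hd p) \<noteq> 0 \<Longrightarrow> Suc k < length p \<Longrightarrow> fst (hd p) \<noteq> snd (p ! k)"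
    and y: "\<And>e. e \<in> edges G \<Longrightarrow> (\<Sum>f\<in>edges G. tmat w e f * y f) = (if e = last p then 1 else 0)"
    and k: "Suc k < length p"
  shows "y (p ! k) = s (p ! Suc k) * w (p ! Suc k) * y (p ! Suc k)"
proof -
  have p0: "p \<noteq> []" using k by auto
  have e: "p ! k \<in> edges G" using p(1) k by (intro epath_in) auto
  have "p ! k \<noteq> last p" using p(2) k p0 by (simp add: last_conv_nth nth_eq_iff_index_eq)
  moreover have "(\<Sum>f | f \<in> edges G \<and> fst f = snd (p ! k). s f * w f * y f)
    = (\<Sum>f \<in> {p ! Suc k}. s f * w f * y f)"
  proof (rule sum.mono_neutral_right)
    show "{p ! Suc k} \<subseteq> {f. f \<in> edges G \<and> fst f = snd (p ! k)}"
      using epath_nth[OF p(1) k] p(1) k by (auto intro: epath_in)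
    show "\<forall>f\<in>{f. f \<in> edges G \<and> fst f = snd (p ! k)} - {p ! Suc k}. s f * w f * y f = 0"
    proof
      fix f assume f: "f \<in> {f. f \<in> edges G \<and> fst f = snd (p ! k)} - {p ! Suc k}"
      have "w f = 0"
      proof (cases "f \<in> set p")
        case True
        then have "f = hd p" using next_edge_unique[OF p k, of f] f p0 by (cases p) auto
        then show ?thesis using hd k f by auto
      qed (rule w)
      then show "s f * w f * y f = 0" by simp
    qed
  qed simp
  ultimately show ?thesis using y[OF e] tmat_mult[OF e, of w y] by simp
qed

text \<open>Weights on the path alone make the solution propagate backwards from its end; the value
  1/3 keeps \<open>gdet\<close> nonzero.\<close>

lemma cof_not_identically_zero:
  assumes p: "epath p" "distinct p"
  shows "\<exists>w. cof (hd p) (last p) w \<noteq> 0"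
proof -
  define w where "w f = (if f \<in> set (tl p) then 1 / 3 else 0 :: real)" for f
  have g: "gdet w \<noteq> 0" by (rule gdet_nonzero_small) (simp add: w_def)
  obtain y where y: "\<And>e. e \<in> edges G \<Longrightarrow> (\<Sum>f\<in>edges G. tmat w e f * y f) = (if e = last p then 1 else 0)"
    using gdet_solvable[OF g, of "\<lambda>e. if e = last p then 1 else 0"] by metis
  have p0: "p \<noteq> []" using p(1) by (simp add: epath_def)
  have hd: "w (hd p) = 0" using p(2) p0 by (cases p) (auto simp: w_def)
  have next_value: "y (p ! k) = 0 \<longleftrightarrow> y (p ! Suc k) = 0" if k: "Suc k < length p" for k
  proof -
    have "p ! Suc k \<in> set (tl p)" using k p0 by (cases p) auto
    moreover have "y (p ! k) = s (p ! Suc k) * w (p ! Suc k) * y (p ! Suc k)"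
      by (rule trail_value[OF p _ _ y k]) (use hd in \<open>auto simp: w_def dest: list.set_sel(2)[OF p0]\<close>)
    moreover have "w (p ! Suc k) = 1 / 3" using calculation(1) by (simp add: w_def)
    ultimately show ?thesis by (simp only: mult_eq_0_iff) simp
  qed
  have iff: "y (p ! k) = 0 \<longleftrightarrow> y (last p) = 0" if "k < length p" for k
  proof -
    have "k \<le> length p - 1" using that by simp
    then show ?thesis
    proof (induction rule: inc_induct)
      case base show ?case using p0 by (simp add: last_conv_nth)
    next
      case (step n)
      then have "Suc n < length p" by simp
      from next_value[OF this] step(3) show ?case by simp
    qed
  qed
  \<comment> \<open>Otherwise \<open>y\<close> vanishes along the whole path and the equation at
    \<open>last p\<close> reads \<open>0 = 1\<close>.\<close>
  have "y (last p) \<noteq> 0"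
  proof
    assume z: "y (last p) = 0"
    then have "y f = 0" if "f \<in> set p" for f using iff that by (metis in_set_conv_nth)
    then have "s f * w f * y f = 0" for f
      using list.set_sel(2)[OF p0, of f] by (cases "f \<in> set (tl p)") (simp_all add: w_def)
    then have "(\<Sum>f | f \<in> edges G \<and> fst f = snd (last p). s f * w f * y f) = 0"
      by (intro sum.neutral) simp
    moreover have "last p \<in> edges G" using p(1) p0 by (intro epath_in) auto
    ultimately have "y (last p) = 1" using y[of "last p"] tmat_mult[of "last p" w y] by simp
    with z show False by simp
  qed
  then have "y (hd p) \<noteq> 0" using iff[of 0] p0 by (simp add: hd_conv_nth)
  moreover have "cof (hd p) (last p) w = gdet w * y (hd p)"
    by (rule cof_eq[OF y]) (use p(1) p0 in \<open>auto intro: epath_in\<close>)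
  ultimately show ?thesis using g by (intro exI[of _ w]) simp
qed

end

section \<open>Total nonnegativity forces a positive determinant\<close>

text \<open>The second factor changes sign at its positive root \<open>t0\<close>, so the first must
  change sign there too. The conclusion expresses the common root.\<close>

lemma affine_common_root:
  fixes c0 c1 g0 g1 :: real
  assumes nn: "\<And>t. 0 < t \<Longrightarrow> 0 \<le> (c0 + c1 * t) * (g0 + g1 * t)" and neg: "g0 * g1 < 0"
  shows "c0 * g1 = c1 * g0"
proof (rule ccontr)
  assume ne: "c0 * g1 \<noteq> c1 * g0"
  define t0 where "t0 = - g0 / g1"
  define q where "q = c0 + c1 * t0"
  have g1: "g1 \<noteq> 0" using neg by auto
  have t0: "0 < t0" using neg by (auto simp: t0_def divide_less_0_iff zero_less_divide_iff mult_less_0_iff)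
  have "q * g1 = c0 * g1 - c1 * g0" using g1 by (simp add: q_def t0_def field_simps)
  then have q: "q \<noteq> 0" using ne by auto
  \<comment> \<open>Small enough that both \<open>t0 + \<delta>\<close> and
    \<open>t0 - \<delta>\<close> are positive and that the first factor keeps the sign of
    \<open>q\<close>, its value at \<open>t0\<close>, at both points.\<close>
  define \<delta> where "\<delta> = min (t0 / 2) (\<bar>q\<bar> / (2 * (\<bar>c1\<bar> + 1)))"
  have \<delta>: "0 < \<delta>" "\<delta> < t0" using t0 q by (auto simp: \<delta>_def)
  have "\<bar>c1\<bar> * \<delta> \<le> \<bar>c1\<bar> * (\<bar>q\<bar> / (2 * (\<bar>c1\<bar> + 1)))" by (intro mult_left_mono) (auto simp: \<delta>_def)
  also have "\<dots> < \<bar>q\<bar>" using q by (simp add: divide_less_eq) (smt (verit) abs_ge_zero mult_left_mono mult_nonneg_nonneg zero_less_abs_iff)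
  finally have small: "\<bar>c1 * \<delta>\<bar> < \<bar>q\<bar>" using \<delta>(1) by (simp add: abs_mult)
  have gt: "g0 + g1 * (t0 + h) = g1 * h" "c0 + c1 * (t0 + h) = q + c1 * h" for h
    using g1 by (simp_all add: t0_def q_def field_simps)
  have "0 \<le> (q + c1 * \<delta>) * (g1 * \<delta>)" using nn[of "t0 + \<delta>"] \<delta> t0 unfolding gt by simp
  then have 1: "0 \<le> (q + c1 * \<delta>) * g1" using \<delta>(1) by (simp add: zero_le_mult_iff mult.assoc[symmetric])
  have "0 \<le> (q + c1 * (- \<delta>)) * (g1 * (- \<delta>))" using nn[of "t0 + - \<delta>"] \<delta> t0 unfolding gt by simp
  then have 2: "(q - c1 * \<delta>) * g1 \<le> 0" using \<delta>(1) by (simp add: mult_le_0_iff mult.assoc[symmetric])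
  show False
  proof (cases "q > 0")
    case True
    then have "q + c1 * \<delta> > 0" "q - c1 * \<delta> > 0" using small by auto
    then have "0 \<le> g1" "g1 \<le> 0" using 1 2 by (auto simp: zero_le_mult_iff mult_le_0_iff)
    then show False using g1 by simp
  next
    case False
    then have "q + c1 * \<delta> < 0" "q - c1 * \<delta> < 0" using small q by auto
    then have "g1 \<le> 0" "0 \<le> g1" using 1 2 by (auto simp: zero_le_mult_iff mult_le_0_iff)
    then show False using g1 by simp
  qed
qed

text \<open>On the line through \<open>u\<close> and \<open>v\<close> both factors restrict to
  nonzero univariate polynomials, whose product is nonzero.\<close>

lemma polyfun_mult_nonzero:
  assumes "polyfun E f" "polyfun E g" "f u \<noteq> 0" "g v \<noteq> 0"
  shows "\<exists>w. f w * g w \<noteq> 0"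
proof -
  obtain p where p: "\<And>t. f (\<lambda>a. u a + t * (v a - u a)) = poly p t"
    using polyfun_line[OF assms(1), of u "\<lambda>a. v a - u a"] by blast
  obtain q where q: "\<And>t. g (\<lambda>a. u a + t * (v a - u a)) = poly q t"
    using polyfun_line[OF assms(2), of u "\<lambda>a. v a - u a"] by blast
  have "p \<noteq> 0" "q \<noteq> 0" using p[of 0] q[of 1] assms(3,4) by auto
  then have "p * q \<noteq> 0" by simp
  then obtain t where "poly (p * q) t \<noteq> 0" using poly_all_0_iff_0 by blast
  then have "f (\<lambda>a. u a + t * (v a - u a)) * g (\<lambda>a. u a + t * (v a - u a)) \<noteq> 0"
    using p[of t] q[of t] by simp
  then show ?thesis by blast
qed

context signed_net
begin

lemma tmat_unique:
  assumes g: "gdet w \<noteq> 0"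
    and y: "\<And>e. e \<in> edges G \<Longrightarrow> (\<Sum>f\<in>edges G. tmat w e f * y f) = b e"
    and y': "\<And>e. e \<in> edges G \<Longrightarrow> (\<Sum>f\<in>edges G. tmat w e f * y' f) = b e"
    and a: "a \<in> edges G"
  shows "y a = y' a"
proof -
  have "gdet w * y a = gdet w * y' a"
    unfolding gdet_def
    using set_det_cramer[OF finite_edges, of "tmat w" y b, OF y a]
      set_det_cramer[OF finite_edges, of "tmat w" y' b, OF y' a] by metis
  then show ?thesis using g by simp
qed

text \<open>No edge ends at a boundary source, so the column of its edge is a unit column.\<close>

lemma gdet_source_edge:
  assumes "i \<in> sources G"
  shows "gdet (w(boundary_edge G i := t)) = gdet w"
  unfolding gdet_def
  by (rule set_det_cong) (use source_edge[OF assms] in \<open>auto simp: tmat_def\<close>)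

lemma gdet_zero: "gdet (\<lambda>_. 0) = 1"
proof -
  have "tmat (\<lambda>_. 0) = (\<lambda>e f. if e = f then 1 else 0)" by (auto simp: tmat_def fun_eq_iff)
  then show ?thesis unfolding gdet_def by (simp add: set_det_unit)
qed

end

text \<open>Total nonnegativity is reduced to one sign per source and sink. Numerator times
  determinant replaces their quotient, so that the condition is polynomial and passes to
  limits.\<close>

locale positive_net = signed_net +
  fixes \<kappa> :: "nat \<Rightarrow> nat \<Rightarrow> real"
  assumes \<kappa>_unit: "\<kappa> i j = 1 \<or> \<kappa> i j = -1"
    and cof_nonneg: "i \<in> sources G \<Longrightarrow> j \<in> sinks G \<Longrightarrow> (\<And>e. 0 < w e) \<Longrightarrow>
      0 \<le> \<kappa> i j * cof (boundary_edge G i) (boundary_edge G j) w * gdet w"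
begin

text \<open>If \<open>gdet\<close> vanishes at a positive value of the weight of \<open>e\<close>, so does the numerator of the
  boundary measurement from \<open>i\<close> to \<open>j\<close>, which is therefore independent of the weight of \<open>e\<close>.
  For generic weights this contradicts the existence of walks from \<open>i\<close> to \<open>j\<close> through \<open>e\<close>.\<close>

lemma gdet_slope_sign_generic:
  assumes e: "e \<in> edges G" and i: "i \<in> sources G" and j: "j \<in> sinks G"
    and ne: "e \<noteq> boundary_edge G i" and w: "\<And>a. 0 < w a"
    and gen: "cof (boundary_edge G i) e w \<noteq> 0" "cof e (boundary_edge G j) w \<noteq> 0" "gdet w \<noteq> 0"
  shows "0 \<le> gdet (w(e := 0)) * (gdet (w(e := 1)) - gdet (w(e := 0)))"
proof (rule ccontr)
  let ?i = "boundary_edge G i" and ?j = "boundary_edge G j"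
  define g0 where "g0 = gdet (w(e := 0))"
  define g1 where "g1 = gdet (w(e := 1)) - gdet (w(e := 0))"
  define c0 where "c0 = cof ?i ?j (w(e := 0))"
  define c1 where "c1 = cof ?i ?j (w(e := 1)) - cof ?i ?j (w(e := 0))"
  have g: "gdet (w(e := t)) = g0 + g1 * t" for t
    unfolding g0_def g1_def by (subst gdet_affine[OF e]) simp
  have c: "cof ?i ?j (w(e := t)) = c0 + c1 * t" for t
    unfolding c0_def c1_def by (subst cof_affine[OF e ne]) simp
  have iE: "?i \<in> edges G" using source_edge[OF i] by simp
  assume "\<not> ?thesis"
  then have neg: "g0 * g1 < 0" by (simp add: g0_def g1_def)
  have "0 \<le> ((\<kappa> i j * c0) + (\<kappa> i j * c1) * t) * (g0 + g1 * t)" if "0 < t" for t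
    using cof_nonneg[OF i j, of "w(e := t)"] w that unfolding g c by (simp add: algebra_simps)
  from affine_common_root[OF this neg] have proportional: "c0 * g1 = c1 * g0"
    using \<kappa>_unit[of i j] by auto
  \<comment> \<open>A second value of the weight of \<open>e\<close>: larger than both the old
    weight and the root of \<open>gdet\<close>, hence different from both.\<close>
  define t' where "t' = w e + (- g0 / g1) + 1"
  have g1: "g1 \<noteq> 0" using neg by auto
  have t0: "0 < - g0 / g1" using neg by (auto simp: zero_less_divide_iff divide_less_0_iff mult_less_0_iff)
  define w' where "w' = w(e := t')"
  have t': "t' \<noteq> w e" "t' \<noteq> - g0 / g1" using t0 w[of e] by (auto simp: t'_def)
  have gw': "gdet w' \<noteq> 0" using t'(2) g1 unfolding w'_def g by (auto simp: field_simps)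
  \<comment> \<open>With a common root the quotient of numerator and determinant is the constant
    \<open>c1 / g1\<close>.\<close>
  have quot: "cof ?i ?j (w(e := t)) * g1 = c1 * gdet (w(e := t))" for t
    unfolding g c using proportional by (simp add: algebra_simps)
  obtain y where y: "\<And>a. a \<in> edges G \<Longrightarrow> (\<Sum>f\<in>edges G. tmat w a f * y f) = (if a = ?j then 1 else 0)"
    using gdet_solvable[OF gen(3), of "\<lambda>a. if a = ?j then 1 else 0"] by metis
  obtain r where r: "\<And>a. a \<in> edges G \<Longrightarrow> (\<Sum>f\<in>edges G. tmat w a f * r f) = (if a = e then 1 else 0)"
    using gdet_solvable[OF gen(3), of "\<lambda>a. if a = e then 1 else 0"] by metis
  obtain y' where y': "\<And>a. a \<in> edges G \<Longrightarrow> (\<Sum>f\<in>edges G. tmat w' a f * y' f) = (if a = ?j then 1 else 0)"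
    using gdet_solvable[OF gw', of "\<lambda>a. if a = ?j then 1 else 0"] by metis
  have "gdet w * y ?i * g1 = c1 * gdet w" using quot[of "w e"] cof_eq[OF y iE] by simp
  moreover have "gdet w' * y' ?i * g1 = c1 * gdet w'" using quot[of t'] cof_eq[OF y' iE] by (simp add: w'_def)
  ultimately have same: "y' ?i = y ?i" using gen(3) gw' g1 by simp (metis mult.commute mult_right_cancel)
  have y'e: "y' e \<noteq> 0"
    using cof_eq[OF y' e] gen(2) cof_upd_col[of e ?j w t'] by (auto simp: w'_def)
  have ri: "r ?i \<noteq> 0" using cof_eq[OF r iE] gen(1) by auto
  have sum1: "(\<Sum>f\<in>edges G. tmat w a f * y' f)
      = (if a = ?j then 1 else 0) + (if snd a = fst e then s e * (t' - w e) * y' e else 0)"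
    if "a \<in> edges G" for a
  proof -
    have "(\<Sum>f\<in>edges G. tmat w a f * y' f)
      = (\<Sum>f\<in>edges G. tmat w' a f * y' f + (if f = e then (if snd a = fst e then s e * (t' - w e) * y' e else 0) else 0))"
      by (intro sum.cong refl) (auto simp: tmat_def w'_def algebra_simps)
    then show ?thesis using e y'[OF that] by (simp add: sum.distrib)
  qed
  have sum2: "(\<Sum>f\<in>edges G. tmat w a f * (if f = e then 1 else 0))
      = (if a = e then 1 else 0) - (if snd a = fst e then s e * w e else 0)" for a
    using e by (simp add: if_distrib[of "\<lambda>x. _ * x"] tmat_def cong: if_cong)
  \<comment> \<open>The change of the weight perturbs only column \<open>e\<close>. Adding
    \<open>?k\<close> at \<open>e\<close> to \<open>w e * y'\<close> cancels this perturbation, so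
    the result solves the old system with right-hand side supported at \<open>?j\<close> and
    \<open>e\<close>; so does \<open>w e * y + ?k * r\<close>. Comparison at \<open>?i\<close> gives
    \<open>?k * r ?i = 0\<close>.\<close>
  let ?k = "(t' - w e) * y' e"
  have "w e * y' ?i + ?k * (if ?i = e then 1 else 0) = w e * y ?i + ?k * r ?i"
  proof (rule tmat_unique[OF gen(3) _ _ iE])
    fix a assume a: "a \<in> edges G"
    have "(\<Sum>f\<in>edges G. tmat w a f * (w e * y' f + ?k * (if f = e then 1 else 0)))
       = w e * (\<Sum>f\<in>edges G. tmat w a f * y' f) + ?k * (\<Sum>f\<in>edges G. tmat w a f * (if f = e then 1 else 0))"
      unfolding sum_distrib_left sum.distrib[symmetric] by (intro sum.cong) (simp_all add: algebra_simps)
    also have "\<dots> = w e * (if a = ?j then 1 else 0) + ?k * (if a = e then 1 else 0)"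
      unfolding sum1[OF a] sum2 by (simp add: algebra_simps)
    finally show "(\<Sum>f\<in>edges G. tmat w a f * (w e * y' f + ?k * (if f = e then 1 else 0)))
       = w e * (if a = ?j then 1 else 0) + ?k * (if a = e then 1 else 0)" .
    have "(\<Sum>f\<in>edges G. tmat w a f * (w e * y f + ?k * r f))
       = w e * (\<Sum>f\<in>edges G. tmat w a f * y f) + ?k * (\<Sum>f\<in>edges G. tmat w a f * r f)"
      unfolding sum_distrib_left sum.distrib[symmetric] by (intro sum.cong) (simp_all add: algebra_simps)
    then show "(\<Sum>f\<in>edges G. tmat w a f * (w e * y f + ?k * r f))
       = w e * (if a = ?j then 1 else 0) + ?k * (if a = e then 1 else 0)"
      unfolding y[OF a] r[OF a] .
  qed
  then have "?k * r ?i = 0" using same ne by simp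
  then show False using ri y'e t'(1) by simp
qed

text \<open>The polynomial \<open>d\<close> collects the genericity conditions. None of its factors
  vanishes identically, thanks to a path from a source to \<open>e\<close>, a path from
  \<open>e\<close> to a sink, and \<open>gdet_zero\<close>.\<close>

lemma gdet_slope_sign:
  assumes e: "e \<in> edges G" and w: "\<And>a. 0 \<le> w a"
  shows "0 \<le> gdet (w(e := 0)) * (gdet (w(e := 1)) - gdet (w(e := 0)))"
proof -
  obtain i j p q where ij: "i \<in> sources G" "j \<in> sinks G" and
    p: "epath p" "distinct p" "hd p = boundary_edge G i" "last p = e" and
    q: "epath q" "distinct q" "hd q = e" "last q = boundary_edge G j"
    using edge_reachable[OF e] .
  show ?thesis
  proof (cases "e = boundary_edge G i")
    case True then show ?thesis using gdet_source_edge[OF ij(1)] by simp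
  next
    case False
    define d where "d w = cof (boundary_edge G i) e w * (cof e (boundary_edge G j) w * gdet w)" for w
    have upd: "polyfun (edges G) (\<lambda>w. gdet (w(e := t)))" for t
      by (rule polyfun_subst) (use polyfun_gdet e in \<open>simp add: insert_absorb\<close>)
    have "gdet (\<lambda>_. 0) \<noteq> 0" by (simp add: gdet_zero)
    with cof_not_identically_zero[OF q(1,2)]
    obtain u where "cof e (boundary_edge G j) u * gdet u \<noteq> 0"
      using polyfun_mult_nonzero[OF polyfun_cof polyfun_gdet] unfolding q by blast
    with cof_not_identically_zero[OF p(1,2)]
    obtain v where v: "d v \<noteq> 0"
      using polyfun_mult_nonzero[OF polyfun_cof polyfun.mult[OF polyfun_cof polyfun_gdet]]
      unfolding p d_def by blast
    show ?thesis
    proof (rule polyfun_dense_nonneg[where E = "edges G" and d = d and h = "\<lambda>w. gdet (w(e := 0)) * (gdet (w(e := 1)) - gdet (w(e := 0)))", OF _ _ v _ finite_edges w])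
      have "polyfun (edges G) (\<lambda>w. gdet (w(e := 0)) * (gdet (w(e := 1)) + (-1) * gdet (w(e := 0))))"
        by (intro polyfun.mult polyfun.add polyfun.const upd)
      then show "polyfun (edges G) (\<lambda>w. gdet (w(e := 0)) * (gdet (w(e := 1)) - gdet (w(e := 0))))" by simp
      show "polyfun (edges G) d"
        unfolding d_def[abs_def] by (intro polyfun.mult polyfun_cof polyfun_gdet)
      show "0 \<le> gdet (w(e := 0)) * (gdet (w(e := 1)) - gdet (w(e := 0)))"
        if "\<And>a. 0 < w a" "d w \<noteq> 0" for w
        using gdet_slope_sign_generic[OF e ij False that(1)] that(2) by (auto simp: d_def)
    qed
  qed
qed

text \<open>The edges are switched on one at a time. While the new weight is 0 the value is at least
  1 by induction, so the slope in that weight is nonnegative.\<close>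

theorem gdet_ge_1:
  assumes w: "\<And>a. a \<in> edges G \<Longrightarrow> 0 \<le> w a"
  shows "1 \<le> gdet w"
proof -
  have "1 \<le> gdet w" if "finite S" "S \<subseteq> edges G" "\<And>a. 0 \<le> w a" "\<And>a. a \<notin> S \<Longrightarrow> w a = 0" for S w
    using that
  proof (induction S arbitrary: w rule: finite_induct)
    case empty
    then have "w = (\<lambda>_. 0)" by auto
    then show ?case by (simp add: gdet_zero)
  next
    case (insert e S)
    have e: "e \<in> edges G" using insert.prems by simp
    have 1: "1 \<le> gdet (w(e := 0))" by (rule insert.IH) (use insert.prems in auto)
    have "0 \<le> gdet (w(e := 1)) - gdet (w(e := 0))"
      using gdet_slope_sign[OF e, of w] insert.prems(2) 1 by (simp add: zero_le_mult_iff)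
    then have "0 \<le> w e * (gdet (w(e := 1)) - gdet (w(e := 0)))" using insert.prems(2) by simp
    then show ?case using 1 gdet_affine[OF e, of w "w e"] by simp
  qed
  from this[of "edges G" "\<lambda>a. if a \<in> edges G then w a else 0"]
  have "1 \<le> gdet (\<lambda>a. if a \<in> edges G then w a else 0)" using w by simp
  moreover have "gdet (\<lambda>a. if a \<in> edges G then w a else 0) = gdet w"
    by (rule polyfun_cong[OF polyfun_gdet]) simp
  ultimately show ?thesis by simp
qed

section \<open>Signs of simple cycles and of simple boundary walks\<close>

lemma sign_prod_unit: "prod_list (map s p) = 1 \<or> prod_list (map s p) = -1"
proof (induction p)
  case (Cons e p)
  then show ?case using s_unit[of e] by auto
qed simp

lemma trail_solution:
  assumes p: "epath p" "distinct p"
    and w: "\<And>f. f \<notin> set p \<Longrightarrow> w f = 0" "\<And>f. f \<in> set (tl p) \<Longrightarrow> w f = 1"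
    and hd: "\<And>k. w (hd p) \<noteq> 0 \<Longrightarrow> Suc k < length p \<Longrightarrow> fst (hd p) \<noteq> snd (p ! k)"
    and y: "\<And>e. e \<in> edges G \<Longrightarrow> (\<Sum>f\<in>edges G. tmat w e f * y f) = (if e = last p then 1 else 0)"
  shows "y (hd p) = prod_list (map s (tl p)) * y (last p)"
proof -
  have p0: "p \<noteq> []" using p(1) by (simp add: epath_def)
  have "y (p ! k) = prod_list (map s (drop (Suc k) p)) * y (last p)" if "k \<le> length p - 1" for k
    using that
  proof (induction rule: inc_induct)
    case base show ?case using p0 by (simp add: last_conv_nth)
  next
    case (step n)
    then have k: "Suc n < length p" by simp
    then have "p ! Suc n \<in> set (tl p)" using p0 by (cases p) auto
    then have "y (p ! n) = s (p ! Suc n) * y (p ! Suc n)"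
      using trail_value[OF p w(1) hd y k] w(2) by simp
    then show ?case using step(3) k by (simp add: Cons_nth_drop_Suc[symmetric])
  qed
  from this[of 0] show ?thesis using p0 by (simp add: hd_conv_nth drop_Suc)
qed

text \<open>With unit weights on the cycle the system feeds the unknown back into itself with the
  sign of the cycle. For sign 1 this reads \<open>y = 1 + y\<close>, although
  \<open>gdet_ge_1\<close> guarantees a solution.\<close>

theorem simple_cycle_sign:
  assumes c: "epath c" "distinct c" and closed: "snd (last c) = fst (hd c)"
  shows "prod_list (map s c) = -1"
proof (rule ccontr)
  assume "prod_list (map s c) \<noteq> -1"
  then have one: "prod_list (map s c) = 1" using sign_prod_unit by blast
  have c0: "c \<noteq> []" using c(1) by (simp add: epath_def)
  define w where "w f = (if f \<in> set c then 1 else 0 :: real)" for f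
  have "1 \<le> gdet w" by (rule gdet_ge_1) (simp add: w_def)
  then have g: "gdet w \<noteq> 0" by auto
  obtain y where y: "\<And>e. e \<in> edges G \<Longrightarrow> (\<Sum>f\<in>edges G. tmat w e f * y f) = (if e = last c then 1 else 0)"
    using gdet_solvable[OF g, of "\<lambda>e. if e = last c then 1 else 0"] by metis
  have inE: "c ! k \<in> edges G" if "k < length c" for k using c(1) that by (intro epath_in) auto
  have lastE: "last c \<in> edges G" and hdE: "hd c \<in> edges G" using c(1) c0 by (auto intro: epath_in)
  \<comment> \<open>The cycle does not pass through its starting vertex early: that would give two
    edges in and two out.\<close>
  have hd: "fst (hd c) \<noteq> snd (c ! k)" if k: "Suc k < length c" for k
  proof
    assume eq: "fst (hd c) = snd (c ! k)"
    have ne: "c ! k \<noteq> last c" "hd c \<noteq> c ! Suc k"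
      using c(2) k c0 by (simp_all add: last_conv_nth hd_conv_nth nth_eq_iff_index_eq)
    have sub: "{c ! k, last c, hd c, c ! Suc k} \<subseteq> edges G"
      using inE[OF k] inE[of k] k lastE hdE by simp
    have "hd c = c ! Suc k"
      by (rule not_two_in_two_out[OF sub refl closed[unfolded eq] eq _ ne(1)])
         (rule epath_nth[OF c(1) k, symmetric])
    with ne(2) show False by contradiction
  qed
  have "y (hd c) = prod_list (map s (tl c)) * y (last c)"
  proof (rule trail_solution[OF c _ _ _ y])
    show "w f = 1" if "f \<in> set (tl c)" for f using list.set_sel(2)[OF c0 that] by (simp add: w_def)
  qed (use hd in \<open>simp_all add: w_def\<close>)
  then have "s (hd c) * y (hd c) = y (last c)"
    using one c0 by (cases c) (auto simp: mult.assoc[symmetric])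
  moreover have "y (last c) = 1 + s (hd c) * y (hd c)"
  proof -
    have "(\<Sum>f | f \<in> edges G \<and> fst f = snd (last c). s f * w f * y f) = (\<Sum>f\<in>{hd c}. s f * w f * y f)"
    proof (rule sum.mono_neutral_right)
      show "{hd c} \<subseteq> {f. f \<in> edges G \<and> fst f = snd (last c)}" using hdE closed by simp
      show "\<forall>f\<in>{f. f \<in> edges G \<and> fst f = snd (last c)} - {hd c}. s f * w f * y f = 0"
      proof
        fix f assume f: "f \<in> {f. f \<in> edges G \<and> fst f = snd (last c)} - {hd c}"
        have "f \<notin> set c"
        proof
          assume "f \<in> set c"
          then obtain k where k: "k < length c" "c ! k = f" by (meson in_set_conv_nth)
          with f c0 obtain l where l: "k = Suc l" by (cases k) (auto simp: hd_conv_nth)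
          with k have "snd (c ! l) = fst (hd c)" using epath_nth[OF c(1), of l] f closed by simp
          with hd[of l] k l show False by simp
        qed
        then show "s f * w f * y f = 0" by (simp add: w_def)
      qed
    qed simp
    then show ?thesis using y[OF lastE] tmat_mult[OF lastE, of w y] c0 by (simp add: w_def)
  qed
  ultimately show False by simp
qed

text \<open>For unit weights on the path beyond its first edge, \<open>cof\<close> is
  \<open>gdet\<close> times the sign of that part. The weights lie on the boundary of the orthant,
  which \<open>polyfun_dense_nonneg\<close> reaches. The factor \<open>s (boundary_edge G i)\<close>
  accounts for the first edge, left out by \<open>cof\<close>.\<close>

theorem simple_path_sign:
  assumes p: "walk G i j p" "distinct p" and ij: "i < nb G" "j < nb G"
  shows "prod_list (map s p) = s (boundary_edge G i) * \<kappa> i j"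
proof -
  have ep: "epath p" using p(1) by (simp add: walk_epath)
  then have p0: "p \<noteq> []" by (simp add: epath_def)
  note ends = walk_ends[OF p(1) ij]
  define w where "w f = (if f \<in> set (tl p) then 1 else 0 :: real)" for f
  have g: "1 \<le> gdet w" by (rule gdet_ge_1) (simp add: w_def)
  then have g0: "gdet w \<noteq> 0" by auto
  obtain y where y: "\<And>e. e \<in> edges G \<Longrightarrow> (\<Sum>f\<in>edges G. tmat w e f * y f) = (if e = last p then 1 else 0)"
    using gdet_solvable[OF g0, of "\<lambda>e. if e = last p then 1 else 0"] by metis
  have hd: "w (hd p) = 0" using p(2) p0 by (cases p) (auto simp: w_def)
  have val: "y (hd p) = prod_list (map s (tl p)) * y (last p)"
  proof (rule trail_solution[OF ep p(2) _ _ _ y])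
    show "w f = 0" if "f \<notin> set p" for f using list.set_sel(2)[OF p0, of f] that by (auto simp: w_def)
  qed (use hd in \<open>simp_all add: w_def\<close>)
  have lastE: "last p \<in> edges G" and hdE: "hd p \<in> edges G" using ep p0 by (auto intro: epath_in)
  have "{f. f \<in> edges G \<and> fst f = snd (last p)} = {}"
    using sink_edge[OF ends(2)] ends(4) by auto
  then have "y (last p) = 1" using y[OF lastE] tmat_mult[OF lastE, of w y] by (simp only: sum.empty) simp
  with val have c: "cof (hd p) (last p) w = gdet w * prod_list (map s (tl p))"
    using cof_eq[OF y hdE] by simp
  have "0 \<le> \<kappa> i j * cof (boundary_edge G i) (boundary_edge G j) w * gdet w"
  proof (rule polyfun_dense_nonneg[where E = "edges G" and d = "\<lambda>_. 1" and h = "\<lambda>w. \<kappa> i j * cof (boundary_edge G i) (boundary_edge G j) w * gdet w"])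
    show "polyfun (edges G) (\<lambda>w. \<kappa> i j * cof (boundary_edge G i) (boundary_edge G j) w * gdet w)"
      by (intro polyfun.mult polyfun.const polyfun_cof polyfun_gdet)
    show "0 \<le> w a" for a by (simp add: w_def)
  qed (use cof_nonneg[OF ends(1,2)] in \<open>auto intro: polyfun.const\<close>)
  then have "0 \<le> (\<kappa> i j * prod_list (map s (tl p))) * (gdet w * gdet w)"
    using c ends by (simp add: algebra_simps)
  then have "0 \<le> \<kappa> i j * prod_list (map s (tl p))"
    using zero_le_mult_iff[of "\<kappa> i j * prod_list (map s (tl p))" "gdet w * gdet w"]
      not_real_square_gt_zero[of "gdet w"] g0 by linarith
  then have "\<kappa> i j = prod_list (map s (tl p))"
    using sign_prod_unit[of "tl p"] \<kappa>_unit[of i j] by auto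
  then show ?thesis using ends p0 by (cases p) auto
qed

end

section \<open>Lam's system and the transfer matrix\<close>

text \<open>Solving the relation at a white vertex for its incoming half-edge moves the outgoing
  ones to the other side, whence the minus sign; at a black vertex the incoming half-edge simply
  equals the outgoing one.\<close>

definition lam_sign :: "plabic \<Rightarrow> (edge \<Rightarrow> nat) \<Rightarrow> edge \<Rightarrow> real" where
  "lam_sign G \<epsilon> f = (-1) ^ \<epsilon> f * (if fst f \<in> white G then -1 else 1)"

locale lam_net = plabic_net +
  fixes \<epsilon> :: "edge \<Rightarrow> nat"

sublocale lam_net \<subseteq> signed_net G "lam_sign G \<epsilon>"
  by unfold_locales (simp add: lam_sign_def minus_one_power_iff)

context lam_net
begin

lemma lam_solution_closed:
  assumes "lam_solution G w \<epsilon> x z" "e \<in> edges G"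
  shows "z (snd e, e) \<in> carrier_vec (nb G)" "z (fst e, e) \<in> carrier_vec (nb G)"
proof -
  have "z \<in> half_edges G \<rightarrow>\<^sub>E carrier_vec (nb G)"
    using assms(1) unfolding lam_solution_def lam_system_def by blast
  moreover have "(snd e, e) \<in> half_edges G" "(fst e, e) \<in> half_edges G"
    using assms(2) by (auto simp: half_edges_def edges_at_def)
  ultimately show "z (snd e, e) \<in> carrier_vec (nb G)" "z (fst e, e) \<in> carrier_vec (nb G)"
    by (auto simp: PiE_iff)
qed

lemma lam_solution_tail:
  assumes "lam_solution G w \<epsilon> x z" "e \<in> edges G"
  shows "z (fst e, e) = ((-1) ^ \<epsilon> e * w e) \<cdot>\<^sub>v z (snd e, e)"
proof -
  have "\<forall>(U, V) \<in> edges G. z (U, (U, V)) = ((-1) ^ \<epsilon> (U, V) * w (U, V)) \<cdot>\<^sub>v z (V, (U, V))"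
    using assms(1) unfolding lam_solution_def lam_system_def by blast
  with assms(2) show ?thesis by (cases e) auto
qed

lemma black_out_single:
  assumes "V \<in> black G"
  obtains f where "f \<in> edges G" "fst f = V" "{f. f \<in> edges G \<and> fst f = V} = {f}"
proof -
  obtain f where "out_edges G V = {f}" using black_out[OF assms] by (auto simp: card_1_singleton_iff)
  then show thesis using that[of f] by (auto simp: out_edges_def)
qed

lemma white_in_single:
  assumes "V \<in> white G" "e \<in> edges G" "snd e = V"
  shows "in_edges G V = {e}"
proof -
  obtain f where "in_edges G V = {f}" using white_in[OF assms(1)] by (auto simp: card_1_singleton_iff)
  moreover have "e \<in> in_edges G V" using assms by (simp add: in_edges_def)
  ultimately show ?thesis by simp
qed

text \<open>Relation (i) eliminates the tails, and the relation at the head of \<open>e\<close>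
  becomes row \<open>e\<close>. At a sink there is no continuation, and the row returns the
  prescribed vector.\<close>

lemma lam_solution_tmat:
  assumes z: "lam_solution G w \<epsilon> x z" and c: "c < nb G" and e: "e \<in> edges G"
  shows "(\<Sum>f\<in>edges G. tmat w e f * z (snd f, f) $ c)
    = (if snd e \<in> internal G then 0 else z (snd e, e) $ c)"
proof -
  let ?out = "{f. f \<in> edges G \<and> fst f = snd e}"
  let ?S = "\<Sum>f\<in>?out. lam_sign G \<epsilon> f * w f * z (snd f, f) $ c"
  have tail: "z (fst f, f) $ c = (-1) ^ \<epsilon> f * w f * z (snd f, f) $ c" if "f \<in> edges G" for f
    using lam_solution_tail[OF z that] lam_solution_closed[OF z that] c by simp
  have eq: "(\<Sum>f\<in>edges G. tmat w e f * z (snd f, f) $ c) = z (snd e, e) $ c - ?S"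
    by (rule tmat_mult[OF e])
  consider (b) "snd e \<in> black G" | (w) "snd e \<in> white G" | (s) "snd e \<notin> internal G"
    by (auto simp: white_def)
  then show ?thesis
  proof cases
    case b
    then have int: "snd e \<in> internal G" using black_internal by blast
    obtain f where f: "f \<in> edges G" "fst f = snd e" "?out = {f}" using black_out_single[OF b] .
    have "\<forall>V \<in> black G. \<forall>e \<in> edges_at G V. \<forall>e' \<in> edges_at G V. z (V, e) = z (V, e')"
      using z unfolding lam_solution_def lam_system_def by blast
    moreover have "e \<in> edges_at G (snd e)" "f \<in> edges_at G (snd e)"
      using e f by (auto simp: edges_at_def)
    ultimately have "z (snd e, e) = z (fst f, f)" using b f(2) by metis
    moreover have "lam_sign G \<epsilon> f = (-1) ^ \<epsilon> f" using b f(2) by (simp add: lam_sign_def white_def)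
    ultimately show ?thesis unfolding eq f(3) using int tail[OF f(1)] by simp
  next
    case w
    then have int: "snd e \<in> internal G" by (simp add: white_def)
    have "finsum_vec TYPE(real) (nb G) (\<lambda>f. z (snd e, f)) (edges_at G (snd e)) = 0\<^sub>v (nb G)"
      using z w unfolding lam_solution_def lam_system_def by blast
    moreover have "finsum_vec TYPE(real) (nb G) (\<lambda>f. z (snd e, f)) (edges_at G (snd e)) $ c
       = (\<Sum>f\<in>edges_at G (snd e). z (snd e, f) $ c)"
    proof (rule index_finsum_vec[OF _ c])
      show "(\<lambda>f. z (snd e, f)) \<in> edges_at G (snd e) \<rightarrow> carrier_vec (nb G)"
      proof
        fix f assume "f \<in> edges_at G (snd e)"
        then have "f \<in> edges G" "fst f = snd e \<or> snd f = snd e" by (auto simp: edges_at_def)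
        then show "z (snd e, f) \<in> carrier_vec (nb G)" using lam_solution_closed[OF z, of f] by metis
      qed
    qed simp
    ultimately have sum0: "(\<Sum>f\<in>edges_at G (snd e). z (snd e, f) $ c) = 0" using c by simp
    have "edges_at G (snd e) = {e} \<union> ?out" "{e} \<inter> ?out = {}"
      using white_in_single[OF w e refl] edges_at_eq[of "snd e"] in_out_disjoint[of "snd e"]
      by (auto simp: out_edges_def)
    then have "z (snd e, e) $ c + (\<Sum>f\<in>?out. z (snd e, f) $ c) = 0"
      using sum0 by (simp add: sum.union_disjoint)
    moreover have "(\<Sum>f\<in>?out. z (snd e, f) $ c) = - ?S"
      unfolding sum_negf[symmetric]
    proof (rule sum.cong[OF refl])
      fix f assume f: "f \<in> ?out"
      then have "lam_sign G \<epsilon> f = - ((-1) ^ \<epsilon> f)" using w by (simp add: lam_sign_def)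
      then show "z (snd e, f) $ c = - (lam_sign G \<epsilon> f * w f * z (snd f, f) $ c)"
        using tail[of f] f by simp
    qed
    ultimately show ?thesis unfolding eq using int by simp
  next
    case s
    then obtain j where "j < nb G" "snd e = bv G j" using vertex_cases[OF e, of "snd e"] by metis
    then have "?out = {}" using sink_edge(4)[OF sink_head[OF e]] by auto
    then show ?thesis unfolding eq using s by (simp only: sum.empty) simp
  qed
qed

lemma sink_cases:
  assumes "e \<in> edges G" "snd e \<notin> internal G"
  obtains j where "j \<in> sinks G" "snd e = bv G j" "e = boundary_edge G j"
  using vertex_cases[OF assms(1), of "snd e"] assms sink_head boundary_edge_eqI by metis

lemma lam_solution_unique:
  assumes g: "gdet w \<noteq> 0" and z: "lam_solution G w \<epsilon> x z" and z': "lam_solution G w \<epsilon> x z'"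
  shows "z = z'"
proof -
  have head: "z (snd e, e) = z' (snd e, e)" if e: "e \<in> edges G" for e
  proof (rule eq_vecI)
    have cz: "z (snd e, e) \<in> carrier_vec (nb G)" "z' (snd e, e) \<in> carrier_vec (nb G)"
      using lam_solution_closed[OF z e] lam_solution_closed[OF z' e] by auto
    show "dim_vec (z (snd e, e)) = dim_vec (z' (snd e, e))" using cz by simp
    fix c assume "c < dim_vec (z' (snd e, e))"
    then have c: "c < nb G" using cz by simp
    show "z (snd e, e) $ c = z' (snd e, e) $ c"
    proof (rule tmat_unique[OF g lam_solution_tmat[OF z c] _ e])
      fix f assume f: "f \<in> edges G"
      have "z (snd f, f) = z' (snd f, f)" if ext: "snd f \<notin> internal G"
      proof -
        obtain j where j: "j \<in> sinks G" "snd f = bv G j" "f = boundary_edge G j" using sink_cases[OF f ext] .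
        have "z (bv G j, boundary_edge G j) = x j" "z' (bv G j, boundary_edge G j) = x j"
          using z z' j(1) by (simp_all add: lam_solution_def)
        then show ?thesis using j by simp
      qed
      then show "(\<Sum>e\<in>edges G. tmat w f e * z' (snd e, e) $ c)
         = (if snd f \<in> internal G then 0 else z (snd f, f) $ c)"
        using lam_solution_tmat[OF z' c f] by simp
    qed
  qed
  have "z u = z' u" for u
  proof (cases "u \<in> half_edges G")
    case True
    then obtain e where e: "e \<in> edges G" "u = (fst e, e) \<or> u = (snd e, e)"
      by (cases u) (auto simp: half_edges_def edges_at_def)
    have "z (fst e, e) = z' (fst e, e)"
      unfolding lam_solution_tail[OF z e(1)] lam_solution_tail[OF z' e(1)] head[OF e(1)] ..
    then show ?thesis using head[OF e(1)] e(2) by metis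
  next
    case False
    have "z \<in> half_edges G \<rightarrow>\<^sub>E carrier_vec (nb G)" "z' \<in> half_edges G \<rightarrow>\<^sub>E carrier_vec (nb G)"
      using z z' unfolding lam_solution_def lam_system_def by blast+
    then have "z \<in> extensional (half_edges G)" "z' \<in> extensional (half_edges G)"
      by (simp_all add: PiE_iff)
    from this[THEN extensional_arb, OF False] show ?thesis by (rule trans[OF _ sym])
  qed
  then show ?thesis by (rule ext)
qed

lemma lam_solution_exists:
  assumes g: "gdet w \<noteq> 0" and x: "x \<in> sinks G \<rightarrow> carrier_vec (nb G)"
  obtains z where "lam_solution G w \<epsilon> x z"
proof -
  \<comment> \<open>The description recovers the sink from its edge; \<open>inj_bv\<close> makes it
    unique.\<close>
  define b where "b c e = (if snd e \<in> internal G then 0 else x (THE j. j \<in> sinks G \<and> e = boundary_edge G j) $ c)" for c :: nat and e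
  have b: "b c (boundary_edge G j) = x j $ c" if j: "j \<in> sinks G" for j c
  proof -
    have "(THE k. k \<in> sinks G \<and> boundary_edge G j = boundary_edge G k) = j"
    proof (rule the_equality)
      fix k assume "k \<in> sinks G \<and> boundary_edge G j = boundary_edge G k"
      then show "k = j" using sink_edge[OF j] sink_edge[of k] inj_bv by metis
    qed (use j in simp)
    moreover have "snd (boundary_edge G j) \<notin> internal G" using sink_edge[OF j] bv_not_internal by simp
    ultimately show ?thesis by (simp add: b_def)
  qed
  have "\<forall>c. \<exists>y. \<forall>e\<in>edges G. (\<Sum>f\<in>edges G. tmat w e f * y f) = b c e"
    using gdet_solvable[OF g] by metis
  then obtain y where y: "\<And>c e. e \<in> edges G \<Longrightarrow> (\<Sum>f\<in>edges G. tmat w e f * y c f) = b c e" by metis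
  have rec: "y c e = b c e + (\<Sum>f | f \<in> edges G \<and> fst f = snd e. lam_sign G \<epsilon> f * w f * y c f)"
    if "e \<in> edges G" for c e using y[OF that, of c] tmat_mult[OF that, of w "y c"] by simp
  let ?n = "nb G"
  \<comment> \<open>Head half-edges carry the solution, tail half-edges are defined by relation (i),
    and the restriction to half-edges provides extensionality.\<close>
  define z where "z = (\<lambda>u \<in> half_edges G. if fst u = snd (snd u) then vec ?n (\<lambda>c. y c (snd u))
     else vec ?n (\<lambda>c. (-1) ^ \<epsilon> (snd u) * w (snd u) * y c (snd u)))"
  have zh: "z (snd e, e) = vec ?n (\<lambda>c. y c e)" if "e \<in> edges G" for e
    using that by (simp add: z_def half_edges_def edges_at_def)
  have zt: "z (fst e, e) = vec ?n (\<lambda>c. (-1) ^ \<epsilon> e * w e * y c e)" if "e \<in> edges G" for e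
    using that edge_internal[OF that] by (simp add: z_def half_edges_def edges_at_def)
  have zc: "z (V, f) \<in> carrier_vec ?n" if "f \<in> edges_at G V" for f V
    using that by (auto simp: z_def half_edges_def)
  have black: "z (V, e) = z (V, f)" if V: "V \<in> black G" and f: "f \<in> edges G" "fst f = V"
      "{f. f \<in> edges G \<and> fst f = V} = {f}" and e: "e \<in> edges_at G V" for V e f
  proof (cases "fst e = V")
    case True then show ?thesis using f(3) e by (auto simp: edges_at_def)
  next
    case False
    with e have e: "e \<in> edges G" "snd e = V" by (auto simp: edges_at_def)
    have "V \<in> internal G" "V \<notin> white G" using V black_internal by (auto simp: white_def)
    then have "y c e = (-1) ^ \<epsilon> f * w f * y c f" for c
      using rec[OF e(1), of c] e(2) f(2,3) by (simp add: b_def lam_sign_def)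
    then show ?thesis using zh[OF e(1)] zt[OF f(1)] e f by simp
  qed
  have "lam_system G w \<epsilon> z"
    unfolding lam_system_def
  proof (intro conjI)
    show "z \<in> half_edges G \<rightarrow>\<^sub>E carrier_vec ?n" by (auto simp: z_def)
    show "\<forall>(U, V)\<in>edges G. z (U, U, V) = ((- 1) ^ \<epsilon> (U, V) * w (U, V)) \<cdot>\<^sub>v z (V, U, V)"
    proof clarify
      fix U V assume e: "(U, V) \<in> edges G"
      show "z (U, U, V) = ((- 1) ^ \<epsilon> (U, V) * w (U, V)) \<cdot>\<^sub>v z (V, U, V)"
        using zh[OF e] zt[OF e] by (intro eq_vecI) auto
    qed
    show "\<forall>V\<in>black G. \<forall>e\<in>edges_at G V. \<forall>e'\<in>edges_at G V. z (V, e) = z (V, e')"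
    proof (intro ballI)
      fix V e e' assume V: "V \<in> black G" and e: "e \<in> edges_at G V" "e' \<in> edges_at G V"
      obtain f where f: "f \<in> edges G" "fst f = V" "{f. f \<in> edges G \<and> fst f = V} = {f}"
        using black_out_single[OF V] .
      show "z (V, e) = z (V, e')" using black[OF V f e(1)] black[OF V f e(2)] by simp
    qed
    show "\<forall>V\<in>white G. finsum_vec TYPE(real) ?n (\<lambda>e. z (V, e)) (edges_at G V) = 0\<^sub>v ?n"
    proof
      fix V assume V: "V \<in> white G"
      obtain e where e: "in_edges G V = {e}" using white_in[OF V] by (auto simp: card_1_singleton_iff)
      then have e': "e \<in> edges G" "snd e = V" by (auto simp: in_edges_def)
      let ?out = "{f. f \<in> edges G \<and> fst f = V}"
      have split: "edges_at G V = {e} \<union> ?out" "{e} \<inter> ?out = {}"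
        using e edges_at_eq[of V] in_out_disjoint[of V] by (auto simp: out_edges_def)
      have cl: "(\<lambda>e. z (V, e)) \<in> edges_at G V \<rightarrow> carrier_vec ?n" using zc by blast
      show "finsum_vec TYPE(real) ?n (\<lambda>e. z (V, e)) (edges_at G V) = 0\<^sub>v ?n"
      proof (rule eq_vecI)
        have "finsum_vec TYPE(real) ?n (\<lambda>e. z (V, e)) (edges_at G V) \<in> carrier_vec ?n"
          by (rule finsum_vec_closed[OF cl])
        then show "dim_vec (finsum_vec TYPE(real) ?n (\<lambda>e. z (V, e)) (edges_at G V)) = dim_vec (0\<^sub>v ?n :: real vec)"
          by simp
        fix c assume "c < dim_vec (0\<^sub>v ?n :: real vec)"
        then have c: "c < ?n" by simp
        have "finsum_vec TYPE(real) ?n (\<lambda>e. z (V, e)) (edges_at G V) $ c = (\<Sum>f\<in>edges_at G V. z (V, f) $ c)"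
          by (rule index_finsum_vec[OF _ c cl]) simp
        also have "\<dots> = z (V, e) $ c + (\<Sum>f\<in>?out. z (V, f) $ c)"
          unfolding split(1) using split(2) by (simp add: sum.union_disjoint)
        also have "z (V, e) $ c = y c e" using zh[OF e'(1)] e' c by simp
        also have "y c e = (\<Sum>f\<in>?out. lam_sign G \<epsilon> f * w f * y c f)"
          using rec[OF e'(1), of c] e'(2) V by (simp add: b_def white_def)
        also have "(\<Sum>f\<in>?out. z (V, f) $ c) = (\<Sum>f\<in>?out. - (lam_sign G \<epsilon> f * w f * y c f))"
          using zt c V by (intro sum.cong) (auto simp: lam_sign_def)
        finally show "finsum_vec TYPE(real) ?n (\<lambda>e. z (V, e)) (edges_at G V) $ c = 0\<^sub>v ?n $ c"
          using c by (simp add: sum_negf)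
      qed
    qed
  qed
  moreover have "z (bv G j, boundary_edge G j) = x j" if j: "j \<in> sinks G" for j
  proof -
    have e: "boundary_edge G j \<in> edges G" "snd (boundary_edge G j) = bv G j" using sink_edge[OF j] by auto
    have "{f. f \<in> edges G \<and> fst f = snd (boundary_edge G j)} = {}"
      using sink_edge[OF j] by auto
    then have "y c (boundary_edge G j) = x j $ c" for c
      using rec[OF e(1), of c] b[OF j] by (simp only: sum.empty add_0_right)
    moreover have "x j \<in> carrier_vec ?n" using x j by blast
    ultimately show ?thesis using zh[OF e(1)] e(2) by (intro eq_vecI) auto
  qed
  ultimately show thesis using that unfolding lam_solution_def by blast
qed

lemma gdet_lam_uniquely_solvable:
  assumes "gdet w \<noteq> 0" shows "lam_uniquely_solvable G w \<epsilon>"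
  unfolding lam_uniquely_solvable_def
  using lam_solution_exists[OF assms] lam_solution_unique[OF assms] by metis

theorem AE_lam_uniquely_solvable: "AE w in weight_measure G. lam_uniquely_solvable G w \<epsilon>"
proof -
  have "AE w in PiM (edges G) (\<lambda>_. lborel). gdet w \<noteq> 0"
    by (rule polyfun_AE_nonzero[OF finite_edges polyfun_gdet, of "\<lambda>_. 0"]) (simp add: gdet_zero)
  then show ?thesis
    unfolding weight_measure_def by eventually_elim (rule gdet_lam_uniquely_solvable)
qed

text \<open>Coordinate \<open>c\<close> solves the scalar system whose right-hand side is the
  indicator of the edge at the sink \<open>c\<close>, or 0 when \<open>c\<close> is a source. The
  factor with \<open>w\<close> leads from the head of the source edge to its tail.\<close>

lemma lam_solution_value:
  assumes g: "gdet w \<noteq> 0" and z: "lam_solution G w \<epsilon> (unit_vec (nb G)) z"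
    and i: "i \<in> sources G" and c: "c < nb G"
  shows "z (bv G i, boundary_edge G i) $ c = (if c \<in> sinks G then
     lam_sign G \<epsilon> (boundary_edge G i) * w (boundary_edge G i) * cof (boundary_edge G i) (boundary_edge G c) w / gdet w else 0)"
proof -
  let ?e = "boundary_edge G i"
  have e: "?e \<in> edges G" "fst ?e = bv G i" using source_edge[OF i] by auto
  have "bv G i \<notin> white G" using bv_not_internal source_edge(1)[OF i] by (simp add: white_def)
  then have s: "lam_sign G \<epsilon> ?e = (-1) ^ \<epsilon> ?e" using e by (simp add: lam_sign_def)
  have zi: "z (bv G i, ?e) $ c = lam_sign G \<epsilon> ?e * w ?e * z (snd ?e, ?e) $ c"
    using lam_solution_tail[OF z e(1)] lam_solution_closed[OF z e(1)] c e(2) s by simp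
  have bd: "z (bv G j, boundary_edge G j) $ c = (if j = c then 1 else 0)" if "j \<in> sinks G" for j
    using z that c sink_edge(1)[OF that] by (simp add: lam_solution_def)
  show ?thesis
  proof (cases "c \<in> sinks G")
    case True
    have "cof ?e (boundary_edge G c) w = gdet w * z (snd ?e, ?e) $ c"
    proof (rule cof_eq[OF _ e(1)])
      fix f assume f: "f \<in> edges G"
      have "(if snd f \<in> internal G then 0 else z (snd f, f) $ c) = (if f = boundary_edge G c then 1 else 0)"
      proof (cases "snd f \<in> internal G")
        case int: True
        then have "f \<noteq> boundary_edge G c" using sink_edge[OF True] bv_not_internal by auto
        with int show ?thesis by simp
      next
        case False
        obtain j where j: "j \<in> sinks G" "snd f = bv G j" "f = boundary_edge G j" using sink_cases[OF f False] .
        have "f = boundary_edge G c \<longleftrightarrow> j = c"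
          using j sink_edge[OF True] sink_edge[OF j(1)] inj_bv by metis
        then show ?thesis using False bd[OF j(1)] j by simp
      qed
      then show "(\<Sum>e\<in>edges G. tmat w f e * z (snd e, e) $ c) = (if f = boundary_edge G c then 1 else 0)"
        using lam_solution_tmat[OF z c f] by simp
    qed
    then show ?thesis using True zi g by simp
  next
    case False
    have "z (snd ?e, ?e) $ c = (\<lambda>_. 0) ?e"
    proof (rule tmat_unique[OF g lam_solution_tmat[OF z c] _ e(1)])
      fix f assume f: "f \<in> edges G"
      have "z (snd f, f) $ c = 0" if ext: "snd f \<notin> internal G"
      proof -
        obtain j where j: "j \<in> sinks G" "snd f = bv G j" "f = boundary_edge G j" using sink_cases[OF f ext] .
        then show ?thesis using bd[OF j(1)] False by auto
      qed
      then show "(\<Sum>e\<in>edges G. tmat w f e * 0) = (if snd f \<in> internal G then 0 else z (snd f, f) $ c)" by simp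
    qed
    then show ?thesis using False zi by simp
  qed
qed

end

section \<open>Exchange minors\<close>

lemma card_less_pick:
  assumes "finite K" "a < card K"
  shows "pick K a \<in> K" "card {b \<in> K. b < pick K a} = a"
  using assms pick_in_set_le card_pick by auto

text \<open>Insertion shifts the positions after \<open>x\<close> by one, the same shift that
  \<open>mat_delete\<close> applies to indices.\<close>

lemma pick_insert:
  assumes K: "finite K" "x \<notin> K" "a < card K"
  shows "pick (insert x K) (if a < card {b \<in> K. b < x} then a else Suc a) = pick K a"
proof -
  let ?c = "pick K a"
  have c: "?c \<in> K" "card {b \<in> K. b < ?c} = a" using card_less_pick[OF K(1,3)] .
  have fin: "finite {b \<in> K. b < y}" for y using K(1) by simp
  have "card {b \<in> insert x K. b < ?c} = (if a < card {b \<in> K. b < x} then a else Suc a)"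
  proof (cases "x < ?c")
    case True
    have "card {b \<in> K. b < x} \<le> card {b \<in> K. b < ?c}" by (rule card_mono[OF fin]) (use True in auto)
    moreover have "{b \<in> insert x K. b < ?c} = insert x {b \<in> K. b < ?c}" using True by auto
    ultimately show ?thesis using c fin K(2) by simp
  next
    case False
    have "card (insert ?c {b \<in> K. b < ?c}) \<le> card {b \<in> K. b < x}"
      by (rule card_mono[OF fin]) (use False c K(2) in \<open>auto simp: not_less le_less\<close>)
    then have "a < card {b \<in> K. b < x}" using c fin by simp
    moreover have "{b \<in> insert x K. b < ?c} = {b \<in> K. b < ?c}" using False by auto
    ultimately show ?thesis using c by simp
  qed
  then show ?thesis using pick_card_in_set[of ?c "insert x K"] c(1) by simp
qed

lemma sorted_list_nth_pick:
  assumes "finite (K :: nat set)" "r < card K"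
  shows "sorted_list_of_set K ! r = pick K r"
proof -
  let ?xs = "sorted_list_of_set K"
  have len: "r < length ?xs" using assms by simp
  have mono: "?xs ! a < ?xs ! b \<longleftrightarrow> a < b" if "a < length ?xs" "b < length ?xs" for a b
    using that strict_sorted_list_of_set[of K] sorted_wrt_nth_less[of "(<)" ?xs] by (metis linorder_neqE_nat not_less_iff_gr_or_eq)
  have "{b \<in> K. b < ?xs ! r} = (\<lambda>a. ?xs ! a) ` {..<r}"
  proof (intro equalityI subsetI)
    fix b assume "b \<in> {b \<in> K. b < ?xs ! r}"
    then obtain a where "a < length ?xs" "b = ?xs ! a" "?xs ! a < ?xs ! r"
      using assms(1) by (metis (no_types, lifting) in_set_conv_nth mem_Collect_eq set_sorted_list_of_set)
    then show "b \<in> (\<lambda>a. ?xs ! a) ` {..<r}" using mono len by auto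
  next
    fix b assume "b \<in> (\<lambda>a. ?xs ! a) ` {..<r}"
    then obtain a where a: "a < r" "b = ?xs ! a" by auto
    then have "b \<in> set ?xs" using len by auto
    with a show "b \<in> {b \<in> K. b < ?xs ! r}" using mono[of a r] len assms(1) by auto
  qed
  moreover have "inj_on (\<lambda>a. ?xs ! a) {..<r}"
    using len by (intro inj_onI) (simp add: nth_eq_iff_index_eq)
  ultimately have "card {b \<in> K. b < ?xs ! r} = r" by (simp add: card_image)
  moreover have "?xs ! r \<in> K" using nth_mem[OF len] assms(1) by simp
  ultimately show ?thesis using pick_card_in_set[of "?xs ! r" K] by simp
qed

lemma card_between:
  fixes K :: "nat set"
  assumes "finite K" "i \<notin> K" "j \<notin> K"
  shows "(-1::real) ^ (card {a \<in> K. a < i} + card {a \<in> K. a < j}) = (-1) ^ card {a \<in> K. min i j < a \<and> a < max i j}"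
proof -
  have *: "(-1::real) ^ (card {a \<in> K. a < i} + card {a \<in> K. a < j}) = (-1) ^ card {a \<in> K. i < a \<and> a < j}"
    if "i \<le> j" "i \<notin> K" for i j
  proof -
    have "{a \<in> K. a < j} = {a \<in> K. a < i} \<union> {a \<in> K. i < a \<and> a < j}"
      using that by (auto simp: not_less le_less)
    then have "card {a \<in> K. a < j} = card {a \<in> K. a < i} + card {a \<in> K. i < a \<and> a < j}"
      using assms(1) by (simp add: card_Un_disjoint disjoint_iff)
    then show ?thesis by (simp add: power_add flip: power_mult_distrib)
  qed
  show ?thesis
  proof (cases "i \<le> j")
    case True then show ?thesis using * assms by (simp add: min_def max_def)
  next
    case False then show ?thesis using *[of j i] assms by (simp add: min_def max_def add.commute)
  qed
qed

text \<open>After the exchange the row of \<open>i\<close> has its only possibly nonzero entry in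
  column \<open>j\<close>; deleting both leaves an identity matrix. Every entry outside the unit
  columns is thus a maximal minor up to sign.\<close>

lemma exchange_minor:
  fixes A :: "real mat"
  assumes I: "finite I" and A: "A \<in> carrier_mat (card I) n" and In: "I \<subseteq> {..<n}"
    and unit: "\<And>r c. r < card I \<Longrightarrow> c \<in> I \<Longrightarrow> A $$ (r, c) = (if c = pick I r then 1 else 0)"
    and i: "i \<in> I" and j: "j < n" "j \<notin> I"
  shows "det (submatrix A UNIV (insert j (I - {i})))
    = (-1) ^ card {s \<in> I. min i j < s \<and> s < max i j} * A $$ (card {a \<in> I. a < i}, j)"
proof -
  define K where "K = I - {i}"
  have K: "finite K" "i \<notin> K" "j \<notin> K" "I = insert i K" using I i j by (auto simp: K_def)
  let ?J = "insert j K" and ?k = "card I" and ?r = "card {a \<in> K. a < i}" and ?q = "card {a \<in> K. a < j}"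
  let ?B = "submatrix A UNIV ?J"
  have k: "?k = Suc (card K)" using K by simp
  have cardJ: "card {c. c < dim_col A \<and> c \<in> ?J} = ?k"
  proof -
    have "{c. c < dim_col A \<and> c \<in> ?J} = ?J" using A In j by (auto simp: K_def)
    then show ?thesis using K by simp
  qed
  have cardR: "card {r. r < dim_row A \<and> r \<in> UNIV} = ?k" using A by simp
  have B: "?B \<in> carrier_mat ?k ?k" using cardJ cardR unfolding submatrix_def by auto
  have Bij: "?B $$ (a, b) = A $$ (a, pick ?J b)" if "a < ?k" "b < ?k" for a b
    using submatrix_index[of a A UNIV b ?J] that cardJ cardR by (simp add: pick_UNIV)
  have rI: "card {a \<in> I. a < i} = ?r"
  proof -
    have "{a \<in> I. a < i} = {a \<in> K. a < i}" by (auto simp: K_def)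
    then show ?thesis by simp
  qed
  have qJ: "card {a \<in> ?J. a < j} = ?q"
  proof -
    have "{a \<in> ?J. a < j} = {a \<in> K. a < j}" by auto
    then show ?thesis by simp
  qed
  have le: "?r \<le> card K" "?q \<le> card K" using K(1) by (auto intro: card_mono)
  then have r: "?r < ?k" and q: "?q < ?k" using k by auto
  have pick_r: "pick I ?r = i" using pick_card_in_set[OF i] rI by simp
  have pick_q: "pick ?J ?q = j" using pick_card_in_set[of j ?J] qJ by simp
  have cJ: "card ?J = ?k" using K by simp
  have pickJ: "pick ?J b \<in> ?J" "pick ?J b = j \<longleftrightarrow> b = ?q" if "b < ?k" for b
    using card_less_pick[of ?J b] K(1) that cJ qJ pick_q by auto
  have "det ?B = (\<Sum>b<?k. ?B $$ (?r, b) * cofactor ?B ?r b)"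
    by (rule laplace_expansion_row[OF B r])
  also have "\<dots> = (\<Sum>b\<in>{?q}. ?B $$ (?r, b) * cofactor ?B ?r b)"
  proof (rule sum.mono_neutral_right)
    show "\<forall>b\<in>{..<?k} - {?q}. ?B $$ (?r, b) * cofactor ?B ?r b = 0"
    proof
      fix b assume b: "b \<in> {..<?k} - {?q}"
      then have "pick ?J b \<in> K" using pickJ[of b] by auto
      then have "pick ?J b \<in> I" "pick ?J b \<noteq> i" using K by auto
      then show "?B $$ (?r, b) * cofactor ?B ?r b = 0" using Bij[OF r] b unit[OF r] pick_r by simp
    qed
  qed (use q in auto)
  also have "\<dots> = A $$ (?r, j) * cofactor ?B ?r ?q" using Bij[OF r q] pick_q by simp
  also have "cofactor ?B ?r ?q = (-1) ^ (?r + ?q)"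
  proof -
    have "mat_delete ?B ?r ?q = 1\<^sub>m (card K)"
    proof (rule eq_matI)
      fix a b assume "a < dim_row (1\<^sub>m (card K) :: real mat)" "b < dim_col (1\<^sub>m (card K) :: real mat)"
      then have ab: "a < card K" "b < card K" by auto
      let ?a = "if a < ?r then a else Suc a" and ?b = "if b < ?q then b else Suc b"
      have lt: "?a < ?k" "?b < ?k" using ab k by auto
      have "mat_delete ?B ?r ?q $$ (a, b) = ?B $$ (?a, ?b)"
        using ab k B by (simp add: mat_delete_def)
      also have "\<dots> = A $$ (?a, pick ?J ?b)" by (rule Bij[OF lt])
      also have "pick ?J ?b = pick K b" by (rule pick_insert[OF K(1,3) ab(2)])
      also have "A $$ (?a, pick K b) = (if pick K b = pick I ?a then 1 else 0)"
        using card_less_pick(1)[OF K(1) ab(2)] K(4) by (intro unit[OF lt(1)]) simp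
      also have "pick I ?a = pick K a" unfolding K(4) by (rule pick_insert[OF K(1,2) ab(1)])
      also have "pick K b = pick K a \<longleftrightarrow> a = b"
        using card_less_pick(2)[OF K(1) ab(1)] card_less_pick(2)[OF K(1) ab(2)] by metis
      finally show "mat_delete ?B ?r ?q $$ (a, b) = 1\<^sub>m (card K) $$ (a, b)" using ab by simp
    qed (use B k in auto)
    then show ?thesis by (simp add: cofactor_def)
  qed
  also have "(-1::real) ^ (?r + ?q) = (-1) ^ card {s \<in> I. min i j < s \<and> s < max i j}"
  proof -
    have "{s \<in> I. min i j < s \<and> s < max i j} = {s \<in> K. min i j < s \<and> s < max i j}"
      unfolding K(4) by auto
    then show ?thesis using card_between[OF K(1-3)] by simp
  qed
  finally show ?thesis unfolding K_def[symmetric] rI by (simp add: mult.commute)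
qed

section \<open>The geometric signature along paths\<close>

text \<open>A cyclic list of corners becomes a periodic sequence by reading indices
  \<open>mod n\<close>. The closing turn is split off because the turns of a path form an open
  sequence.\<close>

lemma polygon_turning:
  fixes vs :: "complex list"
  defines "n \<equiv> length vs"
  defines "nx \<equiv> \<lambda>k. vs ! (Suc k mod n)"
  assumes n3: "3 \<le> n"
    and nd: "\<And>k. k < n \<Longrightarrow> vs ! k \<noteq> nx k"
    and simple: "\<And>i j x. i < j \<Longrightarrow> j < n \<Longrightarrow> x \<in> closed_segment (vs ! i) (nx i) \<Longrightarrow>
      x \<in> closed_segment (vs ! j) (nx j) \<Longrightarrow> j = Suc i \<and> x = vs ! j \<or> i = 0 \<and> j = n - 1 \<and> x = vs ! 0"
    and l: "\<And>k. k < n \<Longrightarrow> cdet l (nx k - vs ! k) \<noteq> 0"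
  shows "(\<Prod>k<n - 1. swsign l (nx k - vs ! k) (nx (Suc k) - vs ! Suc k))
     * swsign l (nx (n - 1) - vs ! (n - 1)) (nx 0 - vs ! 0) = -1"
proof -
  define p where "p k = vs ! (k mod n)" for k
  have n0: "0 < n" using n3 by simp
  have pS: "p (Suc k) = nx (k mod n)" for k by (simp add: p_def nx_def mod_Suc_eq)
  have pk: "p k = vs ! (k mod n)" for k by (simp add: p_def)
  interpret simple_polygon p n
  proof
    show "3 \<le> n" by (rule n3)
    show "p (i + n) = p i" for i by (simp add: p_def)
    show "p i \<noteq> p (Suc i)" for i using nd[of "i mod n"] n0 unfolding pS unfolding pk by simp
    fix d i x
    assume d: "1 \<le> d" "d < n" and x: "x \<in> closed_segment (p i) (p (Suc i))"
      "x \<in> closed_segment (p (i + d)) (p (Suc (i + d)))"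
    define a where "a = i mod n"
    define b where "b = (i + d) mod n"
    have a: "a < n" and b: "b < n" using n0 by (auto simp: a_def b_def)
    have bd: "b = (if a + d < n then a + d else a + d - n)"
    proof -
      have "b = (a + d) mod n" by (simp add: a_def b_def mod_add_left_eq)
      also have "\<dots> = (if a + d < n then a + d else a + d - n)"
        using a d(2) by (auto simp: mod_if)
      finally show ?thesis .
    qed
    have xa: "x \<in> closed_segment (vs ! a) (nx a)" "x \<in> closed_segment (vs ! b) (nx b)"
      using x unfolding pS unfolding pk a_def b_def .
    have goal: "p (Suc i) = nx a" "p i = vs ! a" unfolding pS unfolding pk a_def by auto
    show "d = 1 \<and> x = p (Suc i) \<or> d = n - 1 \<and> x = p i"
    proof (cases "a < b")
      case True
      then have db: "b = a + d" using bd d a by (auto split: if_splits)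
      from simple[OF True b xa] show ?thesis unfolding goal using db b by (auto simp: nx_def)
    next
      case False
      then have db: "b = a + d - n" "n \<le> a + d" using bd d by (auto split: if_splits)
      then have "b < a" using d a by auto
      from simple[OF this a xa(2,1)] consider "a = Suc b" "x = vs ! a" | "b = 0" "a = n - 1" "x = vs ! 0"
        by blast
      then show ?thesis
      proof cases
        case 1
        then have "d = n - 1" using db d by simp
        then show ?thesis unfolding goal using 1 by simp
      next
        case 2
        then have "d = 1" "Suc a = n" using db d by auto
        then show ?thesis unfolding goal using 2 by (simp add: nx_def)
      qed
    qed
  qed
  have ll: "cdet l (p (Suc i) - p i) \<noteq> 0" for i using l[of "i mod n"] n0 unfolding pS unfolding pk by simp
  have e: "p (Suc k) - p k = nx k - vs ! k" if "k < n" for k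
    using that unfolding pS unfolding pk by simp
  have n: "n = Suc (n - 1)" using n0 by simp
  have "(\<Prod>i<n. swsign l (p (Suc i) - p i) (p (Suc (Suc i)) - p (Suc i)))
     = (\<Prod>i<n - 1. swsign l (p (Suc i) - p i) (p (Suc (Suc i)) - p (Suc i)))
       * swsign l (p (Suc (n - 1)) - p (n - 1)) (p (Suc (Suc (n - 1))) - p (Suc (n - 1)))"
    by (subst n, subst prod.lessThan_Suc) simp
  also have "(\<Prod>i<n - 1. swsign l (p (Suc i) - p i) (p (Suc (Suc i)) - p (Suc i)))
     = (\<Prod>k<n - 1. swsign l (nx k - vs ! k) (nx (Suc k) - vs ! Suc k))"
    by (intro prod.cong refl arg_cong2[where f = "swsign l"] e) auto
  also have "p (Suc (n - 1)) - p (n - 1) = nx (n - 1) - vs ! (n - 1)" using e[of "n - 1"] n0 by simp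
  also have "p (Suc (Suc (n - 1))) - p (Suc (n - 1)) = nx 0 - vs ! 0"
    using periodic[of 0] periodic[of "Suc 0"] e[of 0] n0 n[symmetric] by simp
  finally show ?thesis using turning_sign[OF ll] by simp
qed

lemma cdet_zero_scale:
  assumes "l \<noteq> 0" "cdet l v = 0"
  obtains t where "v = of_real t * l"
proof
  have "(Re l)\<^sup>2 + (Im l)\<^sup>2 \<noteq> 0" using assms(1) by (auto simp: complex_eq_iff sum_power2_eq_zero_iff)
  then show "v = of_real ((Re l * Re v + Im l * Im v) / ((Re l)\<^sup>2 + (Im l)\<^sup>2)) * l"
    using assms(2) by (auto simp: complex_eq_iff cdet_def field_simps power2_eq_square)
qed

lemma cdet_ii [simp]: "cdet a (\<i> * b) = inner a b" "cdet (\<i> * a) b = - inner a b"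
  by (simp_all add: cdet_def inner_complex_def)

definition psign :: "int \<Rightarrow> real" where
  "psign k = (if odd k then -1 else 1)"

lemma psign_add [simp]: "psign (a + b) = psign a * psign b"
  by (auto simp: psign_def)

lemma psign_simps [simp]: "psign 1 = -1" "psign 0 = 1" "psign k * psign k = 1"
  by (auto simp: psign_def)

lemma psign_nat_mod2: "(-1) ^ nat (k mod 2) = psign k"
  by (cases "odd k") (auto simp: psign_def odd_iff_mod_2_eq_one even_iff_mod_2_eq_zero)

lemma psign_powi: "(-1) powi k = psign k"
  by (cases "even k") (simp_all add: psign_def power_int_minus_left_even power_int_minus_left_odd)

lemma psign_wind: "psign (wind l e f) = swsign l (evec e) (evec f)"
  by (simp add: psign_def swsign_def odd_wind)

lemma norm_add_scale_sq:
  fixes v l :: "'a::real_inner"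
  shows "(norm (v + t *\<^sub>R l))\<^sup>2 = (norm v)\<^sup>2 + (2 * t * inner l v + t\<^sup>2 * (norm l)\<^sup>2)"
  unfolding power2_norm_eq_inner
  by (simp add: inner_add_left inner_add_right inner_commute power2_eq_square)

definition (in plabic_net) between :: "nat \<Rightarrow> nat \<Rightarrow> nat set" where
  "between i j = {s \<in> sources G. min i j < s \<and> s < max i j}"

lemma (in plabic_net) finite_sources [simp]: "finite (sources G)"
  by (rule finite_subset[of _ "{..<nb G}"]) (auto simp: sources_def)

section \<open>Position of vertices and edges relative to the gauge rays\<close>

locale gauge_net = plabic_net +
  fixes l :: complex
  assumes gauge: "gauge_direction G l"
begin

text \<open>A point of the ray is nearer to the centre than its origin, so the linear term in the
  expansion of the squared norm is negative.\<close>

lemma inward: "j < nb G \<Longrightarrow> inner l (bv G j - centre G) < 0"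
proof -
  assume j: "j < nb G"
  have "ray (bv G j) l \<inter> ball (centre G) (radius G) \<noteq> {}" using gauge j by (simp add: gauge_direction_def)
  then obtain t where t: "0 \<le> t" "dist (centre G) (bv G j + of_real t * l) < radius G"
    by (auto simp: ray_def)
  define v where "v = bv G j - centre G"
  have nv: "norm v = radius G" using bv_dist[OF j] by (simp add: v_def dist_norm norm_minus_commute)
  have "norm (v + t *\<^sub>R l) < norm v"
    using t(2) nv by (simp add: dist_norm norm_minus_commute v_def scaleR_conv_of_real algebra_simps)
  then have "(norm (v + t *\<^sub>R l))\<^sup>2 < (norm v)\<^sup>2" by (simp add: power_strict_mono)
  then have "2 * t * inner l v + t\<^sup>2 * (norm l)\<^sup>2 < 0"
    using norm_add_scale_sq[of v t l] by linarith
  moreover have "0 \<le> t\<^sup>2 * (norm l)\<^sup>2" by simp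
  ultimately have "t * inner l v < 0" by linarith
  then show "inner l (bv G j - centre G) < 0" using t(1) by (simp add: mult_less_0_iff v_def)
qed

lemma l_nonzero: "e \<in> edges G \<Longrightarrow> cdet l (evec e) \<noteq> 0"
  using gauge orient_iff(3) by (simp add: gauge_direction_def)

text \<open>Within the closed disc the full line through a boundary vertex coincides with its ray,
  so crossings can be decided by the sides of lines.\<close>

lemma disc_ray:
  assumes j: "j < nb G" and x: "dist (centre G) x \<le> radius G" and z: "cdet l (x - bv G j) = 0"
  shows "x \<in> ray (bv G j) l"
proof -
  have l0: "l \<noteq> 0" using inward[OF j] by auto
  obtain t where t: "x - bv G j = of_real t * l" using cdet_zero_scale[OF l0 z] .
  define v where "v = bv G j - centre G"
  have nv: "norm v = radius G" using bv_dist[OF j] by (simp add: v_def dist_norm norm_minus_commute)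
  have "x - centre G = v + t *\<^sub>R l" using t by (simp add: v_def scaleR_conv_of_real algebra_simps)
  then have "norm (v + t *\<^sub>R l) \<le> norm v" using x nv by (simp add: dist_norm norm_minus_commute)
  then have "(norm (v + t *\<^sub>R l))\<^sup>2 \<le> (norm v)\<^sup>2" by (simp add: power_mono)
  then have le: "2 * t * inner l v + t\<^sup>2 * (norm l)\<^sup>2 \<le> 0"
    using norm_add_scale_sq[of v t l] by linarith
  have "0 \<le> t"
  proof (rule ccontr)
    assume "\<not> 0 \<le> t"
    then have "0 < t * inner l v" using inward[OF j] by (simp add: v_def zero_less_mult_iff)
    moreover have "0 \<le> t\<^sup>2 * (norm l)\<^sup>2" by simp
    ultimately show False using le by linarith
  qed
  then show ?thesis using t by (auto simp: ray_def algebra_simps intro!: exI[of _ t])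
qed

lemma vertex_disc: "V \<in> vertices G \<Longrightarrow> dist (centre G) V \<le> radius G"
  using internal_ball bv_dist by (auto simp: vertices_def intro: less_imp_le)

text \<open>Crossing the gauge rays in the order of the labels follows from the clockwise labelling
  and from \<open>l\<close> pointing into the disc.\<close>

lemma bv_order:
  assumes "i < j" "j < nb G"
  shows "cdet l (bv G j - bv G i) > 0" "cdet (bv G i - centre G) (bv G j - centre G) < 0"
proof -
  obtain \<theta> where \<theta>: "\<And>j. j < nb G \<Longrightarrow> bv G j = centre G + of_real (radius G) * cis (\<theta> j)"
    "\<And>i j. i < j \<Longrightarrow> j < nb G \<Longrightarrow> \<theta> j < \<theta> i \<and> \<theta> i - \<theta> j < pi"
    using arc unfolding clockwise_on_arc_def by blast
  \<comment> \<open>Mean and half difference of the two angles: the chord is perpendicular to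
    \<open>cis a\<close>, and \<open>inward\<close> at both ends makes the component of
    \<open>l\<close> along \<open>cis a\<close> negative.\<close>
  define a b where "a = (\<theta> i + \<theta> j) / 2" and "b = (\<theta> i - \<theta> j) / 2"
  have b: "0 < b" "b < pi / 2" using \<theta>(2)[OF assms] by (auto simp: b_def)
  have ij: "\<theta> i = a + b" "\<theta> j = a - b" by (auto simp: a_def b_def field_simps)
  have cb: "0 < cos b" "0 < sin b" using b by (auto intro: cos_gt_zero sin_gt_zero)
  have bi: "bv G i = centre G + of_real (radius G) * cis (a + b)"
    and bj: "bv G j = centre G + of_real (radius G) * cis (a - b)"
    using \<theta>(1)[of i] \<theta>(1)[of j] assms ij by auto
  have "inner l (bv G i - centre G) + inner l (bv G j - centre G) < 0"
    using inward[of i] inward[of j] assms by simp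
  moreover have "inner l (bv G i - centre G) + inner l (bv G j - centre G)
     = 2 * radius G * cos b * (Re l * cos a + Im l * sin a)"
    by (simp add: bi bj inner_complex_def cos_add cos_diff sin_add sin_diff algebra_simps)
  ultimately have neg: "Re l * cos a + Im l * sin a < 0"
    using cb radius_pos by (simp add: mult_less_0_iff)
  have "cdet l (bv G j - bv G i) = - 2 * radius G * sin b * (Re l * cos a + Im l * sin a)"
    by (simp add: bi bj cdet_def cos_add cos_diff sin_add sin_diff algebra_simps)
  then show "cdet l (bv G j - bv G i) > 0"
    using neg cb radius_pos by (simp add: mult_less_0_iff)
  have "cdet (bv G i - centre G) (bv G j - centre G) = - (radius G)\<^sup>2 * sin (2 * b)"
  proof -
    have "cdet (bv G i - centre G) (bv G j - centre G)
      = (radius G)\<^sup>2 * (cos (a + b) * sin (a - b) - sin (a + b) * cos (a - b))"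
      by (simp add: bi bj cdet_def power2_eq_square algebra_simps)
    also have "cos (a + b) * sin (a - b) - sin (a + b) * cos (a - b) = - sin ((a + b) - (a - b))"
      by (subst sin_diff) simp
    finally show ?thesis by simp
  qed
  moreover have "0 < sin (2 * b)" using b by (intro sin_gt_zero) auto
  ultimately show "cdet (bv G i - centre G) (bv G j - centre G) < 0" using radius_pos by simp
qed

lemma vertex_side:
  assumes V: "V \<in> vertices G" and j: "j < nb G" and ne: "V \<noteq> bv G j"
  shows "cdet l (V - bv G j) \<noteq> 0"
proof
  assume z: "cdet l (V - bv G j) = 0"
  from V consider "V \<in> internal G" | k where "k < nb G" "V = bv G k" by (auto simp: vertices_def)
  then show False
  proof cases
    case 1
    then have "V \<in> ray (bv G j) l" using disc_ray[OF j vertex_disc[OF V] z] by simp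
    then show False using gauge 1 j by (auto simp: gauge_direction_def)
  next
    case (2 k)
    then have "k < j \<or> j < k" using ne by (cases "k = j") auto
    then show False using bv_order(1)[of k j] bv_order(1)[of j k] 2 j z by auto
  qed
qed

definition crossed :: "edge \<Rightarrow> nat set" where
  "crossed e = {s \<in> sources G. ray (bv G s) l \<inter> open_segment (fst e) (snd e) \<noteq> {}}"

lemma edge_vertices: "e \<in> edges G \<Longrightarrow> fst e \<in> vertices G" "e \<in> edges G \<Longrightarrow> snd e \<in> vertices G"
  using edges_vertices by auto

text \<open>The functional \<open>cdet l (x - bv G s)\<close> is affine along the edge, and by
  \<open>disc_ray\<close> its zeros in the disc are the points of the ray.\<close>

lemma crossed_iff:
  assumes e: "e \<in> edges G" and s: "s \<in> sources G"
  shows "s \<in> crossed e \<longleftrightarrow> cdet l (fst e - bv G s) * cdet l (snd e - bv G s) < 0"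
proof -
  let ?\<alpha> = "cdet l (fst e - bv G s)" and ?\<beta> = "cdet l (snd e - bv G s)"
  have sn: "s < nb G" using source_edge(1)[OF s] .
  have ne: "fst e \<noteq> snd e" using edge_internal[OF e] by simp
  have dif: "?\<beta> - ?\<alpha> \<noteq> 0" using l_nonzero[OF e] by (simp add: evec_def)
  have lin: "cdet l ((1 - u) *\<^sub>R fst e + u *\<^sub>R snd e - bv G s) = (1 - u) * ?\<alpha> + u * ?\<beta>" for u
    by (simp add: algebra_simps)
  show ?thesis
  proof
    assume "s \<in> crossed e"
    then obtain x where "x \<in> ray (bv G s) l" "x \<in> open_segment (fst e) (snd e)"
      by (auto simp: crossed_def)
    then obtain t u where x: "x = bv G s + of_real t * l" "0 < u" "u < 1" "x = (1 - u) *\<^sub>R fst e + u *\<^sub>R snd e"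
      unfolding ray_def in_segment by blast
    have "cdet l (x - bv G s) = 0" by (simp add: x(1))
    then have z: "(1 - u) * ?\<alpha> + u * ?\<beta> = 0" using lin[of u] x(4) by simp
    then have "?\<alpha> \<noteq> 0" using dif x(2) by auto
    have "u * (?\<alpha> * ?\<beta>) = - (1 - u) * ?\<alpha>\<^sup>2"
    proof -
      have "u * ?\<beta> = - (1 - u) * ?\<alpha>" using z by (simp add: algebra_simps)
      then have "?\<alpha> * (u * ?\<beta>) = ?\<alpha> * (- (1 - u) * ?\<alpha>)" by simp
      then show ?thesis by (simp add: algebra_simps power2_eq_square)
    qed
    also have "\<dots> < 0" using x(3) \<open>?\<alpha> \<noteq> 0\<close> by (intro mult_neg_pos) (simp_all only: zero_less_power2, simp)
    finally have "u * (?\<alpha> * ?\<beta>) < 0" .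
    then show "?\<alpha> * ?\<beta> < 0" using x(2) by (simp add: mult_less_0_iff)
  next
    assume neg: "?\<alpha> * ?\<beta> < 0"
    \<comment> \<open>The parameter at which the affine function with end values
      \<open>?\<alpha>\<close> and \<open>?\<beta>\<close> vanishes.\<close>
    define u where "u = ?\<alpha> / (?\<alpha> - ?\<beta>)"
    have u: "0 < u" "u < 1" using neg by (auto simp: u_def mult_less_0_iff divide_less_eq zero_less_divide_iff)
    define x where "x = (1 - u) *\<^sub>R fst e + u *\<^sub>R snd e"
    have "(1 - u) * ?\<alpha> + u * ?\<beta> = ?\<alpha> - u * (?\<alpha> - ?\<beta>)" by (simp add: algebra_simps)
    also have "\<dots> = 0" using dif by (simp add: u_def)
    finally have z: "cdet l (x - bv G s) = 0" unfolding x_def lin .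
    have xs: "x \<in> open_segment (fst e) (snd e)" using u ne unfolding x_def in_segment by blast
    have "x \<in> cball (centre G) (radius G)"
      unfolding x_def using vertex_disc edge_vertices[OF e] u
      by (intro convexD[OF convex_cball]) auto
    then have "x \<in> ray (bv G s) l" using disc_ray[OF sn _ z] by simp
    then show "s \<in> crossed e" using xs s by (auto simp: crossed_def)
  qed
qed

definition side :: "nat \<Rightarrow> complex \<Rightarrow> real" where
  "side s V = sgn (cdet l (V - bv G s))"

text \<open>The edge at the source itself starts on the ray, where \<open>side\<close> is 0; this
  start does not count as a crossing.\<close>

lemma crossing_sign:
  assumes e: "e \<in> edges G" and s: "s \<in> sources G"
  shows "(if s \<in> crossed e then -1 else 1) = (if fst e = bv G s then 1 else side s (fst e) * side s (snd e))"
proof (cases "fst e = bv G s")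
  case True
  then show ?thesis using crossed_iff[OF e s] by simp
next
  case False
  have sn: "s < nb G" using source_edge(1)[OF s] .
  have "cdet l (fst e - bv G s) \<noteq> 0" "cdet l (snd e - bv G s) \<noteq> 0"
    using vertex_side edge_vertices[OF e] sn False source_edge(4)[OF s e] by auto
  then show ?thesis using crossed_iff[OF e s] False
    by (auto simp: side_def sgn_real_def mult_less_0_iff)
qed

lemma side_unit:
  "V \<in> vertices G \<Longrightarrow> s < nb G \<Longrightarrow> V \<noteq> bv G s \<Longrightarrow> side s V * side s V = 1"
  using vertex_side[of V s] by (simp add: side_def sgn_real_def)

definition esign :: "edge \<Rightarrow> real" where
  "esign e = (-1) ^ card (crossed e)"

lemma esign_eq: "esign e = (\<Prod>s\<in>sources G. if s \<in> crossed e then -1 else 1)"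
proof -
  have "sources G \<inter> crossed e = crossed e" by (auto simp: crossed_def)
  then have "(\<Prod>s\<in>sources G. if s \<in> crossed e then -1 else (1::real)) = (\<Prod>s\<in>crossed e. -1)"
    using prod.inter_restrict[of "sources G" "\<lambda>_. -1::real" "crossed e"] by simp
  then show ?thesis by (simp add: esign_def)
qed

lemma psign_ray_crossings:
  assumes e: "e \<in> edges G" shows "psign (ray_crossings G l e) = esign e"
proof -
  have "orient l (evec e) = 1 \<or> orient l (evec e) = -1"
    using l_nonzero[OF e] orient_iff[of l "evec e"] by linarith
  then have "odd (ray_crossings G l e) \<longleftrightarrow> odd (card (crossed e))"
    by (auto simp: ray_crossings_def crossed_def)
  then show ?thesis by (auto simp: psign_def esign_def)
qed

text \<open>The sides of the inner vertices occur twice and cancel.\<close>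

lemma path_side:
  assumes p: "epath p" and s: "s \<in> sources G" and hd: "fst (hd p) \<noteq> bv G s"
  shows "prod_list (map (\<lambda>e. if s \<in> crossed e then -1 else 1) p) = side s (fst (hd p)) * side s (snd (last p))"
  using p hd
proof (induction p)
  case (Cons e p)
  have sn: "s < nb G" using source_edge(1)[OF s] .
  have e: "e \<in> edges G" using Cons.prems(1) by (simp add: epath_Cons)
  have c: "(if s \<in> crossed e then -1 else 1) = side s (fst e) * side s (snd e)"
    using crossing_sign[OF e s] Cons.prems(2) by simp
  show ?case
  proof (cases "p = []")
    case False
    then have p: "epath p" "snd e = fst (hd p)" using Cons.prems(1) by (auto simp: epath_Cons)
    have ne: "snd e \<noteq> bv G s" using source_edge(4)[OF s e] .
    have "prod_list (map (\<lambda>e. if s \<in> crossed e then -1 else 1) (e # p))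
      = (side s (fst e) * side s (snd e)) * (side s (snd e) * side s (snd (last p)))"
      using Cons.IH[OF p(1)] ne p(2) c by simp
    also have "\<dots> = side s (fst e) * side s (snd (last p))"
      using side_unit[OF edge_vertices(2)[OF e] sn ne] by (simp add: algebra_simps)
    finally show ?thesis using False by simp
  qed (use c in simp)
qed (simp add: epath_def)

lemma prod_list_swap:
  "prod_list (map (\<lambda>e. \<Prod>s\<in>A. f s e :: real) p) = (\<Prod>s\<in>A. prod_list (map (f s) p))"
  by (induction p) (simp_all add: prod.distrib)

lemma closed_path_crossings:
  assumes p: "epath p" "snd (last p) = fst (hd p)"
  shows "prod_list (map esign p) = 1"
proof -
  have p0: "p \<noteq> []" using p(1) by (simp add: epath_def)
  have E: "last p \<in> edges G" "hd p \<in> edges G" using p(1) p0 by (auto intro: epath_in)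
  have "prod_list (map esign p) = (\<Prod>s\<in>sources G. prod_list (map (\<lambda>e. if s \<in> crossed e then -1 else (1::real)) p))"
    unfolding esign_eq[abs_def] by (rule prod_list_swap)
  also have "\<dots> = 1"
  proof (rule prod.neutral, rule ballI)
    fix s assume s: "s \<in> sources G"
    have ne: "fst (hd p) \<noteq> bv G s" using source_edge(4)[OF s E(1)] p(2) by simp
    then show "prod_list (map (\<lambda>e. if s \<in> crossed e then -1 else 1) p) = (1::real)"
      using path_side[OF p(1) s] p(2) side_unit[OF edge_vertices(1)[OF E(2)] source_edge(1)[OF s]] by simp
  qed
  finally show ?thesis .
qed

lemma side_order: "s < nb G \<Longrightarrow> i < nb G \<Longrightarrow> i \<noteq> s \<Longrightarrow> side s (bv G i) = (if s < i then 1 else -1)"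
  using bv_order(1)[of s i] bv_order(1)[of i s]
  by (cases s i rule: linorder_cases) (auto simp: side_def sgn_real_def)

text \<open>The ray of a source \<open>s\<close> other than \<open>i\<close> separates the ends
  exactly when \<open>s\<close> lies between them. For the ray of \<open>i\<close> the telescoping
  starts at the head of the first edge, whose side is given by the direction of that edge.\<close>

lemma walk_crossings:
  assumes p: "walk G i j p" and ij: "i < nb G" "j < nb G"
  shows "prod_list (map esign p)
    = (-1) ^ card (between i j) * (sgn (cdet l (evec (hd p))) * (if i < j then 1 else -1))"
proof -
  note ends = walk_ends[OF p ij]
  have ep: "epath p" using p by (simp add: walk_epath)
  have p0: "p \<noteq> []" using ep by (simp add: epath_def)
  have hl: "fst (hd p) = bv G i" "snd (last p) = bv G j" using p by (auto simp: walk_def)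
  have E: "last p \<in> edges G" "hd p \<in> edges G" using ep p0 by (auto intro: epath_in)
  have jS: "j \<notin> sources G" using ends(2) by (simp add: sinks_def)
  then have "i \<noteq> j" using ends(1) by auto
  let ?c = "\<lambda>s. prod_list (map (\<lambda>e. if s \<in> crossed e then -1 else (1::real)) p)"
  have ci: "?c i = sgn (cdet l (evec (hd p))) * (if i < j then 1 else -1)"
  proof -
    obtain e q where eq: "p = e # q" using p0 by (cases p) auto
    have e: "e \<in> edges G" "fst e = bv G i" using E hl eq by auto
    have c1: "(if i \<in> crossed e then -1 else 1) = (1::real)" using crossing_sign[OF e(1) ends(1)] e(2) by simp
    have s1: "side i (snd e) = sgn (cdet l (evec e))" using e(2) by (simp add: side_def evec_def)
    have sj: "side i (bv G j) = (if i < j then 1 else -1)" using side_order[of i j] ij \<open>i \<noteq> j\<close> by auto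
    show ?thesis
    proof (cases "q = []")
      case True
      then have sj': "side i (bv G j) = sgn (cdet l (evec e))" using s1 hl eq by simp
      have "side i (bv G j) * side i (bv G j) = 1"
        by (rule side_unit) (use ij inj_bv[of i j] \<open>i \<noteq> j\<close> in \<open>auto simp: vertices_def\<close>)
      then have "sgn (cdet l (evec e)) * (if i < j then 1 else -1) = 1"
        using sj sj' by metis
      then show ?thesis using True eq c1 by simp
    next
      case False
      then have q: "epath q" "snd e = fst (hd q)" using ep eq by (auto simp: epath_Cons)
      have "snd e \<noteq> bv G i" using source_edge(4)[OF ends(1) e(1)] .
      then have "prod_list (map (\<lambda>e. if i \<in> crossed e then -1 else (1::real)) q) = side i (snd e) * side i (bv G j)"
        using path_side[OF q(1) ends(1)] q(2) hl(2) False eq by simp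
      then show ?thesis using c1 s1 sj eq by simp
    qed
  qed
  have cs: "?c s = (if s \<in> between i j then -1 else 1)" if s: "s \<in> sources G" "s \<noteq> i" for s
  proof -
    have sn: "s < nb G" using source_edge(1)[OF s(1)] .
    have "fst (hd p) \<noteq> bv G s" using hl(1) inj_bv[of i s] ij sn s(2) by auto
    then have "?c s = side s (bv G i) * side s (bv G j)" using path_side[OF ep s(1)] hl by simp
    moreover have "s \<noteq> j" using s jS by auto
    ultimately show ?thesis using side_order[OF sn ij(1)] side_order[OF sn ij(2)] s
      by (auto simp: between_def)
  qed
  have "prod_list (map esign p) = (\<Prod>s\<in>sources G. ?c s)"
    unfolding esign_eq[abs_def] by (rule prod_list_swap)
  also have "\<dots> = ?c i * (\<Prod>s\<in>sources G - {i}. ?c s)"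
    by (rule prod.remove) (use ends(1) in auto)
  also have "(\<Prod>s\<in>sources G - {i}. ?c s) = (\<Prod>s\<in>sources G - {i}. if s \<in> between i j then -1 else 1)"
    by (rule prod.cong) (use cs in auto)
  also have "\<dots> = (\<Prod>s\<in>between i j. -1)"
  proof -
    have "(sources G - {i}) \<inter> between i j = between i j" by (auto simp: between_def)
    then show ?thesis
      using prod.inter_restrict[of "sources G - {i}" "\<lambda>_. -1::real" "between i j"] by simp
  qed
  finally show ?thesis using ci by simp
qed

text \<open>The factors of the geometric sign at the two ends of an edge combine, at each inner vertex
  of a path, to the sign of the turn.\<close>

definition tail_sign :: "edge \<Rightarrow> real" where
  "tail_sign e = (if fst e \<notin> internal G then -1 else if fst e \<in> white G
     then swsign l (evec (THE f. f \<in> in_edges G (fst e))) (evec e) else 1)"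

definition head_sign :: "edge \<Rightarrow> real" where
  "head_sign e = (if snd e \<in> black G then swsign l (evec e) (evec (THE f. f \<in> out_edges G (snd e))) else 1)"

text \<open>At a white tail the summand 1 of the geometric exponent cancels the minus sign of
  \<open>lam_sign\<close>; at a boundary tail it survives as the factor -1.\<close>

lemma lam_sign_geometric:
  assumes e: "e \<in> edges G"
  shows "lam_sign G (geometric_signature G l) e = tail_sign e * esign e * head_sign e"
proof -
  have 1: "(-1) ^ geometric_signature G l e = psign (geometric_exponent G l e)"
    unfolding geometric_signature_def by (rule psign_nat_mod2)
  have bw: "black G \<subseteq> internal G" "V \<in> white G \<longleftrightarrow> V \<in> internal G \<and> V \<notin> black G" for V
    using black_internal by (auto simp: white_def)
  have int: "fst e \<in> internal G \<or> snd e \<in> internal G" using edge_internal[OF e] by simp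
  show ?thesis
    unfolding lam_sign_def 1 geometric_exponent_def Let_def tail_sign_def head_sign_def
    using int bw by (auto simp: psign_wind psign_ray_crossings[OF e])
qed

text \<open>By perfect orientation a black vertex knows the edge by which the path leaves, and a
  white vertex the edge by which it enters. Exactly one of the two factors carries the turn.\<close>

lemma turn_sign:
  assumes "e \<in> edges G" "f \<in> edges G" "snd e = fst f"
  shows "head_sign e * tail_sign f = swsign l (evec e) (evec f)"
proof -
  have V: "fst f \<in> internal G"
    using vertex_cases[OF assms(2), of "fst f"] source_edge(4)[OF source_tail[OF assms(2)] assms(1)] assms(3) by metis
  show ?thesis
  proof (cases "fst f \<in> black G")
    case True
    obtain g where g: "out_edges G (fst f) = {g}" using black_out[OF True] by (auto simp: card_1_singleton_iff)
    have "f \<in> out_edges G (fst f)" using assms by (simp add: out_edges_def)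
    then have "g = f" using g by simp
    then show ?thesis using True V g assms by (simp add: head_sign_def tail_sign_def white_def)
  next
    case False
    then have w: "fst f \<in> white G" using V by (simp add: white_def)
    obtain g where g: "in_edges G (fst f) = {g}" using white_in[OF w] by (auto simp: card_1_singleton_iff)
    have "e \<in> in_edges G (fst f)" using assms by (simp add: in_edges_def)
    then have "g = e" using g by simp
    then show ?thesis using False V w g assms by (simp add: head_sign_def tail_sign_def)
  qed
qed

definition turns :: "edge list \<Rightarrow> real" where
  "turns p = (\<Prod>k<length p - 1. swsign l (evec (p ! k)) (evec (p ! Suc k)))"

lemma turns_Cons: "p \<noteq> [] \<Longrightarrow> turns (e # p) = swsign l (evec e) (evec (hd p)) * turns p"
proof -
  assume "p \<noteq> []"
  then obtain m where "length p = Suc m" by (cases p) auto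
  then show ?thesis using \<open>p \<noteq> []\<close>
    unfolding turns_def by (simp add: prod.lessThan_Suc_shift hd_conv_nth del: prod.lessThan_Suc)
qed

lemma path_sign:
  assumes "epath p"
  shows "prod_list (map (lam_sign G (geometric_signature G l)) p)
    = tail_sign (hd p) * prod_list (map esign p) * turns p * head_sign (last p)"
  using assms
proof (induction p)
  case (Cons e p)
  have e: "e \<in> edges G" using Cons.prems by (simp add: epath_Cons)
  show ?case
  proof (cases "p = []")
    case True then show ?thesis using lam_sign_geometric[OF e] by (simp add: turns_def)
  next
    case False
    then have p: "epath p" "snd e = fst (hd p)" using Cons.prems by (auto simp: epath_Cons)
    have "hd p \<in> edges G" using p False by (auto intro: epath_in)
    then have t: "head_sign e * tail_sign (hd p) = swsign l (evec e) (evec (hd p))" using turn_sign e p(2) by simp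
    have "prod_list (map (lam_sign G (geometric_signature G l)) (e # p))
      = (tail_sign e * esign e * head_sign e) *
        (tail_sign (hd p) * prod_list (map esign p) * turns p * head_sign (last p))"
      using Cons.IH[OF p(1)] lam_sign_geometric[OF e] by simp
    also have "\<dots> = tail_sign e * (esign e * prod_list (map esign p)) * ((head_sign e * tail_sign (hd p)) * turns p) * head_sign (last p)"
      by (simp add: ac_simps)
    finally show ?thesis using False by (simp add: turns_Cons t)
  qed
qed (simp add: epath_def)

lemma walk_sign:
  assumes p: "walk G i j p" and ij: "i < nb G" "j < nb G"
  shows "prod_list (map (lam_sign G (geometric_signature G l)) p)
    = - ((-1) ^ card (between i j) * (sgn (cdet l (evec (hd p))) * (if i < j then 1 else -1) * turns p))"
proof -
  have ep: "epath p" using p by (simp add: walk_epath)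
  have hl: "fst (hd p) = bv G i" "snd (last p) = bv G j" using p by (auto simp: walk_def)
  then have "tail_sign (hd p) = -1" "head_sign (last p) = 1"
    using bv_not_internal ij black_internal by (auto simp: tail_sign_def head_sign_def)
  then show ?thesis using path_sign[OF ep] walk_crossings[OF p ij] by simp
qed

lemma closed_path_sign:
  assumes p: "epath p" "snd (last p) = fst (hd p)"
  shows "prod_list (map (lam_sign G (geometric_signature G l)) p)
    = turns p * swsign l (evec (last p)) (evec (hd p))"
proof -
  have p0: "p \<noteq> []" using p(1) by (simp add: epath_def)
  then have "last p \<in> edges G" "hd p \<in> edges G" using p(1) by (auto intro: epath_in)
  then have "head_sign (last p) * tail_sign (hd p) = swsign l (evec (last p)) (evec (hd p))"
    using turn_sign p(2) by blast
  then show ?thesis using path_sign[OF p(1)] closed_path_crossings[OF p] by (simp add: ac_simps)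
qed

end

section \<open>Turning of simple cycles and of simple boundary walks\<close>

context gauge_net
begin

lemma epath_simple_meet:
  assumes e: "e \<in> edges G" "f \<in> edges G" "fst e \<noteq> fst f" "snd e \<noteq> snd f"
    and x: "x \<in> seg e" "x \<in> seg f"
  shows "x = snd e \<and> snd e = fst f \<or> x = fst e \<and> fst e = snd f"
proof -
  have "e \<noteq> f" using e by auto
  from edges_meet[OF e(1,2) this] x have "x \<in> {fst e, snd e} \<inter> {fst f, snd f}" by blast
  then show ?thesis using e(3,4) by auto
qed

text \<open>A repeated tail would have two path edges in and two out. The first tail has no
  predecessor on the path and is covered by the last assumption.\<close>

lemma trail_tails_distinct:
  assumes p: "epath p" "distinct p" and ij: "i < j" "j < length p"
    and hd: "\<And>k. Suc k < length p \<Longrightarrow> snd (p ! k) \<noteq> fst (hd p)"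
  shows "fst (p ! i) \<noteq> fst (p ! j)"
proof
  assume eq: "fst (p ! i) = fst (p ! j)"
  obtain b where b: "j = Suc b" using ij by (cases j) auto
  have p0: "p \<noteq> []" using ij by auto
  have E: "\<And>k. k < length p \<Longrightarrow> p ! k \<in> edges G" using p(1) by (auto intro: epath_in)
  have vb: "snd (p ! b) = fst (p ! j)" using epath_nth[OF p(1)] b ij by simp
  show False
  proof (cases i)
    case 0
    then show False using hd[of b] vb eq b ij p0 by (simp add: hd_conv_nth)
  next
    case (Suc a)
    then have va: "snd (p ! a) = fst (p ! j)" using epath_nth[OF p(1), of a] ij eq by simp
    have "p ! a \<noteq> p ! b" "p ! i \<noteq> p ! j" using p(2) ij b Suc by (simp_all add: nth_eq_iff_index_eq)
    moreover have "{p ! a, p ! b, p ! i, p ! j} \<subseteq> edges G" using E ij b Suc by simp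
    ultimately show False using not_two_in_two_out[of "p ! a" "p ! b" "p ! i" "p ! j", OF _ va vb eq] by blast
  qed
qed

theorem cycle_turning:
  assumes c: "epath c" "distinct c" and closed: "snd (last c) = fst (hd c)"
  shows "turns c * swsign l (evec (last c)) (evec (hd c)) = -1"
proof -
  let ?n = "length c" and ?vs = "map fst c"
  have c0: "c \<noteq> []" using c(1) by (simp add: epath_def)
  then have n0: "0 < ?n" by simp
  have E: "\<And>k. k < ?n \<Longrightarrow> c ! k \<in> edges G" using c(1) by (auto intro: epath_in)
  have hd: "snd (c ! k) \<noteq> fst (hd c)" if k: "Suc k < ?n" for k
  proof
    assume eq: "snd (c ! k) = fst (hd c)"
    have ne: "c ! k \<noteq> last c" "hd c \<noteq> c ! Suc k"
      using c(2) k c0 by (simp_all add: last_conv_nth hd_conv_nth nth_eq_iff_index_eq)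
    have sub: "{c ! k, last c, hd c, c ! Suc k} \<subseteq> edges G"
      using E[OF k] E[of k] k E[of 0] E[of "?n - 1"] c0 by (simp add: last_conv_nth hd_conv_nth)
    have "hd c = c ! Suc k"
      by (rule not_two_in_two_out[OF sub eq closed refl _ ne(1)])
         (simp add: epath_nth[OF c(1) k, symmetric] eq)
    with ne(2) show False by contradiction
  qed
  have head: "snd (c ! k) = fst (c ! (Suc k mod ?n))" if k: "k < ?n" for k
  proof (cases "Suc k < ?n")
    case True then show ?thesis using epath_nth[OF c(1)] by simp
  next
    case False
    then have "Suc k = ?n" using k by simp
    then show ?thesis using closed c0 by (metis One_nat_def diff_Suc_1 hd_conv_nth last_conv_nth mod_self)
  qed
  have nx: "?vs ! (Suc k mod ?n) = snd (c ! k)" if "k < ?n" for k using head[OF that] n0 by simp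
  have tails: "fst (c ! i) \<noteq> fst (c ! j)" if "i < ?n" "j < ?n" "i \<noteq> j" for i j
    using trail_tails_distinct[OF c _ _ hd, of i j] trail_tails_distinct[OF c _ _ hd, of j i] that
    by (metis linorder_neqE_nat)
  have heads: "snd (c ! i) \<noteq> snd (c ! j)" if "i < ?n" "j < ?n" "i \<noteq> j" for i j
  proof -
    have "Suc i mod ?n \<noteq> Suc j mod ?n" using that by (auto simp: mod_Suc split: if_splits)
    then show ?thesis using tails[of "Suc i mod ?n" "Suc j mod ?n"] head that n0 by simp
  qed
  \<comment> \<open>A loop is excluded by \<open>edge_internal\<close>; two opposite edges between
    the same vertices would share their midpoint.\<close>
  have n3: "3 \<le> ?n"
  proof (rule ccontr)
    assume "\<not> 3 \<le> ?n"
    then consider "?n = 1" | "?n = 2" using n0 by linarith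
    then show False
    proof cases
      case 1
      then show False using head[of 0] edge_internal[OF E[of 0]] by simp
    next
      case 2
      have h: "snd (c ! 0) = fst (c ! 1)" "snd (c ! 1) = fst (c ! 0)" using head[of 0] head[of 1] 2 by auto
      have ne: "c ! 0 \<noteq> c ! 1" using tails[of 0 1] 2 by auto
      define m where "m = midpoint (fst (c ! 0)) (snd (c ! 0))"
      have "m \<in> seg (c ! 0)" by (simp add: m_def seg_def)
      moreover from this have "m \<in> seg (c ! 1)" using h by (simp add: seg_def closed_segment_commute)
      ultimately have "m = fst (c ! 0) \<or> m = snd (c ! 0)"
        using edges_meet[OF E[of 0] E[of 1] ne] 2 by auto
      then show False using edge_internal[OF E[of 0]] 2 by (auto simp: m_def midpoint_eq_endpoint)
    qed
  qed
  have "(\<Prod>k<length ?vs - 1. swsign l (?vs ! (Suc k mod length ?vs) - ?vs ! k)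
        (?vs ! (Suc (Suc k) mod length ?vs) - ?vs ! Suc k))
     * swsign l (?vs ! (Suc (length ?vs - 1) mod length ?vs) - ?vs ! (length ?vs - 1))
        (?vs ! (Suc 0 mod length ?vs) - ?vs ! 0) = -1"
  proof (rule polygon_turning)
    show "3 \<le> length ?vs" using n3 by simp
    show "?vs ! k \<noteq> ?vs ! (Suc k mod length ?vs)" if "k < length ?vs" for k
      using that nx[of k] edge_internal[OF E[of k]] by simp
    show "cdet l (?vs ! (Suc k mod length ?vs) - ?vs ! k) \<noteq> 0" if "k < length ?vs" for k
      using that nx[of k] l_nonzero[OF E[of k]] by (simp add: evec_def)
    fix i j x assume ij: "i < j" "j < length ?vs"
      and x: "x \<in> closed_segment (?vs ! i) (?vs ! (Suc i mod length ?vs))"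
        "x \<in> closed_segment (?vs ! j) (?vs ! (Suc j mod length ?vs))"
    then have lt: "i < ?n" "j < ?n" "i \<noteq> j" by auto
    have "x \<in> seg (c ! i)" "x \<in> seg (c ! j)" using x lt nx by (simp_all add: seg_def)
    from epath_simple_meet[OF E[OF lt(1)] E[OF lt(2)] tails[OF lt] heads[OF lt] this]
    consider "x = snd (c ! i)" "snd (c ! i) = fst (c ! j)" | "x = fst (c ! i)" "fst (c ! i) = snd (c ! j)" by blast
    then show "j = Suc i \<and> x = ?vs ! j \<or> i = 0 \<and> j = length ?vs - 1 \<and> x = ?vs ! 0"
    proof cases
      case 1
      then have "Suc i mod ?n = j" using tails[of "Suc i mod ?n" j] head[OF lt(1)] lt n0 by auto
      then have "j = Suc i" using ij lt by (auto simp: mod_Suc split: if_splits)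
      then show ?thesis using 1 lt by simp
    next
      case 2
      then have "Suc j mod ?n = i" using tails[of "Suc j mod ?n" i] head[OF lt(2)] lt n0 by auto
      then have "i = 0" "j = ?n - 1" using ij lt by (auto simp: mod_Suc split: if_splits)
      then show ?thesis using 2 lt c0 by simp
    qed
  qed
  moreover have "(\<Prod>k<length ?vs - 1. swsign l (?vs ! (Suc k mod length ?vs) - ?vs ! k)
        (?vs ! (Suc (Suc k) mod length ?vs) - ?vs ! Suc k)) = turns c"
    unfolding turns_def using nx epath_nth[OF c(1)] by (intro prod.cong) (auto simp: evec_def)
  moreover have "?vs ! (Suc (length ?vs - 1) mod length ?vs) - ?vs ! (length ?vs - 1) = evec (last c)"
    using nx[of "?n - 1"] n0 c0 by (simp add: evec_def last_conv_nth)
  moreover have "?vs ! (Suc 0 mod length ?vs) - ?vs ! 0 = evec (hd c)"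
    using nx[of 0] n3 n0 c0 by (auto simp: evec_def hd_conv_nth)
  ultimately show ?thesis by simp
qed

lemma cycle_geometric_sign:
  assumes "epath c" "distinct c" "snd (last c) = fst (hd c)"
  shows "prod_list (map (lam_sign G (geometric_signature G l)) c) = -1"
  using closed_path_sign cycle_turning assms by simp

lemma boundary_edge_inward:
  assumes e: "e \<in> edges G" and j: "j < nb G"
  shows "fst e = bv G j \<Longrightarrow> inner (evec e) (bv G j - centre G) < 0"
    "snd e = bv G j \<Longrightarrow> inner (evec e) (bv G j - centre G) > 0"
proof -
  define v where "v = bv G j - centre G"
  have nv: "norm v = radius G" using bv_dist[OF j] by (simp add: v_def dist_norm norm_minus_commute)
  have key: "inner (V - bv G j) v < 0" if "V \<in> internal G" for V
  proof -
    have "norm (v + 1 *\<^sub>R (V - bv G j)) < norm v"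
      using internal_ball that nv by (auto simp: v_def dist_norm norm_minus_commute)
    then have "(norm (v + 1 *\<^sub>R (V - bv G j)))\<^sup>2 < (norm v)\<^sup>2" by (simp add: power_strict_mono)
    then have "2 * inner (V - bv G j) v + (norm (V - bv G j))\<^sup>2 < 0"
      using norm_add_scale_sq[of v 1 "V - bv G j"] by simp
    moreover have "0 \<le> (norm (V - bv G j))\<^sup>2" by simp
    ultimately show ?thesis by linarith
  qed
  show "inner (evec e) (bv G j - centre G) < 0" if "fst e = bv G j"
    using key[of "snd e"] edge_internal[OF e] that bv_not_internal[OF j] by (auto simp: evec_def v_def)
  show "inner (evec e) (bv G j - centre G) > 0" if "snd e = bv G j"
    using key[of "fst e"] edge_internal[OF e] that bv_not_internal[OF j]
    by (auto simp: evec_def v_def inner_diff_left)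
qed

lemma walk_vertices:
  assumes p: "walk G i j p" "i < nb G" "j < nb G" and k: "Suc k < length p"
  shows "snd (p ! k) \<in> internal G"
proof -
  have ep: "epath p" using p(1) by (simp add: walk_epath)
  have E: "p ! k \<in> edges G" "p ! Suc k \<in> edges G" using ep k by (auto intro: epath_in)
  show ?thesis
  proof (rule ccontr)
    assume "snd (p ! k) \<notin> internal G"
    then obtain m where m: "m < nb G" "snd (p ! k) = bv G m" using vertex_cases[OF E(1), of "snd (p ! k)"] by metis
    then show False using sink_edge(4)[OF sink_head[OF E(1) m] E(2)] epath_nth[OF ep k] by simp
  qed
qed

text \<open>A simple walk is closed to a simple polygon by the meeting point of the tangents of the
  boundary circle at its end points.\<close>

theorem walk_turning:
  assumes p: "walk G i j p" "distinct p" and ij: "i < nb G" "j < nb G"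
  shows "turns p = sgn (cdet l (evec (hd p))) * (if i < j then 1 else -1)"
proof -
  note ends = walk_ends[OF p(1) ij]
  have ep: "epath p" using p(1) by (simp add: walk_epath)
  then have p0: "p \<noteq> []" by (simp add: epath_def)
  let ?m = "length p"
  have m0: "0 < ?m" using p0 by simp
  have hl: "fst (hd p) = bv G i" "snd (last p) = bv G j" using p by (auto simp: walk_def)
  have E: "\<And>k. k < ?m \<Longrightarrow> p ! k \<in> edges G" using ep by (auto intro: epath_in)
  have lastE: "last p \<in> edges G" and hdE: "hd p \<in> edges G" using ep p0 by (auto intro: epath_in)
  have "j \<notin> sources G" using ends(2) by (simp add: sinks_def)
  then have ne: "i \<noteq> j" using ends(1) by auto
  define u v where "u = bv G i - centre G" and "v = bv G j - centre G"
  have nu: "inner u u = (radius G)\<^sup>2" and nv: "inner v v = (radius G)\<^sup>2"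
    using bv_dist[OF ij(1)] bv_dist[OF ij(2)]
    by (simp_all add: u_def v_def dist_norm norm_minus_commute flip: power2_norm_eq_inner)
  define D where "D = cdet u v"
  have D: "if i < j then D < 0 else D > 0"
    using bv_order(2)[of i j] bv_order(2)[of j i] ij ne cdet_swap[of u v]
    by (cases "i < j") (auto simp: D_def u_def v_def)
  have lu: "inner l u < 0" and lv: "inner l v < 0" using inward ij by (simp_all add: u_def v_def)
  have lag: "(inner u v)\<^sup>2 + D\<^sup>2 = (radius G)\<^sup>2 * (radius G)\<^sup>2"
  proof -
    have "(inner u v)\<^sup>2 + D\<^sup>2 = inner u u * inner v v"
      by (simp add: D_def cdet_def inner_complex_def power2_eq_square algebra_simps)
    then show ?thesis by (simp add: nu nv)
  qed
  \<comment> \<open>\<open>S\<close> is \<open>inner u (u + v)\<close>, positive because the end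
    points are not antipodal. A point \<open>\<kappa> *\<^sub>R (u + v)\<close> relative to the
    centre lies on both tangents iff \<open>\<kappa> * S\<close> is the squared radius.\<close>
  define S where "S = (radius G)\<^sup>2 + inner u v"
  have S: "S > 0"
  proof -
    have "0 < D\<^sup>2" using D by (auto split: if_splits)
    then have "(inner u v)\<^sup>2 < ((radius G)\<^sup>2)\<^sup>2" using lag by (simp add: power2_eq_square)
    then have "\<bar>inner u v\<bar> < (radius G)\<^sup>2" by (rule power2_less_imp_less[of "\<bar>inner u v\<bar>", unfolded power2_abs]) simp
    then show ?thesis by (simp add: S_def)
  qed
  define \<kappa> where "\<kappa> = (radius G)\<^sup>2 / S"
  define a where "a = centre G + \<kappa> *\<^sub>R (u + v)"
  \<comment> \<open>Up to sign the tangent length divided by the radius; positive exactly when the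
    closing path from \<open>bv G j\<close> to \<open>bv G i\<close> runs counterclockwise.\<close>
  define \<tau> where "\<tau> = - D / S"
  have au: "bv G i - a = \<tau> *\<^sub>R (\<i> * u)" and av: "a - bv G j = \<tau> *\<^sub>R (\<i> * v)"
  proof -
    have R2: "(radius G)\<^sup>2 = Re u * Re u + Im u * Im u" "(radius G)\<^sup>2 = Re v * Re v + Im v * Im v"
      using nu nv by (simp_all add: inner_complex_def)
    have Su: "S *\<^sub>R (bv G i - a) = (- D) *\<^sub>R (\<i> * u)"
    proof -
      have "S *\<^sub>R (bv G i - a) = S *\<^sub>R u - (radius G)\<^sup>2 *\<^sub>R (u + v)"
        using S by (simp add: a_def \<kappa>_def u_def algebra_simps)
      also have "\<dots> = inner u v *\<^sub>R u - inner u u *\<^sub>R v" by (simp add: S_def nu algebra_simps)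
      also have "\<dots> = (- D) *\<^sub>R (\<i> * u)"
        by (simp add: complex_eq_iff D_def cdet_def inner_complex_def algebra_simps)
      finally show ?thesis .
    qed
    have Sv: "S *\<^sub>R (a - bv G j) = (- D) *\<^sub>R (\<i> * v)"
    proof -
      have "S *\<^sub>R (a - bv G j) = (radius G)\<^sup>2 *\<^sub>R (u + v) - S *\<^sub>R v"
        using S by (simp add: a_def \<kappa>_def v_def algebra_simps)
      also have "\<dots> = inner v v *\<^sub>R u - inner u v *\<^sub>R v" by (simp add: S_def nv algebra_simps)
      also have "\<dots> = (- D) *\<^sub>R (\<i> * v)"
        by (simp add: complex_eq_iff D_def cdet_def inner_complex_def algebra_simps)
      finally show ?thesis .
    qed
    have "(1 / S) *\<^sub>R (S *\<^sub>R (bv G i - a)) = (1 / S) *\<^sub>R ((- D) *\<^sub>R (\<i> * u))" using Su by simp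
    then show "bv G i - a = \<tau> *\<^sub>R (\<i> * u)" using S by (simp add: \<tau>_def)
    have "(1 / S) *\<^sub>R (S *\<^sub>R (a - bv G j)) = (1 / S) *\<^sub>R ((- D) *\<^sub>R (\<i> * v))" using Sv by simp
    then show "a - bv G j = \<tau> *\<^sub>R (\<i> * v)" using S by (simp add: \<tau>_def)
  qed
  have \<tau>: "if i < j then \<tau> > 0 else \<tau> < 0"
    using D S by (auto simp: \<tau>_def divide_less_0_iff zero_less_divide_iff split: if_splits)
  then have \<tau>0: "\<tau> \<noteq> 0" by (auto split: if_splits)
  have cda: "cdet l (bv G i - a) = \<tau> * inner l u" "cdet l (a - bv G j) = \<tau> * inner l v"
    unfolding au av by simp_all
  let ?vs = "map fst p @ [bv G j, a]"
  let ?n = "length ?vs"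
  have n: "?n = ?m + 2" by simp
  have vs: "?vs ! k = fst (p ! k)" if "k < ?m" for k using that by (simp add: nth_append)
  have vsm: "?vs ! ?m = bv G j" "?vs ! Suc ?m = a" by (simp_all add: nth_append)
  have nx: "?vs ! (Suc k mod ?n) = snd (p ! k)" if k: "k < ?m" for k
  proof (cases "Suc k < ?m")
    case True then show ?thesis using epath_nth[OF ep True] vs[OF True] by simp
  next
    case False
    then have k': "k = ?m - 1" "Suc k = ?m" using k by auto
    then have "snd (p ! k) = bv G j" using hl(2) p0 by (simp add: last_conv_nth)
    then show ?thesis using vsm k' by simp
  qed
  have nxm: "?vs ! (Suc ?m mod ?n) = a" "?vs ! (Suc (Suc ?m) mod ?n) = bv G i"
    using vsm vs[of 0] m0 hl(1) p0 by (simp_all add: hd_conv_nth)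
  have hd: "snd (p ! k) \<noteq> fst (hd p)" if "Suc k < ?m" for k
    using walk_vertices[OF p(1) ij that] bv_not_internal[OF ij(1)] hl by auto
  have tails: "fst (p ! b) \<noteq> fst (p ! c)" if "b < ?m" "c < ?m" "b \<noteq> c" for b c
    using trail_tails_distinct[OF ep p(2) _ _ hd, of b c] trail_tails_distinct[OF ep p(2) _ _ hd, of c b] that
    by (metis linorder_neqE_nat)
  have endhead: "snd (p ! b) \<noteq> bv G j" if "Suc b < ?m" for b
    using walk_vertices[OF p(1) ij that] bv_not_internal[OF ij(2)] by auto
  have heads: "snd (p ! b) \<noteq> snd (p ! c)" if "b < c" "c < ?m" for b c
  proof (cases "Suc c < ?m")
    case True
    then show ?thesis using epath_nth[OF ep, of b] epath_nth[OF ep, of c] tails[of "Suc b" "Suc c"] that by simp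
  next
    case False
    then have "c = ?m - 1" using that by simp
    then have "snd (p ! c) = bv G j" using hl p0 by (simp add: last_conv_nth)
    then show ?thesis using endhead[of b] that by simp
  qed
  have ball: "dist (centre G) x \<le> radius G" if "x \<in> seg (p ! k)" "k < ?m" for x k
  proof -
    have "seg (p ! k) \<subseteq> cball (centre G) (radius G)"
      unfolding seg_def using vertex_disc edge_vertices[OF E[OF that(2)]]
      by (intro closed_segment_subset convex_cball) auto
    then show ?thesis using that by auto
  qed
  \<comment> \<open>A tangent meets the closed disc only at its point of contact, so the two added
    sides meet the walk only at its ends.\<close>
  have tangent: "x = bv G c" if x: "x = bv G c + t *\<^sub>R (\<i> * (bv G c - centre G))"
    and d: "dist (centre G) x \<le> radius G" and c: "c < nb G" for x t c
  proof -
    define w where "w = bv G c - centre G"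
    have nw: "norm w = radius G" using bv_dist[OF c] by (simp add: w_def dist_norm norm_minus_commute)
    have "norm (w + t *\<^sub>R (\<i> * w)) \<le> norm w"
      using d x nw by (simp add: w_def dist_norm norm_minus_commute algebra_simps)
    then have "(norm (w + t *\<^sub>R (\<i> * w)))\<^sup>2 \<le> (norm w)\<^sup>2" by (simp add: power_mono)
    then have "2 * t * inner (\<i> * w) w + t\<^sup>2 * (norm (\<i> * w))\<^sup>2 \<le> 0"
      using norm_add_scale_sq[of w t "\<i> * w"] by linarith
    moreover have "inner (\<i> * w) w = 0" by (simp add: inner_complex_def)
    ultimately have "t\<^sup>2 * (norm (\<i> * w))\<^sup>2 \<le> 0" by simp
    moreover have "norm (\<i> * w) > 0" using nw radius_pos by (simp add: norm_mult)
    ultimately have "t = 0" by (simp add: mult_le_0_iff)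
    then show ?thesis using x by simp
  qed
  have segv: "x = bv G j" if xs: "x \<in> closed_segment (bv G j) a" "dist (centre G) x \<le> radius G" for x
  proof -
    obtain t where "x = (1 - t) *\<^sub>R bv G j + t *\<^sub>R a" using xs(1) unfolding in_segment by blast
    then have "x = bv G j + t *\<^sub>R (a - bv G j)" by (simp add: algebra_simps)
    then have "x = bv G j + (t * \<tau>) *\<^sub>R (\<i> * (bv G j - centre G))"
      unfolding av by (simp add: v_def)
    from tangent[OF this xs(2) ij(2)] show ?thesis .
  qed
  have segu: "x = bv G i" if xs: "x \<in> closed_segment a (bv G i)" "dist (centre G) x \<le> radius G" for x
  proof -
    obtain t where "x = (1 - t) *\<^sub>R a + t *\<^sub>R bv G i" using xs(1) unfolding in_segment by blast
    then have "x = bv G i + (t - 1) *\<^sub>R (bv G i - a)" by (simp add: algebra_simps)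
    then have "x = bv G i + ((t - 1) * \<tau>) *\<^sub>R (\<i> * (bv G i - centre G))"
      unfolding au by (simp add: u_def)
    from tangent[OF this xs(2) ij(1)] show ?thesis .
  qed
  have seguv: "x = a" if xs: "x \<in> closed_segment (bv G j) a" "x \<in> closed_segment a (bv G i)" for x
  proof -
    obtain t where "x = (1 - t) *\<^sub>R bv G j + t *\<^sub>R a" using xs(1) unfolding in_segment by blast
    then have t: "x - a = (- (1 - t)) *\<^sub>R (a - bv G j)" by (simp add: algebra_simps)
    obtain r where "x = (1 - r) *\<^sub>R a + r *\<^sub>R bv G i" using xs(2) unfolding in_segment by blast
    then have r: "x - a = r *\<^sub>R (bv G i - a)" by (simp add: algebra_simps)
    have "cdet (x - a) (x - a) = cdet (r *\<^sub>R (bv G i - a)) ((- (1 - t)) *\<^sub>R (a - bv G j))"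
      using t r by metis
    then have "0 = r * (- (1 - t)) * (\<tau> * \<tau>) * cdet (\<i> * u) (\<i> * v)" unfolding au av by auto
    moreover have "cdet (\<i> * u) (\<i> * v) = D" by (simp add: D_def cdet_def inner_complex_def)
    moreover have "D \<noteq> 0" using D by (auto split: if_splits)
    ultimately have "r = 0 \<or> 1 - t = 0" using \<tau>0 by simp
    then show "x = a" using t r by auto
  qed
  have at_v: "k = ?m - 1" if "bv G j \<in> seg (p ! k)" "k < ?m" for k
  proof (rule ccontr)
    assume "k \<noteq> ?m - 1"
    then have k: "Suc k < ?m" using that by simp
    have "p ! k \<noteq> last p" using p(2) k p0 by (simp add: last_conv_nth nth_eq_iff_index_eq)
    moreover have "bv G j \<in> seg (last p)" using hl by (simp add: seg_def)
    ultimately have "bv G j \<in> {fst (p ! k), snd (p ! k)}"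
      using edges_meet[OF E[OF that(2)] lastE] that(1) by blast
    then show False using sink_edge(4)[OF ends(2) E[OF that(2)]] endhead[OF k] by auto
  qed
  have at_u: "k = 0" if "bv G i \<in> seg (p ! k)" "k < ?m" for k
  proof (rule ccontr)
    assume k: "k \<noteq> 0"
    have "p ! k \<noteq> hd p" using p(2) k that p0 by (simp add: hd_conv_nth nth_eq_iff_index_eq)
    moreover have "bv G i \<in> seg (hd p)" using hl by (simp add: seg_def)
    ultimately have "bv G i \<in> {fst (p ! k), snd (p ! k)}"
      using edges_meet[OF E[OF that(2)] hdE] that(1) by blast
    then show False using source_edge(4)[OF ends(1) E[OF that(2)]] tails[of k 0] k that m0 hl p0
      by (auto simp: hd_conv_nth)
  qed
  have "(\<Prod>k<?n - 1. swsign l (?vs ! (Suc k mod ?n) - ?vs ! k) (?vs ! (Suc (Suc k) mod ?n) - ?vs ! Suc k))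
     * swsign l (?vs ! (Suc (?n - 1) mod ?n) - ?vs ! (?n - 1)) (?vs ! (Suc 0 mod ?n) - ?vs ! 0) = -1"
  proof (rule polygon_turning)
    show "3 \<le> ?n" using m0 n by linarith
    show "?vs ! k \<noteq> ?vs ! (Suc k mod ?n)" "cdet l (?vs ! (Suc k mod ?n) - ?vs ! k) \<noteq> 0"
      if k: "k < ?n" for k
    proof -
      consider "k < ?m" | "k = ?m" | "k = Suc ?m" using k by fastforce
      then have "cdet l (?vs ! (Suc k mod ?n) - ?vs ! k) \<noteq> 0"
      proof cases
        case 1 then show ?thesis unfolding nx[OF 1] vs[OF 1] using l_nonzero[OF E[OF 1]] by (simp add: evec_def)
      next
        case 2 show ?thesis unfolding 2 nxm vsm cda using lv \<tau>0 by simp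
      next
        case 3 show ?thesis unfolding 3 nxm vsm cda using lu \<tau>0 by simp
      qed
      then show "cdet l (?vs ! (Suc k mod ?n) - ?vs ! k) \<noteq> 0" .
      then show "?vs ! k \<noteq> ?vs ! (Suc k mod ?n)" by auto
    qed
    fix b c x assume bc: "b < c" "c < ?n"
      and x: "x \<in> closed_segment (?vs ! b) (?vs ! (Suc b mod ?n))"
        "x \<in> closed_segment (?vs ! c) (?vs ! (Suc c mod ?n))"
    consider "c < ?m" | "b < ?m" "c = ?m" | "b < ?m" "c = Suc ?m" | "b = ?m" "c = Suc ?m" using bc by fastforce
    then show "c = Suc b \<and> x = ?vs ! c \<or> b = 0 \<and> c = ?n - 1 \<and> x = ?vs ! 0"
    proof cases
      case 1
      then have b: "b < ?m" using bc by simp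
      have xs: "x \<in> seg (p ! b)" "x \<in> seg (p ! c)"
        using x unfolding nx[OF 1] nx[OF b] vs[OF 1] vs[OF b] by (simp_all add: seg_def)
      have tc: "fst (p ! b) \<noteq> fst (p ! c)" using tails b 1 bc by simp
      from epath_simple_meet[OF E[OF b] E[OF 1] tc heads[OF bc(1) 1] xs]
      consider "x = snd (p ! b)" "snd (p ! b) = fst (p ! c)" | "fst (p ! b) = snd (p ! c)" by blast
      then show ?thesis
      proof cases
        case A: 1
        then have "fst (p ! Suc b) = fst (p ! c)" using epath_nth[OF ep, of b] bc 1 by simp
        then have "c = Suc b" using tails[of "Suc b" c] bc 1 by fastforce
        then show ?thesis using A vs[OF 1] by simp
      next
        case B: 2
        show ?thesis
        proof (cases "b = 0")
          case True
          then show ?thesis using B source_edge(4)[OF ends(1) E[OF 1]] hl(1) p0 by (simp add: hd_conv_nth)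
        next
          case False
          then have "snd (p ! (b - 1)) = fst (p ! b)" using epath_nth[OF ep, of "b - 1"] b by simp
          moreover have "b - 1 < c" using bc(1) by simp
          ultimately show ?thesis using heads[OF _ 1, of "b - 1"] B by simp
        qed
      qed
    next
      case 2
      have xs: "x \<in> seg (p ! b)" "x \<in> closed_segment (bv G j) a"
        using x unfolding 2(2) nx[OF 2(1)] vs[OF 2(1)] nxm vsm by (simp_all add: seg_def)
      have "x = bv G j" using segv[OF xs(2) ball[OF xs(1) 2(1)]] .
      moreover from this have "b = ?m - 1" using at_v xs(1) 2(1) by simp
      ultimately show ?thesis using vsm 2 by auto
    next
      case 3
      have xs: "x \<in> seg (p ! b)" "x \<in> closed_segment a (bv G i)"
        using x unfolding 3(2) nx[OF 3(1)] vs[OF 3(1)] nxm vsm by (simp_all add: seg_def)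
      have "x = bv G i" using segu[OF xs(2) ball[OF xs(1) 3(1)]] .
      moreover from this have "b = 0" using at_u xs(1) 3(1) by simp
      moreover have "?vs ! 0 = bv G i" using vs[OF m0] hl p0 by (simp add: hd_conv_nth)
      ultimately show ?thesis using 3 by simp
    next
      case 4
      have "x \<in> closed_segment (bv G j) a" "x \<in> closed_segment a (bv G i)"
        using x unfolding 4 nxm vsm by simp_all
      then have "x = a" by (rule seguv)
      then show ?thesis using 4 vsm by simp
    qed
  qed
  moreover have "?n - 1 = Suc ?m" by simp
  moreover have "(\<Prod>k<Suc ?m. swsign l (?vs ! (Suc k mod ?n) - ?vs ! k) (?vs ! (Suc (Suc k) mod ?n) - ?vs ! Suc k))
    = turns p * swsign l (evec (last p)) (a - bv G j) * swsign l (a - bv G j) (bv G i - a)"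
  proof -
    obtain r where r: "?m = Suc r" using m0 by (cases ?m) auto
    have "(\<Prod>k<r. swsign l (?vs ! (Suc k mod ?n) - ?vs ! k) (?vs ! (Suc (Suc k) mod ?n) - ?vs ! Suc k)) = turns p"
      unfolding turns_def using r nx vs epath_nth[OF ep] by (intro prod.cong) (auto simp: evec_def)
    moreover have "?vs ! (Suc r mod ?n) - ?vs ! r = evec (last p)"
      using nx[of r] vs[of r] r p0 by (simp add: evec_def last_conv_nth)
    ultimately show ?thesis using nxm vsm unfolding r by simp
  qed
  moreover have "?vs ! (Suc (Suc ?m) mod ?n) - ?vs ! Suc ?m = bv G i - a" using nxm vsm by simp
  moreover have "?vs ! (Suc 0 mod ?n) - ?vs ! 0 = evec (hd p)"
    using nx[OF m0] vs[OF m0] p0 by (simp add: evec_def hd_conv_nth)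
  ultimately have total: "turns p * swsign l (evec (last p)) (a - bv G j) * swsign l (a - bv G j) (bv G i - a)
     * swsign l (bv G i - a) (evec (hd p)) = -1" by simp
  have el: "inner (evec (last p)) v > 0" using boundary_edge_inward(2)[OF lastE ij(2)] hl by (simp add: v_def)
  have eh: "inner (evec (hd p)) u < 0" using boundary_edge_inward(1)[OF hdE ij(1)] hl by (simp add: u_def)
  have cd1: "cdet (evec (last p)) (a - bv G j) = \<tau> * inner (evec (last p)) v" unfolding av by simp
  have cd3: "cdet (bv G i - a) (evec (hd p)) = - (\<tau> * inner (evec (hd p)) u)" unfolding au by (simp add: inner_commute)
  have ls: "cdet l (evec (hd p)) \<noteq> 0" using l_nonzero[OF hdE] .
  \<comment> \<open>Among the three added corners only the one at \<open>bv G i\<close> can sweep,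
    depending on the side of the first edge.\<close>
  show ?thesis
  proof (cases "i < j")
    case True
    then have t: "\<tau> > 0" using \<tau> by simp
    have s: "cdet l (a - bv G j) < 0" "cdet l (bv G i - a) < 0"
      unfolding cda using t lu lv by (simp_all add: mult_pos_neg)
    have "cdet (evec (last p)) (a - bv G j) > 0" "cdet (bv G i - a) (evec (hd p)) > 0"
      unfolding cd1 cd3 using t el eh by (simp_all add: mult_pos_neg)
    then have "swsign l (evec (last p)) (a - bv G j) = 1" "swsign l (a - bv G j) (bv G i - a) = 1"
      "swsign l (bv G i - a) (evec (hd p)) = (if cdet l (evec (hd p)) > 0 then -1 else 1)"
      using s by (auto simp: swsign_def sweeps_def)
    then show ?thesis using total ls True by (auto simp: sgn_real_def split: if_splits)
  next
    case False
    then have t: "\<tau> < 0" using \<tau> by simp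
    have s: "cdet l (a - bv G j) > 0" "cdet l (bv G i - a) > 0"
      unfolding cda using t lu lv by (simp_all add: mult_neg_neg)
    have "cdet (evec (last p)) (a - bv G j) < 0" "cdet (bv G i - a) (evec (hd p)) < 0"
      unfolding cd1 cd3 using t el eh by (simp_all add: mult_neg_pos mult_neg_neg)
    then have "swsign l (evec (last p)) (a - bv G j) = 1" "swsign l (a - bv G j) (bv G i - a) = 1"
      "swsign l (bv G i - a) (evec (hd p)) = (if cdet l (evec (hd p)) < 0 then -1 else 1)"
      using s by (auto simp: swsign_def sweeps_def)
    then show ?thesis using total ls False by (auto simp: sgn_real_def split: if_splits)
  qed
qed

lemma simple_walk_geometric_sign:
  assumes p: "walk G i j p" "distinct p" and ij: "i < nb G" "j < nb G"
  shows "prod_list (map (lam_sign G (geometric_signature G l)) p) = - ((-1) ^ card (between i j))"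
proof -
  have "hd p \<in> edges G" using p(1) by (auto simp: walk_def)
  then have "sgn (cdet l (evec (hd p))) * sgn (cdet l (evec (hd p))) = 1"
    using l_nonzero by (simp add: sgn_real_def)
  then show ?thesis using walk_sign[OF p(1) ij] walk_turning[OF p ij] by (auto simp: algebra_simps)
qed

end

section \<open>Postnikov's winding index\<close>

lemma cdet_mult: "cdet (l * a) (l * b) = (norm l)\<^sup>2 * cdet a b"
  unfolding cdet_def cmod_power2 by (simp add: power2_eq_square algebra_simps)

text \<open>Angles are measured from \<open>l\<close> in \<open>[0, 2 * pi)\<close>, so their jump
  occurs at the direction whose sweeps are counted.\<close>

lemma polar_turn:
  assumes l: "l \<noteq> 0" and a: "a \<noteq> 0"
  defines "\<alpha> \<equiv> Arg2pi (a / l)"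
  shows "a = l * (of_real (norm (a / l)) * cis \<alpha>)" "0 < norm (a / l)" "0 \<le> \<alpha>" "\<alpha> < 2 * pi"
    "cdet l a = (norm l)\<^sup>2 * norm (a / l) * sin \<alpha>"
proof -
  have "a / l = of_real (norm (a / l)) * cis \<alpha>"
    using Arg2pi_eq[of "a / l"] by (simp add: \<alpha>_def cis_conv_exp)
  then show eq: "a = l * (of_real (norm (a / l)) * cis \<alpha>)" using l by (simp add: field_simps)
  show "0 < norm (a / l)" using l a by simp
  show "0 \<le> \<alpha>" "\<alpha> < 2 * pi" using Arg2pi[of "a / l"] by (auto simp: \<alpha>_def)
  have "cdet l a = cdet (l * 1) (l * (of_real (norm (a / l)) * cis \<alpha>))" using eq by simp
  also have "\<dots> = (norm l)\<^sup>2 * norm (a / l) * sin \<alpha>" unfolding cdet_mult by (simp add: cdet_def)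
  finally show "cdet l a = (norm l)\<^sup>2 * norm (a / l) * sin \<alpha>" .
qed

lemma polar_quotient:
  assumes l: "l \<noteq> 0" and a: "a \<noteq> 0" and b: "b \<noteq> 0"
  defines "\<delta> \<equiv> Arg2pi (b / l) - Arg2pi (a / l)"
  shows "b / a = of_real (norm (b / l) / norm (a / l)) * cis \<delta>"
    "cdet a b = (norm l)\<^sup>2 * norm (a / l) * norm (b / l) * sin \<delta>"
proof -
  note pa = polar_turn[OF l a] and pb = polar_turn[OF l b]
  have "cdet a b = cdet (l * (of_real (norm (a / l)) * cis (Arg2pi (a / l)))) (l * (of_real (norm (b / l)) * cis (Arg2pi (b / l))))"
    using pa(1) pb(1) by simp
  also have "\<dots> = (norm l)\<^sup>2 * norm (a / l) * norm (b / l) * sin \<delta>"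
    unfolding cdet_mult \<delta>_def sin_diff by (simp add: cdet_def algebra_simps)
  finally show "cdet a b = (norm l)\<^sup>2 * norm (a / l) * norm (b / l) * sin \<delta>" .
  have "b / a = (l * (of_real (norm (b / l)) * cis (Arg2pi (b / l)))) / (l * (of_real (norm (a / l)) * cis (Arg2pi (a / l))))"
    using pa(1) pb(1) by simp
  also have "\<dots> = of_real (norm (b / l) / norm (a / l)) * (cis (Arg2pi (b / l)) / cis (Arg2pi (a / l)))"
    using l by simp
  also have "cis (Arg2pi (b / l)) / cis (Arg2pi (a / l)) = cis \<delta>" by (simp add: cis_divide \<delta>_def)
  finally show "b / a = of_real (norm (b / l) / norm (a / l)) * cis \<delta>" .
qed

lemma sin_sign_Arg2pi:
  fixes \<alpha> :: real
  assumes "0 \<le> \<alpha>" "\<alpha> < 2 * pi"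
  shows "0 < sin \<alpha> \<Longrightarrow> 0 < \<alpha> \<and> \<alpha> < pi" "sin \<alpha> < 0 \<Longrightarrow> pi < \<alpha>"
proof -
  have 1: "sin \<alpha> \<le> 0" if "pi \<le> \<alpha>" using sin_le_zero[of \<alpha>] that assms by simp
  have 2: "0 \<le> sin \<alpha>" if "\<alpha> \<le> pi" using sin_ge_zero[of \<alpha>] that assms by simp
  show "0 < \<alpha> \<and> \<alpha> < pi" if "0 < sin \<alpha>"
    using 1 that assms by (cases "\<alpha> = 0") (auto simp: not_less[symmetric])
  show "pi < \<alpha>" if "sin \<alpha> < 0" using 2 that by force
qed

text \<open>The principal argument differs from the difference of the angles by
  \<open>2 * pi\<close> exactly when the turn passes over \<open>l\<close>. Antiparallel vectors,
  where the sense of the turn is ambiguous, are excluded.\<close>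

lemma Arg_turn:
  assumes nz: "cdet l a \<noteq> 0" "cdet l b \<noteq> 0" and anti: "\<And>t. 0 < t \<Longrightarrow> b \<noteq> (- t) *\<^sub>R a"
  obtains k :: int where "Arg (b / a) = Arg2pi (b / l) - Arg2pi (a / l) + 2 * pi * k"
    "psign k = swsign l a b"
proof -
  have l: "l \<noteq> 0" and a: "a \<noteq> 0" and b: "b \<noteq> 0" using nz by auto
  define \<alpha> \<beta> where "\<alpha> = Arg2pi (a / l)" and "\<beta> = Arg2pi (b / l)"
  define \<delta> where "\<delta> = \<beta> - \<alpha>"
  define ra rb where "ra = norm (a / l)" and "rb = norm (b / l)"
  note pa = polar_turn[OF l a, folded \<alpha>_def ra_def] and pb = polar_turn[OF l b, folded \<beta>_def rb_def]
  note pq = polar_quotient[OF l a b, folded \<alpha>_def \<beta>_def ra_def rb_def, folded \<delta>_def]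
  have nl: "0 < (norm l)\<^sup>2" using l by simp
  have sa: "cdet l a < 0 \<longleftrightarrow> sin \<alpha> < 0" "0 < cdet l a \<longleftrightarrow> 0 < sin \<alpha>"
    using pa(2,5) nl by (auto simp: mult_less_0_iff zero_less_mult_iff)
  have sb: "cdet l b < 0 \<longleftrightarrow> sin \<beta> < 0" "0 < cdet l b \<longleftrightarrow> 0 < sin \<beta>"
    using pb(2,5) nl by (auto simp: mult_less_0_iff zero_less_mult_iff)
  have sab: "cdet a b < 0 \<longleftrightarrow> sin \<delta> < 0" "0 < cdet a b \<longleftrightarrow> 0 < sin \<delta>"
    using pa(2) pb(2) pq(2) nl by (auto simp: mult_less_0_iff zero_less_mult_iff)
  have an: "sin \<alpha> \<noteq> 0" "sin \<beta> \<noteq> 0" using nz pa(5) pb(5) by auto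
  have range: "- 2 * pi < \<delta>" "\<delta> < 2 * pi" using pa(3,4) pb(3,4) by (auto simp: \<delta>_def)
  have np: "cis \<delta> \<noteq> -1"
  proof
    assume "cis \<delta> = -1"
    then have "b / a = - of_real (rb / ra)" using pq(1) by simp
    then have "b = (- (rb / ra)) *\<^sub>R a" using a by (simp add: field_simps scaleR_conv_of_real)
    then show False using anti[of "rb / ra"] pa(2) pb(2) by simp
  qed
  have d: "\<delta> \<noteq> pi" "\<delta> \<noteq> - pi" using np by (auto simp: complex_eq_iff)
  have arg: "Arg (b / a) = \<delta> + 2 * pi * k" if "- pi < \<delta> + 2 * pi * k" "\<delta> + 2 * pi * k \<le> pi" for k :: int
  proof (rule Arg_unique)
    have "cis (\<delta> + 2 * pi * k) = cis \<delta>"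
      by (simp add: cis_mult[symmetric] cis_multiple_2pi)
    then show "of_real (rb / ra) * exp (\<i> * of_real (\<delta> + 2 * pi * k)) = b / a"
      using pq(1) by (simp add: cis_conv_exp)
  qed (use that pa(2) pb(2) in auto)
  consider "\<delta> < - pi" | "- pi < \<delta>" "\<delta> < pi" | "pi < \<delta>" using d by linarith
  then show thesis
  proof cases
    case 1
    have "\<alpha> > pi" "\<beta> < pi" using 1 pa(3,4) pb(3,4) by (auto simp: \<delta>_def)
    then have "sin \<alpha> < 0" "0 < sin \<beta>"
      using an sin_sign_Arg2pi[OF pa(3,4)] sin_sign_Arg2pi[OF pb(3,4)] by linarith+
    moreover have "0 < sin \<delta>" using sin_gt_zero[of "\<delta> + 2 * pi"] 1 range by simp
    ultimately have "psign 1 = swsign l a b" using sa sb sab by (simp add: swsign_def sweeps_def)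
    then show ?thesis using that[of 1] arg[of 1] 1 range by (simp add: \<delta>_def \<alpha>_def \<beta>_def)
  next
    case 2
    have "\<not> sweeps l a b"
    proof
      assume "sweeps l a b"
      then consider "sin \<alpha> < 0" "0 < sin \<beta>" "0 < sin \<delta>" | "0 < sin \<alpha>" "sin \<beta> < 0" "sin \<delta> < 0"
        unfolding sweeps_def sa sb sab by blast
      then show False
      proof cases
        case A: 1
        then have "\<delta> < 0" using sin_sign_Arg2pi[OF pa(3,4)] sin_sign_Arg2pi[OF pb(3,4)] by (simp add: \<delta>_def)
        then have "sin (- \<delta>) > 0" using 2 by (intro sin_gt_zero) auto
        then show False using A by simp
      next
        case B: 2
        then have "\<delta> > 0" using sin_sign_Arg2pi[OF pa(3,4)] sin_sign_Arg2pi[OF pb(3,4)] by (simp add: \<delta>_def)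
        then have "sin \<delta> > 0" using 2 by (intro sin_gt_zero) auto
        then show False using B by simp
      qed
    qed
    then show ?thesis using that[of 0] arg[of 0] 2 by (simp add: \<delta>_def \<alpha>_def \<beta>_def swsign_def)
  next
    case 3
    have "\<alpha> < pi" "\<beta> > pi" using 3 pa(3,4) pb(3,4) by (auto simp: \<delta>_def)
    then have "0 < sin \<alpha>" "sin \<beta> < 0"
      using an sin_sign_Arg2pi[OF pa(3,4)] sin_sign_Arg2pi[OF pb(3,4)] by linarith+
    moreover have "sin \<delta> < 0"
      using sin_gt_zero[of "2 * pi - \<delta>"] 3 range by (simp add: sin_diff)
    ultimately have "psign (-1) = swsign l a b" using sa sb sab by (simp add: swsign_def sweeps_def psign_def)
    then show ?thesis using that[of "-1"] arg[of "-1"] 3 range by (simp add: \<delta>_def \<alpha>_def \<beta>_def)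
  qed
qed

text \<open>Both angles exceed \<open>pi\<close>, so their difference lies in
  \<open>(- pi, pi)\<close> and the counterclockwise turn adds a full circle iff the difference is
  negative.\<close>

lemma Arg2pi_turn:
  assumes neg: "cdet l a < 0" "cdet l b < 0"
  shows "Arg2pi (b / a) = Arg2pi (b / l) - Arg2pi (a / l) + 2 * pi * (if cdet a b < 0 then 1 else 0)"
proof -
  have l: "l \<noteq> 0" and a: "a \<noteq> 0" and b: "b \<noteq> 0" using neg by auto
  define \<delta> where "\<delta> = Arg2pi (b / l) - Arg2pi (a / l)"
  note pa = polar_turn[OF l a] and pb = polar_turn[OF l b]
  note pq = polar_quotient[OF l a b, folded \<delta>_def]
  have nl: "0 < (norm l)\<^sup>2" using l by simp
  have "sin (Arg2pi (a / l)) < 0" "sin (Arg2pi (b / l)) < 0"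
    using pa(2,5) pb(2,5) nl neg by (simp_all add: mult_less_0_iff zero_less_mult_iff)
  then have "pi < Arg2pi (a / l)" "pi < Arg2pi (b / l)"
    using sin_sign_Arg2pi(2) pa(3,4) pb(3,4) by blast+
  then have range: "- pi < \<delta>" "\<delta> < pi" using pa(4) pb(4) by (auto simp: \<delta>_def)
  have sab: "cdet a b < 0 \<longleftrightarrow> sin \<delta> < 0"
    using pa(2) pb(2) pq(2) nl by (auto simp: mult_less_0_iff zero_less_mult_iff)
  have "sin \<delta> < 0 \<longleftrightarrow> \<delta> < 0"
  proof
    assume "sin \<delta> < 0"
    then show "\<delta> < 0" using sin_ge_zero[of \<delta>] range by force
  next
    assume "\<delta> < 0"
    then show "sin \<delta> < 0" using sin_gt_zero[of "- \<delta>"] range by simp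
  qed
  with sab have s: "cdet a b < 0 \<longleftrightarrow> \<delta> < 0" by simp
  show ?thesis
  proof (rule Arg2pi_unique)
    have "cis (\<delta> + 2 * pi * (if cdet a b < 0 then 1 else 0)) = cis \<delta>"
      by (simp add: cis_mult[symmetric])
    then show "of_real (norm (b / l) / norm (a / l)) *
       exp (\<i> * of_real (Arg2pi (b / l) - Arg2pi (a / l) + 2 * pi * (if cdet a b < 0 then 1 else 0))) = b / a"
      using pq(1) unfolding \<delta>_def[symmetric] by (simp add: cis_conv_exp)
  qed (use pa(2) pb(2) range s in \<open>auto simp: \<delta>_def\<close>)
qed

context gauge_net
begin

text \<open>An edge folding back onto its predecessor would share with it points other than the
  common vertex.\<close>

lemma not_antiparallel:
  assumes e: "e \<in> edges G" and f: "f \<in> edges G" and ef: "snd e = fst f" and t: "0 < t"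
  shows "evec f \<noteq> (- t) *\<^sub>R evec e"
proof
  assume eq: "evec f = (- t) *\<^sub>R evec e"
  have ne: "e \<noteq> f"
  proof
    assume "e = f"
    then have "snd e = fst e" using ef by simp
    then show False using edge_internal[OF e] by simp
  qed
  \<comment> \<open>\<open>r < 1\<close> keeps the point \<open>x\<close> inside \<open>e\<close>,
    and \<open>r < t\<close> keeps it inside \<open>f\<close>.\<close>
  define r where "r = min (1 / 2) (t / 2)"
  have r: "0 < r" "r < 1" "r < t" using t by (auto simp: r_def)
  define x where "x = snd e - r *\<^sub>R evec e"
  have "x = (1 - (1 - r)) *\<^sub>R fst e + (1 - r) *\<^sub>R snd e" by (simp add: x_def evec_def algebra_simps)
  then have xe: "x \<in> seg e" unfolding seg_def in_segment using r by (intro exI[of _ "1 - r"]) auto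
  have "x = fst f + (r / t) *\<^sub>R evec f" unfolding eq using t by (simp add: x_def ef)
  then have "x = (1 - r / t) *\<^sub>R fst f + (r / t) *\<^sub>R snd f" by (simp add: evec_def algebra_simps)
  then have xf: "x \<in> seg f" unfolding seg_def in_segment using r t by (intro exI[of _ "r / t"]) auto
  have ev0: "evec e \<noteq> 0" using edge_internal[OF e] by (auto simp: evec_def)
  from edges_meet[OF e f ne] xe xf have "x = fst e \<or> x = snd e" by blast
  then show False
  proof
    assume "x = snd e" then show False using r ev0 by (simp add: x_def)
  next
    assume "x = fst e"
    then have "(1 - r) *\<^sub>R evec e = 0" by (simp add: x_def evec_def algebra_simps)
    then show False using r ev0 by simp
  qed
qed

lemma path_total_turning:
  assumes "epath p"
  shows "\<exists>k::int. (\<Sum>m<length p - 1. Arg (evec (p ! Suc m) / evec (p ! m)))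
     = Arg2pi (evec (last p) / l) - Arg2pi (evec (hd p) / l) + 2 * pi * k \<and> psign k = turns p"
  using assms
proof (induction p)
  case (Cons e p)
  have e: "e \<in> edges G" using Cons.prems by (simp add: epath_Cons)
  show ?case
  proof (cases "p = []")
    case True then show ?thesis by (intro exI[of _ 0]) (simp add: turns_def)
  next
    case False
    then have p: "epath p" "snd e = fst (hd p)" using Cons.prems by (auto simp: epath_Cons)
    have h: "hd p \<in> edges G" using p False by (auto intro: epath_in)
    obtain k where k: "(\<Sum>m<length p - 1. Arg (evec (p ! Suc m) / evec (p ! m)))
       = Arg2pi (evec (last p) / l) - Arg2pi (evec (hd p) / l) + 2 * pi * of_int k" "psign k = turns p"
      using Cons.IH[OF p(1)] by blast
    obtain k' where k': "Arg (evec (hd p) / evec e) = Arg2pi (evec (hd p) / l) - Arg2pi (evec e / l) + 2 * pi * of_int k'"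
      "psign k' = swsign l (evec e) (evec (hd p))"
      using Arg_turn[OF l_nonzero[OF e] l_nonzero[OF h] not_antiparallel[OF e h p(2)]] by blast
    obtain m where m: "length p = Suc m" using False by (cases p) auto
    have "(\<Sum>m<length (e # p) - 1. Arg (evec ((e # p) ! Suc m) / evec ((e # p) ! m)))
      = Arg (evec (hd p) / evec e) + (\<Sum>m<length p - 1. Arg (evec (p ! Suc m) / evec (p ! m)))"
      using m False by (simp add: sum.lessThan_Suc_shift hd_conv_nth del: sum.lessThan_Suc)
    then show ?thesis using k k' False
      by (intro exI[of _ "k' + k"]) (simp add: turns_Cons algebra_simps)
  qed
qed (simp add: epath_def)

text \<open>Around the closed curve the angles measured from \<open>l\<close> cancel, leaving
  multiples of \<open>2 * pi\<close> with the parities of the sweeps. Joining the arc at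
  \<open>bv G j\<close> never sweeps, leaving it at \<open>bv G i\<close> may, and the final minus
  one in \<open>Wind\<close> contributes one more sign.\<close>

theorem Wind_sign:
  assumes p: "walk G i j p" and ij: "i < nb G" "j < nb G"
  shows "(-1) powi Wind G i j p = sgn (cdet l (evec (hd p))) * (if i < j then 1 else -1) * turns p"
proof -
  note ends = walk_ends[OF p ij]
  have ep: "epath p" using p by (simp add: walk_epath)
  then have p0: "p \<noteq> []" by (simp add: epath_def)
  have hl: "fst (hd p) = bv G i" "snd (last p) = bv G j" using p by (auto simp: walk_def)
  have lastE: "last p \<in> edges G" and hdE: "hd p \<in> edges G" using ep p0 by (auto intro: epath_in)
  have "j \<notin> sources G" using ends(2) by (simp add: sinks_def)
  then have ne: "i \<noteq> j" using ends(1) by auto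
  define u v where "u = bv G i - centre G" and "v = bv G j - centre G"
  have lu: "cdet l (\<i> * u) < 0" and lv: "cdet l (\<i> * v) < 0" using inward ij by (simp_all add: u_def v_def)
  have el: "inner (evec (last p)) v > 0" using boundary_edge_inward(2)[OF lastE ij(2)] hl by (simp add: v_def)
  have eh: "inner (evec (hd p)) u < 0" using boundary_edge_inward(1)[OF hdE ij(1)] hl by (simp add: u_def)
  have orth: "inner (\<i> * w) w = 0" for w by (simp add: inner_complex_def)
  obtain k1 where k1: "(\<Sum>m<length p - 1. Arg (evec (p ! Suc m) / evec (p ! m)))
     = Arg2pi (evec (last p) / l) - Arg2pi (evec (hd p) / l) + 2 * pi * of_int k1" "psign k1 = turns p"
    using path_total_turning[OF ep] by blast
  have "\<i> * v \<noteq> (- t) *\<^sub>R evec (last p)" if "0 < t" for t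
  proof
    assume "\<i> * v = (- t) *\<^sub>R evec (last p)"
    then have "inner (\<i> * v) v = - t * inner (evec (last p)) v" by simp
    then show False using orth[of v] el that by simp
  qed
  then obtain k2 where k2: "Arg (\<i> * v / evec (last p)) = Arg2pi (\<i> * v / l) - Arg2pi (evec (last p) / l) + 2 * pi * of_int k2"
    "psign k2 = swsign l (evec (last p)) (\<i> * v)"
    using Arg_turn[OF l_nonzero[OF lastE], of "\<i> * v"] lv by (metis less_irrefl)
  have "evec (hd p) \<noteq> (- t) *\<^sub>R (\<i> * u)" if "0 < t" for t
  proof
    assume "evec (hd p) = (- t) *\<^sub>R (\<i> * u)"
    then have "inner (evec (hd p)) u = - t * inner (\<i> * u) u" by simp
    then show False using orth[of u] eh by simp
  qed
  then obtain k4 where k4: "Arg (evec (hd p) / (\<i> * u)) = Arg2pi (evec (hd p) / l) - Arg2pi (\<i> * u / l) + 2 * pi * of_int k4"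
    "psign k4 = swsign l (\<i> * u) (evec (hd p))"
    using Arg_turn[OF _ l_nonzero[OF hdE], of "\<i> * u"] lu by (metis less_irrefl)
  \<comment> \<open>The tangent of the counterclockwise arc from \<open>bv G j\<close> to
    \<open>bv G i\<close> passes over \<open>l\<close> exactly when that arc goes the long way
    round.\<close>
  define k3 :: int where "k3 = (if j < i then 1 else 0)"
  have "cdet (\<i> * v) (\<i> * u) < 0 \<longleftrightarrow> j < i"
  proof -
    have "cdet (\<i> * v) (\<i> * u) = cdet v u" by (simp add: cdet_def inner_complex_def)
    then show ?thesis
      using bv_order(2)[of i j] bv_order(2)[of j i] ij ne cdet_swap[of u v]
      by (cases "j < i") (auto simp: u_def v_def)
  qed
  then have "Arg2pi (u / v) = Arg2pi (\<i> * u / l) - Arg2pi (\<i> * v / l) + 2 * pi * of_int k3"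
    using Arg2pi_turn[OF lv lu] by (simp add: k3_def)
  then have "total_turning G i j p = 2 * pi * of_int (k1 + k2 + k3 + k4)"
    unfolding total_turning_def u_def[symmetric] v_def[symmetric] k1 k2 k4 by (simp add: algebra_simps)
  then have W: "Wind G i j p = k1 + k2 + k3 + k4 - 1" by (simp add: Wind_def)
  have s2: "swsign l (evec (last p)) (\<i> * v) = 1"
    using lv el by (simp add: swsign_def sweeps_def)
  have s4: "swsign l (\<i> * u) (evec (hd p)) = - sgn (cdet l (evec (hd p)))"
    using lu eh l_nonzero[OF hdE] by (auto simp: swsign_def sweeps_def sgn_real_def inner_commute)
  have "psign k3 = (if i < j then 1 else -1)" using ne by (auto simp: k3_def psign_def)
  moreover have "psign (-1) = -1" by (simp add: psign_def)
  ultimately show ?thesis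
    using k1(2) k2(2) k4(2) s2 s4 unfolding psign_powi W diff_conv_add_uminus psign_add by simp
qed

lemma walk_geometric_sign:
  assumes p: "walk G i j p" and ij: "i < nb G" "j < nb G"
  shows "prod_list (map (lam_sign G (geometric_signature G l)) p)
    = - ((-1) ^ card (between i j) * (-1) powi Wind G i j p)"
  using walk_sign[OF assms] Wind_sign[OF assms] by simp

end

section \<open>Existence of gauge directions\<close>

text \<open>The direction opposite to the middle of the arc enters the disc at every boundary
  vertex. A small perturbation avoids the finitely many forbidden directions and preserves this open
  condition.\<close>

lemma (in plabic_net) gauge_direction_exists:
  obtains l where "gauge_direction G l"
proof (cases "nb G = 0")
  case True
  have "\<forall>V\<in>internal G. \<exists>j<nb G. (V, bv G j) \<in> (edges G \<union> (edges G)\<inverse>)\<^sup>*"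
    using graph unfolding plabic_graph_def by (elim conjE)
  then have "internal G = {}" using True by auto
  then have "vertices G = {}" using True by (simp add: vertices_def)
  then have "edges G = {}" using edges_vertices by auto
  then have "gauge_direction G 1" using True by (simp add: gauge_direction_def)
  then show thesis by (rule that)
next
  case False
  obtain \<theta> where \<theta>: "\<And>j. j < nb G \<Longrightarrow> bv G j = centre G + of_real (radius G) * cis (\<theta> j)"
    "\<And>i j. i < j \<Longrightarrow> j < nb G \<Longrightarrow> \<theta> j < \<theta> i \<and> \<theta> i - \<theta> j < pi"
    using arc unfolding clockwise_on_arc_def by blast
  \<comment> \<open>As the arc is shorter than a half circle, all boundary angles are within
    \<open>pi / 2\<close> of its bisector.\<close>
  define \<mu> where "\<mu> = (\<theta> 0 + \<theta> (nb G - 1)) / 2"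
  define l where "l = - cis \<mu>"
  have l0: "l \<noteq> 0" by (simp add: l_def)
  have inw: "inner l (bv G j - centre G) < 0" if j: "j < nb G" for j
  proof -
    have "\<theta> j \<le> \<theta> 0" using \<theta>(2)[of 0 j] j by (cases "j = 0") auto
    moreover have "j = nb G - 1 \<or> j < nb G - 1" using j by linarith
    then have "\<theta> (nb G - 1) \<le> \<theta> j" using \<theta>(2)[of j "nb G - 1"] j by auto
    moreover have "\<theta> 0 - \<theta> (nb G - 1) < pi"
      using \<theta>(2)[of 0 "nb G - 1"] False pi_gt_zero by (cases "nb G = 1") auto
    ultimately have "- (pi / 2) < \<theta> j - \<mu>" "\<theta> j - \<mu> < pi / 2" by (auto simp: \<mu>_def field_simps)
    then have "0 < cos (\<theta> j - \<mu>)" by (rule cos_gt_zero_pi)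
    moreover have "inner l (bv G j - centre G) = - radius G * cos (\<theta> j - \<mu>)"
      using \<theta>(1)[OF j] by (simp add: l_def inner_complex_def cos_diff algebra_simps)
    ultimately show ?thesis using radius_pos by simp
  qed
  let ?l = "\<lambda>t. l + of_real t * (\<i> * l)"
  have ev1: "\<forall>\<^sub>F t in at_right 0. \<forall>v \<in> evec ` edges G \<union> (\<lambda>(V, j). V - bv G j) ` (internal G \<times> {..<nb G}). cdet (?l t) v \<noteq> 0"
  proof (rule eventually_ball_finite)
    show "finite (evec ` edges G \<union> (\<lambda>(V, j). V - bv G j) ` (internal G \<times> {..<nb G}))"
      using finite_internal by auto
    show "\<forall>v \<in> evec ` edges G \<union> (\<lambda>(V, j). V - bv G j) ` (internal G \<times> {..<nb G}).
        \<forall>\<^sub>F t in at_right 0. cdet (?l t) v \<noteq> 0"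
    proof
      fix v assume "v \<in> evec ` edges G \<union> (\<lambda>(V, j). V - bv G j) ` (internal G \<times> {..<nb G})"
      then consider e where "e \<in> edges G" "v = evec e"
        | V j where "V \<in> internal G" "j < nb G" "v = V - bv G j" by auto
      then have "v \<noteq> 0"
      proof cases
        case 1 then show ?thesis using edge_internal[OF 1(1)] by (auto simp: evec_def)
      next
        case 2 then show ?thesis using bv_not_internal[of j] by auto
      qed
      from eventually_generic_direction[OF l0 this]
      show "\<forall>\<^sub>F t in at_right 0. cdet (?l t) v \<noteq> 0" by (rule eventually_mono) blast
    qed
  qed
  have ev2: "\<forall>\<^sub>F t in at_right 0. \<forall>j\<in>{..<nb G}. inner (?l t) (bv G j - centre G) < 0"
  proof (rule eventually_ball_finite, simp, rule ballI)
    fix j assume j: "j \<in> {..<nb G}"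
    have "((\<lambda>t. inner (?l t) (bv G j - centre G)) \<longlongrightarrow> inner (l + of_real 0 * (\<i> * l)) (bv G j - centre G)) (at_right 0)"
      by (intro tendsto_intros)
    then show "\<forall>\<^sub>F t in at_right 0. inner (?l t) (bv G j - centre G) < 0"
      using order_tendstoD(2) inw[of j] j by fastforce
  qed
  obtain t where t: "\<forall>v \<in> evec ` edges G \<union> (\<lambda>(V, j). V - bv G j) ` (internal G \<times> {..<nb G}). cdet (?l t) v \<noteq> 0"
    "\<forall>j\<in>{..<nb G}. inner (?l t) (bv G j - centre G) < 0"
    using eventually_happens'[OF trivial_limit_at_right_real eventually_conj[OF ev1 ev2]] by blast
  have "gauge_direction G (?l t)"
    unfolding gauge_direction_def
  proof (intro conjI allI impI ballI)
    fix j assume j: "j < nb G"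
    define v where "v = bv G j - centre G"
    have nv: "norm v = radius G" using bv_dist[OF j] by (simp add: v_def dist_norm norm_minus_commute)
    have neg: "inner (?l t) v < 0" using t(2) j by (simp add: v_def)
    then have "?l t \<noteq> 0" by auto
    then have nl: "0 < (norm (?l t))\<^sup>2" by simp
    \<comment> \<open>The parameter of the point of the ray nearest to the centre.\<close>
    define r where "r = - inner (?l t) v / (norm (?l t))\<^sup>2"
    have r: "0 < r" using neg nl by (simp add: r_def divide_neg_pos)
    have "r\<^sup>2 * (norm (?l t))\<^sup>2 = - r * inner (?l t) v" using nl by (simp add: r_def power2_eq_square)
    then have "(norm (v + r *\<^sub>R ?l t))\<^sup>2 = (norm v)\<^sup>2 + r * inner (?l t) v"
      unfolding norm_add_scale_sq by simp
    also have "\<dots> < (norm v)\<^sup>2" using r neg by (simp add: mult_pos_neg)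
    finally have "norm (v + r *\<^sub>R ?l t) < norm v" by (rule power_less_imp_less_base) simp
    then have "bv G j + of_real r * ?l t \<in> ball (centre G) (radius G)"
      using nv by (simp add: dist_norm norm_minus_commute v_def scaleR_conv_of_real algebra_simps)
    moreover have "bv G j + of_real r * ?l t \<in> ray (bv G j) (?l t)" using r by (auto simp: ray_def intro: less_imp_le)
    ultimately show "ray (bv G j) (?l t) \<inter> ball (centre G) (radius G) \<noteq> {}" by blast
    show "ray (bv G j) (?l t) \<inter> internal G = {}"
    proof (rule ccontr)
      assume "ray (bv G j) (?l t) \<inter> internal G \<noteq> {}"
      then obtain V s where V: "V \<in> internal G" "V = bv G j + of_real s * ?l t" by (auto simp: ray_def)
      then have "cdet (?l t) (V - bv G j) = 0" by simp
      moreover have "V - bv G j \<in> (\<lambda>(V, j). V - bv G j) ` (internal G \<times> {..<nb G})" using V(1) j by force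
      ultimately show False using t(1) by blast
    qed
  next
    fix e assume "e \<in> edges G"
    then show "orient (?l t) (evec e) \<noteq> 0" using t(1) by (simp add: orient_iff)
  qed
  then show thesis by (rule that)
qed

section \<open>Signs of walks determine signatures\<close>

context plabic_net
begin

definition closed_epath :: "edge list \<Rightarrow> bool" where
  "closed_epath c \<longleftrightarrow> epath c \<and> snd (last c) = fst (hd c)"

lemma closed_epath_split:
  assumes "epath (as @ [x] @ bs @ [x] @ cs)"
  shows "closed_epath (x # bs)" "epath (as @ [x] @ cs)"
  using assms unfolding closed_epath_def epath_def
  by (auto simp: successively_append_iff successively_Cons)

text \<open>Cutting at a repeated edge gives two shorter closed paths whose products multiply to the
  original one.\<close>

lemma closed_epath_prod:
  fixes d :: "edge \<Rightarrow> real"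
  assumes simple: "\<And>c. closed_epath c \<Longrightarrow> distinct c \<Longrightarrow> prod_list (map d c) = 1"
    and c: "closed_epath c"
  shows "prod_list (map d c) = 1"
  using c
proof (induction "length c" arbitrary: c rule: less_induct)
  case less
  show ?case
  proof (cases "distinct c")
    case False
    then obtain as x bs cs where c: "c = as @ [x] @ bs @ [x] @ cs" using not_distinct_decomp by blast
    have 1: "closed_epath (x # bs)" and 2: "epath (as @ [x] @ cs)"
      using closed_epath_split less.prems unfolding c closed_epath_def by blast+
    have "hd (as @ [x] @ cs) = hd c" "last (as @ [x] @ cs) = last c" unfolding c by (auto simp: hd_append)
    then have 3: "closed_epath (as @ [x] @ cs)" using 2 less.prems by (simp add: closed_epath_def)
    have "prod_list (map d (as @ [x] @ cs)) = 1" by (rule less.hyps[OF _ 3]) (simp add: c)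
    moreover have "prod_list (map d (x # bs)) = 1" by (rule less.hyps[OF _ 1]) (simp add: c)
    moreover have "prod_list (map d c) = prod_list (map d (as @ [x] @ cs)) * prod_list (map d (x # bs))"
      unfolding c by (simp add: ac_simps)
    ultimately show ?thesis by simp
  qed (use simple less.prems in blast)
qed

text \<open>The same cut leaves a shorter walk with the same ends and a closed path.\<close>

lemma walk_prod:
  fixes d :: "edge \<Rightarrow> real"
  assumes cycles: "\<And>c. closed_epath c \<Longrightarrow> distinct c \<Longrightarrow> prod_list (map d c) = 1"
    and simple: "\<And>p. walk G i j p \<Longrightarrow> distinct p \<Longrightarrow> prod_list (map d p) = 1"
    and p: "walk G i j p"
  shows "prod_list (map d p) = 1"
  using p
proof (induction "length p" arbitrary: p rule: less_induct)
  case less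
  show ?case
  proof (cases "distinct p")
    case False
    then obtain as x bs cs where c: "p = as @ [x] @ bs @ [x] @ cs" using not_distinct_decomp by blast
    have 1: "closed_epath (x # bs)" and 2: "epath (as @ [x] @ cs)"
      using closed_epath_split less.prems unfolding c walk_epath by blast+
    have "hd (as @ [x] @ cs) = hd p" "last (as @ [x] @ cs) = last p" unfolding c by (auto simp: hd_append)
    then have 3: "walk G i j (as @ [x] @ cs)" using 2 less.prems by (simp add: walk_epath)
    have "prod_list (map d (as @ [x] @ cs)) = 1" by (rule less.hyps[OF _ 3]) (simp add: c)
    moreover have "prod_list (map d (x # bs)) = 1" using closed_epath_prod[OF cycles 1] by blast
    moreover have "prod_list (map d p) = prod_list (map d (as @ [x] @ cs)) * prod_list (map d (x # bs))"
      unfolding c by (simp add: ac_simps)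
    ultimately show ?thesis by simp
  qed (use simple less.prems in blast)
qed

definition reaches :: "edge list \<Rightarrow> complex \<Rightarrow> bool" where
  "reaches q V \<longleftrightarrow> epath q \<and> (\<exists>i. i < nb G \<and> fst (hd q) = bv G i) \<and> snd (last q) = V"

lemma internal_reached:
  assumes "V \<in> internal G"
  obtains q where "reaches q V"
proof -
  have "in_edges G V \<noteq> {}"
  proof (cases "V \<in> black G")
    case True
    then show ?thesis using black_out[OF True] internal_degree[OF assms] card_edges_at[of V] by auto
  next
    case False
    then have "V \<in> white G" using assms by (simp add: white_def)
    then show ?thesis using white_in by force
  qed
  then obtain e where e: "e \<in> edges G" "snd e = V" by (auto simp: in_edges_def)
  obtain i j p q where "i \<in> sources G" "epath p" "hd p = boundary_edge G i" "last p = e"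
    using edge_reachable[OF e(1)] by metis
  then have "reaches p V" using e(2) source_edge[of i] unfolding reaches_def by auto
  then show thesis by (rule that)
qed

lemma reaches_continue:
  assumes q: "reaches q V" and V: "V \<in> internal G"
  obtains r j where "j < nb G" "epath r" "fst (hd r) = V" "snd (last r) = bv G j"
proof -
  have ep: "epath q" and V': "snd (last q) = V" using q by (auto simp: reaches_def)
  have e: "last q \<in> edges G" using ep by (auto simp: epath_def)
  obtain i j p r where j: "j \<in> sinks G" and r: "epath r" "hd r = last q" "last r = boundary_edge G j"
    using edge_reachable[OF e] by metis
  have "tl r \<noteq> []"
  proof
    assume "tl r = []"
    then have "last r = hd r" using r(1) by (cases r) (auto simp: epath_def)
    then have "V = bv G j" using r V' sink_edge[OF j] by simp
    then show False using V bv_not_internal sink_edge(1)[OF j] by blast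
  qed
  moreover obtain e' where "r = e' # tl r" using r(1) by (cases r) (auto simp: epath_def)
  ultimately have "epath (tl r)" "fst (hd (tl r)) = V" "last (tl r) = boundary_edge G j"
    using r V' epath_Cons[of e' "tl r"] by (metis list.sel(1), metis list.sel(1), metis last_tl)
  then show thesis using that[of j "tl r"] sink_edge[OF j] by simp
qed

text \<open>Both paths extend to boundary walks by the same continuation \<open>r\<close>, so both
  products are inverse to the product along \<open>r\<close>.\<close>

lemma reaches_prod_unique:
  fixes d :: "edge \<Rightarrow> real"
  assumes d: "\<And>i j p. i < nb G \<Longrightarrow> j < nb G \<Longrightarrow> walk G i j p \<Longrightarrow> prod_list (map d p) = 1"
    and q: "reaches q V" "reaches q' V" and V: "V \<in> internal G"
  shows "prod_list (map d q) = prod_list (map d q')"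
proof -
  obtain r j where r: "j < nb G" "epath r" "fst (hd r) = V" "snd (last r) = bv G j"
    using reaches_continue[OF q(1) V] .
  have "prod_list (map d q) * prod_list (map d r) = 1" if q: "reaches q V" for q
  proof -
    obtain i where i: "epath q" "i < nb G" "fst (hd q) = bv G i" "snd (last q) = V"
      using q by (auto simp: reaches_def)
    have ne: "q \<noteq> []" "r \<noteq> []" using i(1) r(2) by (auto simp: epath_def)
    then have "walk G i j (q @ r)" using i r by (simp add: walk_epath epath_append)
    from d[OF i(2) r(1) this] show ?thesis by simp
  qed
  from this[OF q(1)] this[OF q(2)] show ?thesis by (metis mult.commute mult_cancel_left zero_neq_one mult_zero_left)
qed

lemma reaches_snoc:
  assumes "reaches q (fst e)" "e \<in> edges G"
  shows "reaches (q @ [e]) (snd e)"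
proof -
  have "q \<noteq> []" using assms(1) by (auto simp: reaches_def epath_def)
  then show ?thesis using assms by (auto simp: reaches_def epath_append epath_Cons)
qed

theorem equivalent_signaturesI:
  assumes walks: "\<And>i j p. i < nb G \<Longrightarrow> j < nb G \<Longrightarrow> walk G i j p \<Longrightarrow>
      prod_list (map (lam_sign G \<epsilon>) p) = prod_list (map (lam_sign G \<epsilon>') p)"
  shows "equivalent_signatures G \<epsilon> \<epsilon>'"
proof -
  \<comment> \<open>The ratio of the two signs; the contributions of white tails cancel.\<close>
  define d where "d e = ((-1) ^ (\<epsilon> e + \<epsilon>' e) :: real)" for e
  have d_eq: "d e = lam_sign G \<epsilon> e * lam_sign G \<epsilon>' e" for e
    by (simp add: d_def lam_sign_def power_add)
  have sq: "prod_list (map (lam_sign G \<epsilon>) p) * prod_list (map (lam_sign G \<epsilon>) p) = 1" for p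
    by (induction p) (auto simp: lam_sign_def minus_one_power_iff algebra_simps)
  have d: "prod_list (map d p) = 1" if "i < nb G" "j < nb G" "walk G i j p" for i j p
  proof -
    have "prod_list (map d p) = prod_list (map (lam_sign G \<epsilon>) p) * prod_list (map (lam_sign G \<epsilon>') p)"
      unfolding d_eq by (induction p) auto
    then show ?thesis using walks[OF that] sq[of p] by simp
  qed
  \<comment> \<open>A potential for \<open>d\<close>: the value does not depend on the path from the
    boundary, and it serves as the gauge transformation.\<close>
  define D where "D V = prod_list (map d (SOME q. reaches q V))" for V
  have D: "prod_list (map d q) = D V" if "reaches q V" "V \<in> internal G" for q V
    unfolding D_def by (rule reaches_prod_unique[OF d that(1) _ that(2)]) (auto intro: someI that(1))
  have unit: "prod_list (map d q) = 1 \<or> prod_list (map d q) = -1" for q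
    by (induction q) (auto simp: d_def minus_one_power_iff)
  define \<eta> :: "complex \<Rightarrow> nat" where "\<eta> V = (if D V = 1 then 0 else 1)" for V
  have \<eta>: "D V = (-1) ^ \<eta> V" for V using unit[of "SOME q. reaches q V"] by (auto simp: \<eta>_def D_def)
  have parity: "even a \<longleftrightarrow> even b" if "(-1::real) ^ a = (-1) ^ b" for a b :: nat
    using that by (auto simp: minus_one_power_iff split: if_splits)
  show ?thesis
    unfolding equivalent_signatures_def
  proof (intro exI[of _ \<eta>] conjI)
    show "\<forall>V\<in>internal G. \<eta> V \<in> {0, 1}" by (simp add: \<eta>_def)
    show "\<forall>(U, V)\<in>edges G. U \<in> internal G \<and> V \<in> internal G \<longrightarrow>
        \<epsilon>' (U, V) mod 2 = (\<epsilon> (U, V) + \<eta> U + \<eta> V) mod 2"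
    proof clarify
      fix U V assume e: "(U, V) \<in> edges G" and int: "U \<in> internal G" "V \<in> internal G"
      obtain q where q: "reaches q U" using internal_reached[OF int(1)] .
      have "reaches (q @ [(U, V)]) V" using reaches_snoc[of q "(U, V)"] q e by simp
      from D[OF this int(2)] D[OF q int(1)] have "D V = D U * d (U, V)" by simp
      then have "(-1::real) ^ \<eta> V = (-1) ^ (\<eta> U + (\<epsilon> (U, V) + \<epsilon>' (U, V)))"
        unfolding \<eta> d_def by (simp add: power_add)
      from parity[OF this] show "\<epsilon>' (U, V) mod 2 = (\<epsilon> (U, V) + \<eta> U + \<eta> V) mod 2"
        by (auto simp: mod2_eq_if)
    qed
    show "\<forall>(U, V)\<in>edges G. U \<in> internal G \<and> V \<notin> internal G \<longrightarrow>
        \<epsilon>' (U, V) mod 2 = (\<epsilon> (U, V) + \<eta> U) mod 2"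
    proof clarify
      fix U V assume e: "(U, V) \<in> edges G" and int: "U \<in> internal G" "V \<notin> internal G"
      obtain q where q: "reaches q U" using internal_reached[OF int(1)] .
      obtain j where j: "j < nb G" "V = bv G j" using vertex_cases[OF e, of V] int(2) by auto
      have "reaches (q @ [(U, V)]) V" using reaches_snoc[of q "(U, V)"] q e by simp
      then obtain i where i: "i < nb G" "walk G i j (q @ [(U, V)])" using j by (auto simp: reaches_def walk_epath)
      from d[OF i(1) j(1) i(2)] D[OF q int(1)] have "D U * d (U, V) = 1" by simp
      then have "(-1::real) ^ (\<eta> U + (\<epsilon> (U, V) + \<epsilon>' (U, V))) = (-1) ^ 0"
        unfolding \<eta> d_def by (simp add: power_add)
      from parity[OF this] show "\<epsilon>' (U, V) mod 2 = (\<epsilon> (U, V) + \<eta> U) mod 2"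
        by (auto simp: mod2_eq_if)
    qed
    show "\<forall>(U, V)\<in>edges G. U \<notin> internal G \<and> V \<in> internal G \<longrightarrow>
        \<epsilon>' (U, V) mod 2 = (\<epsilon> (U, V) + \<eta> V) mod 2"
    proof clarify
      fix U V assume e: "(U, V) \<in> edges G" and int: "U \<notin> internal G" "V \<in> internal G"
      obtain i where i: "i < nb G" "U = bv G i" using vertex_cases[OF e, of U] int(1) by auto
      have "reaches [(U, V)] V" using i e by (auto simp: reaches_def epath_Cons)
      from D[OF this int(2)] have "D V = d (U, V)" by simp
      then have "(-1::real) ^ \<eta> V = (-1) ^ (\<epsilon> (U, V) + \<epsilon>' (U, V))" unfolding \<eta> d_def .
      from parity[OF this] show "\<epsilon>' (U, V) mod 2 = (\<epsilon> (U, V) + \<eta> V) mod 2"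
        by (auto simp: mod2_eq_if)
    qed
  qed
qed

end

section \<open>The boundary measurement series\<close>

context signed_net
begin

text \<open>The matrix \<open>tmat\<close> with the weights replaced by formal variables.\<close>

definition smat :: "edge \<Rightarrow> edge \<Rightarrow> edge mseries" where
  "smat e f = (if e = f then 1 else 0) - (if snd e = fst f then mlin (s f) f else 0)"

text \<open>The monomial records the edges after \<open>e\<close> only, as \<open>cof\<close> does;
  the empty continuation occurs when \<open>e\<close> is already the last edge.\<close>

definition continuations :: "nat \<Rightarrow> edge \<Rightarrow> edge multiset \<Rightarrow> edge list set" where
  "continuations j e m = {q. mset q = m \<and> epath (e # q) \<and> last (e # q) = boundary_edge G j}"

definition cont_series :: "nat \<Rightarrow> edge \<Rightarrow> edge mseries" where
  "cont_series j e = mser (\<lambda>m. \<Sum>q\<in>continuations j e m. prod_list (map s q))"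

lemma finite_mset_eq: "finite {q. mset q = m}"
proof (rule finite_subset)
  show "{q. mset q = m} \<subseteq> {q. set q \<subseteq> set_mset m \<and> length q = size m}" by auto
  show "finite {q. set q \<subseteq> set_mset m \<and> length q = size m}" by (rule finite_lists_length_eq) simp
qed

lemma finite_continuations [simp]: "finite (continuations j e m)"
  by (rule finite_subset[OF _ finite_mset_eq[of m]]) (auto simp: continuations_def)

lemma continuations_Cons:
  assumes e: "e \<in> edges G" and f: "f \<in> edges G" "fst f = snd e"
  shows "{q \<in> continuations j e m. q \<noteq> [] \<and> hd q = f}
    = (if f \<in># m then (#) f ` continuations j f (m - {#f#}) else {})"
proof (intro equalityI subsetI)
  fix q assume q: "q \<in> {q \<in> continuations j e m. q \<noteq> [] \<and> hd q = f}"
  then obtain q' where q': "q = f # q'" by (cases q) auto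
  from q have 1: "mset (f # q') = m" "epath (e # f # q')" "last (e # f # q') = boundary_edge G j"
    unfolding q' by (simp_all add: continuations_def)
  then have "f \<in># m" "mset q' = m - {#f#}" by auto
  moreover have "epath (f # q')" using 1(2) by (simp add: epath_Cons)
  ultimately show "q \<in> (if f \<in># m then (#) f ` continuations j f (m - {#f#}) else {})"
    using 1(3) q' by (simp add: continuations_def)
next
  fix q assume q: "q \<in> (if f \<in># m then (#) f ` continuations j f (m - {#f#}) else {})"
  then have fm: "f \<in># m" by (auto split: if_splits)
  with q obtain q' where q': "q = f # q'" "q' \<in> continuations j f (m - {#f#})" by auto
  then have 1: "mset q' = m - {#f#}" "epath (f # q')" "last (f # q') = boundary_edge G j"
    by (simp_all add: continuations_def)
  have "mset (f # q') = m" using 1(1) fm by simp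
  moreover have "epath (e # f # q')" using 1(2) e f by (simp add: epath_Cons)
  ultimately show "q \<in> {q \<in> continuations j e m. q \<noteq> [] \<and> hd q = f}"
    using 1(3) q'(1) by (simp add: continuations_def)
qed

lemma cont_series_rec:
  assumes e: "e \<in> edges G"
  shows "cont_series j e = (if e = boundary_edge G j then 1 else 0)
    + (\<Sum>f | f \<in> edges G \<and> fst f = snd e. mlin (s f) f * cont_series j f)"
proof (rule mseries_eqI)
  fix m
  let ?F = "{f. f \<in> edges G \<and> fst f = snd e}" and ?Q = "continuations j e m"
  let ?g = "\<lambda>q. prod_list (map s q)"
  let ?A = "{q \<in> ?Q. q = []}" and ?B = "{q \<in> ?Q. q \<noteq> []}"
  have "coef (cont_series j e) m = sum ?g (?A \<union> ?B)"
    unfolding cont_series_def coef_mser by (rule sum.cong) auto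
  also have "\<dots> = sum ?g ?A + sum ?g ?B" by (rule sum.union_disjoint) auto
  also have "sum ?g ?A = coef (if e = boundary_edge G j then 1 else 0) m"
  proof -
    have "?A = (if e = boundary_edge G j \<and> m = {#} then {[]} else {})"
      using e by (auto simp: continuations_def epath_Cons)
    then show ?thesis by auto
  qed
  also have "sum ?g ?B = (\<Sum>f\<in>?F. \<Sum>q | q \<in> ?B \<and> hd q = f. ?g q)"
  proof (rule sum.group[symmetric])
    show "hd ` ?B \<subseteq> ?F"
    proof
      fix f assume "f \<in> hd ` ?B"
      then obtain q where "q \<in> ?Q" "q \<noteq> []" "f = hd q" by blast
      then show "f \<in> ?F" by (cases q) (auto simp: continuations_def epath_Cons)
    qed
  qed auto
  also have "\<dots> = (\<Sum>f\<in>?F. coef (mlin (s f) f * cont_series j f) m)"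
  proof (rule sum.cong[OF refl])
    fix f assume f: "f \<in> ?F"
    have "{q. q \<in> ?B \<and> hd q = f} = (if f \<in># m then (#) f ` continuations j f (m - {#f#}) else {})"
      using continuations_Cons[OF e, of f j m] f by (simp add: conj_assoc)
    then have "(\<Sum>q | q \<in> ?B \<and> hd q = f. ?g q)
       = (if f \<in># m then sum ?g ((#) f ` continuations j f (m - {#f#})) else 0)" by simp
    also have "\<dots> = coef (mlin (s f) f * cont_series j f) m"
      unfolding coef_mlin_mult cont_series_def coef_mser
      by (simp add: sum.reindex sum_distrib_left)
    finally show "(\<Sum>q | q \<in> ?B \<and> hd q = f. ?g q) = coef (mlin (s f) f * cont_series j f) m" .
  qed
  finally show "coef (cont_series j e) m = coef ((if e = boundary_edge G j then 1 else 0)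
    + (\<Sum>f | f \<in> edges G \<and> fst f = snd e. mlin (s f) f * cont_series j f)) m"
    by (simp add: coef_sum)
qed

lemma smat_cont_series:
  assumes e: "e \<in> edges G"
  shows "(\<Sum>f\<in>edges G. smat e f * cont_series j f) = (if e = boundary_edge G j then 1 else 0)"
proof -
  have "(\<Sum>f\<in>edges G. smat e f * cont_series j f)
    = (\<Sum>f\<in>edges G. (if e = f then cont_series j f else 0) - (if fst f = snd e then mlin (s f) f * cont_series j f else 0))"
    by (intro sum.cong) (auto simp: smat_def algebra_simps)
  also have "\<dots> = cont_series j e - (\<Sum>f\<in>edges G. if fst f = snd e then mlin (s f) f * cont_series j f else 0)"
    using e by (simp add: sum_subtractf)
  also have "(\<Sum>f\<in>edges G. if fst f = snd e then mlin (s f) f * cont_series j f else 0)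
    = (\<Sum>f | f \<in> edges G \<and> fst f = snd e. mlin (s f) f * cont_series j f)"
    by (simp add: sum.inter_filter)
  finally show ?thesis by (subst (asm) cont_series_rec[OF e]) simp
qed

lemma is_mpoly_smat: "is_mpoly (smat e f)"
  unfolding smat_def diff_conv_add_uminus by (intro is_mpoly_add is_mpoly_uminus) auto

lemma mval_smat: "mval w (smat e f) = tmat w e f"
  unfolding smat_def tmat_def diff_conv_add_uminus
  by (subst mval_add) (auto simp: mval_uminus is_mpoly_uminus)

text \<open>The assumption \<open>sign\<close> makes the coefficients multiplicative along walks, so
  the series solves a linear system. Cramer's rule over the series ring then exhibits it as a
  quotient of polynomials with denominator of value \<open>gdet w\<close>.\<close>

lemma walk_series_value:
  assumes g: "gdet w \<noteq> 0" and i: "i \<in> sources G" and j: "j \<in> sinks G"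
    and sign: "\<And>p. walk G i j p \<Longrightarrow> (-1) powi Wind G i j p = c * prod_list (map s p)"
  shows "boundary_measurement G w i j
    = c * s (boundary_edge G i) * w (boundary_edge G i) * cof (boundary_edge G i) (boundary_edge G j) w / gdet w"
proof -
  let ?a = "boundary_edge G i" and ?b = "boundary_edge G j"
  have a: "?a \<in> edges G" using source_edge[OF i] by simp
  define P0 where "P0 = set_det (edges G) (\<lambda>e f. if f = ?a then (if e = ?b then 1 else 0) else smat e f)"
  define Q where "Q = set_det (edges G) smat"
  have cr: "P0 = Q * cont_series j ?a"
    unfolding P0_def Q_def by (rule set_det_cramer[OF finite_edges smat_cont_series a])
  have Qv: "is_mpoly Q \<and> mval w Q = gdet w"
    using mval_set_det[OF finite_edges, of smat w] is_mpoly_smat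
    unfolding Q_def gdet_def mval_smat by blast
  have Pv: "is_mpoly P0 \<and> mval w P0 = cof ?a ?b w"
  proof -
    have m: "is_mpoly (if f = ?a then (if e = ?b then 1 else 0) else smat e f)" for e f
      using is_mpoly_smat by simp
    have "mval w P0 = set_det (edges G) (\<lambda>e f. mval w (if f = ?a then (if e = ?b then 1 else 0) else smat e f))"
      using mval_set_det[OF finite_edges, of "\<lambda>e f. if f = ?a then (if e = ?b then 1 else 0) else smat e f" w] m
      unfolding P0_def by blast
    also have "\<dots> = cof ?a ?b w"
      unfolding cof_def by (rule set_det_cong[OF finite_edges]) (simp add: mval_smat)
    finally show ?thesis
      using mval_set_det[OF finite_edges, of "\<lambda>e f. if f = ?a then (if e = ?b then 1 else 0) else smat e f" w] m
      unfolding P0_def by blast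
  qed
  \<comment> \<open>Each walk consists of the source edge and a continuation of it.\<close>
  have S: "mser (walk_series G i j) = mlin (c * s ?a) ?a * cont_series j ?a"
  proof (rule mseries_eqI)
    fix m
    have set: "{p. walk G i j p \<and> mset p = m} = (if ?a \<in># m then (#) ?a ` continuations j ?a (m - {#?a#}) else {})"
    proof (intro equalityI subsetI)
      fix p assume p: "p \<in> {p. walk G i j p \<and> mset p = m}"
      then have w: "walk G i j p" by simp
      have "hd p = ?a" "last p = ?b" "epath p"
        using walk_ends(3,4)[OF w] source_edge(1)[OF i] sink_edge(1)[OF j] w by (auto simp: walk_epath)
      moreover from this(3) obtain f q where q: "p = f # q" by (cases p) (auto simp: epath_def)
      ultimately have 1: "p = ?a # q" "epath (?a # q)" "last (?a # q) = ?b" by simp_all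
      moreover have "mset (?a # q) = m" using p 1(1) by simp
      then have "?a \<in># m" "mset q = m - {#?a#}" by auto
      ultimately show "p \<in> (if ?a \<in># m then (#) ?a ` continuations j ?a (m - {#?a#}) else {})"
        by (simp add: continuations_def)
    next
      fix p assume p: "p \<in> (if ?a \<in># m then (#) ?a ` continuations j ?a (m - {#?a#}) else {})"
      then have am: "?a \<in># m" by (auto split: if_splits)
      with p obtain q where q: "p = ?a # q" "q \<in> continuations j ?a (m - {#?a#})" by auto
      then have 1: "mset q = m - {#?a#}" "epath p" "last p = ?b" "hd p = ?a"
        by (simp_all add: continuations_def)
      have "mset p = m" using 1(1) q(1) am by simp
      moreover have "walk G i j p"
        using 1 source_edge(3)[OF i] sink_edge(3)[OF j] by (simp add: walk_epath)
      ultimately show "p \<in> {p. walk G i j p \<and> mset p = m}" by simp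
    qed
    have "coef (mser (walk_series G i j)) m = (\<Sum>p | walk G i j p \<and> mset p = m. c * prod_list (map s p))"
      unfolding coef_mser walk_series_def by (rule sum.cong) (auto simp: sign)
    also have "\<dots> = coef (mlin (c * s ?a) ?a * cont_series j ?a) m"
      unfolding set coef_mlin_mult cont_series_def coef_mser
      by (simp add: sum.reindex sum_distrib_left ac_simps)
    finally show "coef (mser (walk_series G i j)) m = coef (mlin (c * s ?a) ?a * cont_series j ?a) m" .
  qed
  have "series_has_value (walk_series G i j) w (c * s ?a * w ?a * cof ?a ?b w / gdet w)"
    unfolding series_has_value_iff
  proof (intro exI conjI)
    show "is_mpoly (mlin (c * s ?a) ?a * P0)" using Pv by (intro is_mpoly_mult) auto
    show "is_mpoly Q" "mval w Q \<noteq> 0" using Qv g by auto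
    show "mlin (c * s ?a) ?a * P0 = Q * mser (walk_series G i j)"
      unfolding S cr by (simp add: ac_simps)
    show "c * s ?a * w ?a * cof ?a ?b w / gdet w = mval w (mlin (c * s ?a) ?a * P0) / mval w Q"
      using Pv Qv by (simp add: mval_mult)
  qed
  then show ?thesis
    unfolding boundary_measurement_def using series_value_unique by (intro the_equality) auto
qed

end

section \<open>Lam's signature theorem\<close>

context lam_net
begin

lemma lam_matrix_carrier: "lam_matrix G z \<in> carrier_mat (card (sources G)) (nb G)"
  by (rule carrier_matI) (simp_all add: lam_matrix_def)

lemma lam_matrix_index:
  assumes z: "lam_solution G w \<epsilon> (unit_vec (nb G)) z" and r: "r < card (sources G)" and c: "c < nb G"
  shows "lam_matrix G z $$ (r, c) = (if c = pick (sources G) r then 1 else 0)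
    - z (bv G (pick (sources G) r), boundary_edge G (pick (sources G) r)) $ c"
proof -
  let ?i = "pick (sources G) r"
  have i: "?i \<in> sources G" using card_less_pick[OF finite_sources r] by simp
  have nth: "sorted_list_of_set (sources G) ! r = ?i" by (rule sorted_list_nth_pick[OF finite_sources r])
  have e: "boundary_edge G ?i \<in> edges G" "fst (boundary_edge G ?i) = bv G ?i" using source_edge[OF i] by auto
  have "z (bv G ?i, boundary_edge G ?i) \<in> carrier_vec (nb G)"
    using lam_solution_closed(2)[OF z e(1)] e(2) by simp
  then show ?thesis
    using r c nth source_edge(1)[OF i] by (simp add: lam_matrix_def mat_of_rows_def)
qed

lemma pick_rank: "i \<in> sources G \<Longrightarrow> pick (sources G) (card {a \<in> sources G. a < i}) = i"
  by (rule pick_card_in_set)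

lemma rank_less: "i \<in> sources G \<Longrightarrow> card {a \<in> sources G. a < i} < card (sources G)"
  by (rule psubset_card_mono) auto

lemma lam_matrix_sink:
  assumes g: "gdet w \<noteq> 0" and z: "lam_solution G w \<epsilon> (unit_vec (nb G)) z"
    and i: "i \<in> sources G" and c: "c < nb G"
  shows "lam_matrix G z $$ (card {a \<in> sources G. a < i}, c) = (if c \<in> sinks G then
     - (lam_sign G \<epsilon> (boundary_edge G i) * w (boundary_edge G i) * cof (boundary_edge G i) (boundary_edge G c) w / gdet w)
     else if c = i then 1 else 0)"
proof -
  have "i \<notin> sinks G" using i by (simp add: sinks_def)
  then show ?thesis
    unfolding lam_matrix_index[OF z rank_less[OF i] c] pick_rank[OF i] lam_solution_value[OF g z i c] by auto
qed

text \<open>The sign for which exchanging column \<open>i\<close> for \<open>j\<close> yields a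
  minor equal to \<open>tnn_sign i j\<close> times the source weight times
  \<open>cof / gdet\<close>.\<close>

definition tnn_sign :: "nat \<Rightarrow> nat \<Rightarrow> real" where
  "tnn_sign i j = - ((-1) ^ card (between i j)) * lam_sign G \<epsilon> (boundary_edge G i)"

lemma tnn_cof_nonneg:
  assumes tnn: "AE w in weight_measure G. positive_weights G w \<longrightarrow>
      (\<forall>z. lam_solution G w \<epsilon> (unit_vec (nb G)) z \<longrightarrow> totally_nonnegative (lam_matrix G z))"
    and i: "i \<in> sources G" and j: "j \<in> sinks G" and w: "\<And>e. e \<in> edges G \<Longrightarrow> 0 < w e"
  shows "0 \<le> tnn_sign i j * cof (boundary_edge G i) (boundary_edge G j) w * gdet w"
proof (rule AE_polyfun_nonneg[OF finite_edges _ _ w])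
  let ?a = "boundary_edge G i" and ?b = "boundary_edge G j"
  show "polyfun (edges G) (\<lambda>w. tnn_sign i j * cof ?a ?b w * gdet w)"
    by (intro polyfun.mult polyfun.const polyfun_cof polyfun_gdet)
  show "AE w in PiM (edges G) (\<lambda>_. lborel). (\<forall>a\<in>edges G. 0 < w a) \<longrightarrow> 0 \<le> tnn_sign i j * cof ?a ?b w * gdet w"
    using tnn unfolding weight_measure_def
  proof eventually_elim
    case (elim w)
    show ?case
    proof
      assume pos: "\<forall>a\<in>edges G. 0 < w a"
      show "0 \<le> tnn_sign i j * cof ?a ?b w * gdet w"
      proof (cases "gdet w = 0")
        case g: False
        have "unit_vec (nb G) \<in> sinks G \<rightarrow> carrier_vec (nb G)" by auto
        then obtain z where z: "lam_solution G w \<epsilon> (unit_vec (nb G)) z"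
          using lam_solution_exists[OF g] by blast
        have T: "totally_nonnegative (lam_matrix G z)"
          using elim pos z by (simp add: positive_weights_def)
        let ?I = "sources G" and ?A = "lam_matrix G z"
        have jn: "j < nb G" "j \<notin> ?I" using j by (auto simp: sinks_def)
        have In: "?I \<subseteq> {..<nb G}" by (auto simp: sources_def)
        have minor: "det (submatrix ?A UNIV (insert j (?I - {i})))
          = (-1) ^ card {s \<in> ?I. min i j < s \<and> s < max i j} * ?A $$ (card {a \<in> ?I. a < i}, j)"
        proof (rule exchange_minor[OF finite_sources lam_matrix_carrier In _ i jn])
          fix r c assume r: "r < card ?I" and c: "c \<in> ?I"
          let ?k = "pick ?I r"
          have k: "?k \<in> ?I" using card_less_pick[OF finite_sources r] by simp
          have "c < nb G" "c \<notin> sinks G" using c by (auto simp: sources_def sinks_def)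
          then show "?A $$ (r, c) = (if c = ?k then 1 else 0)"
            using lam_matrix_index[OF z r] lam_solution_value[OF g z k] by simp
        qed
        have "insert j (?I - {i}) \<subseteq> {..<dim_col ?A}" using In jn lam_matrix_carrier[of z] by auto
        moreover have "card (insert j (?I - {i})) = dim_row ?A"
        proof -
          have "card (insert j (?I - {i})) = Suc (card (?I - {i}))" using jn by simp
          also have "\<dots> = card ?I" using i by (intro card.remove[symmetric]) auto
          finally show ?thesis using lam_matrix_carrier[of z] by auto
        qed
        ultimately have "0 \<le> det (submatrix ?A UNIV (insert j (?I - {i})))"
          using T by (simp add: totally_nonnegative_def)
        then have "0 \<le> (-1) ^ card (between i j) *
            - (lam_sign G \<epsilon> ?a * w ?a * cof ?a ?b w / gdet w)"
          unfolding minor between_def[symmetric] lam_matrix_sink[OF g z i jn(1)] using j by simp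
        \<comment> \<open>This positive factor clears the denominator and the source weight, which
          makes the inequality polynomial and lets it extend from almost all to all positive
          weights.\<close>
        moreover have "0 \<le> (gdet w)\<^sup>2 / w ?a" using pos source_edge(2)[OF i] by (simp add: less_imp_le)
        ultimately have "0 \<le> ((-1) ^ card (between i j) * - (lam_sign G \<epsilon> ?a * w ?a * cof ?a ?b w / gdet w))
            * ((gdet w)\<^sup>2 / w ?a)"
          by (rule mult_nonneg_nonneg)
        also have "\<dots> = tnn_sign i j * cof ?a ?b w * gdet w"
        proof -
          have "w ?a \<noteq> 0" using pos source_edge(2)[OF i] by force
          then show ?thesis using g by (simp add: tnn_sign_def power2_eq_square)
        qed
        finally show ?thesis .
      qed simp
    qed
  qed
qed

end

locale tnn_net = lam_net +
  assumes tnn: "AE w in weight_measure G. positive_weights G w \<longrightarrow>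
      (\<forall>z. lam_solution G w \<epsilon> (unit_vec (nb G)) z \<longrightarrow> totally_nonnegative (lam_matrix G z))"

sublocale tnn_net \<subseteq> positive_net G "lam_sign G \<epsilon>" tnn_sign
proof
  show "tnn_sign i j = 1 \<or> tnn_sign i j = -1" for i j
    using s_unit[of "boundary_edge G i"] by (auto simp: tnn_sign_def minus_one_power_iff)
  show "0 \<le> tnn_sign i j * cof (boundary_edge G i) (boundary_edge G j) w * gdet w"
    if "i \<in> sources G" "j \<in> sinks G" "\<And>e. 0 < w e" for i j w
    by (rule tnn_cof_nonneg[OF tnn that(1,2)]) (rule that(3))
qed

context tnn_net
begin

text \<open>The product of the two sign functions is 1 on simple cycles, where both are -1, and on
  simple walks, where both depend only on the ends; \<open>walk_prod\<close> extends this to all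
  walks.\<close>

lemma walk_sign_geometric:
  assumes l: "gauge_direction G l" and ij: "i < nb G" "j < nb G" and p: "walk G i j p"
  shows "prod_list (map (lam_sign G \<epsilon>) p) = prod_list (map (lam_sign G (geometric_signature G l)) p)"
proof -
  interpret gauge_net G l by unfold_locales (rule l)
  define d where "d e = lam_sign G \<epsilon> e * lam_sign G (geometric_signature G l) e" for e
  have dp: "prod_list (map d q) = prod_list (map (lam_sign G \<epsilon>) q) * prod_list (map (lam_sign G (geometric_signature G l)) q)" for q
    unfolding d_def by (induction q) auto
  have "prod_list (map d p) = 1"
  proof (rule walk_prod[OF _ _ p])
    fix c assume "closed_epath c" "distinct c"
    then have "prod_list (map (lam_sign G \<epsilon>) c) = -1" "prod_list (map (lam_sign G (geometric_signature G l)) c) = -1"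
      using simple_cycle_sign cycle_geometric_sign by (auto simp: closed_epath_def)
    then show "prod_list (map d c) = 1" unfolding dp by simp
  next
    fix q assume q: "walk G i j q" "distinct q"
    have "prod_list (map (lam_sign G \<epsilon>) q) = - ((-1) ^ card (between i j))"
      using simple_path_sign[OF q ij] s_unit[of "boundary_edge G i"] by (auto simp: tnn_sign_def)
    moreover have "prod_list (map (lam_sign G (geometric_signature G l)) q) = - ((-1) ^ card (between i j))"
      by (rule simple_walk_geometric_sign[OF q ij])
    ultimately show "prod_list (map d q) = 1" unfolding dp by (simp flip: power_mult_distrib)
  qed
  then have "prod_list (map (lam_sign G \<epsilon>) p) * prod_list (map (lam_sign G (geometric_signature G l)) p) = 1"
    unfolding dp .
  then show ?thesis using sign_prod_unit[of p] by auto
qed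

lemma positive_gdet: "positive_weights G w \<Longrightarrow> gdet w \<noteq> 0"
  using gdet_ge_1[of w] by (auto simp: positive_weights_def less_imp_le)

theorem lam_matrix_boundary_measurement:
  assumes w: "positive_weights G w" and z: "lam_solution G w \<epsilon> (unit_vec (nb G)) z"
  shows "lam_matrix G z = boundary_measurement_matrix G w"
proof (rule eq_matI)
  have g: "gdet w \<noteq> 0" by (rule positive_gdet[OF w])
  obtain l where l: "gauge_direction G l" using gauge_direction_exists .
  interpret gauge_net G l by unfold_locales (rule l)
  show dims: "dim_row (lam_matrix G z) = dim_row (boundary_measurement_matrix G w)"
    "dim_col (lam_matrix G z) = dim_col (boundary_measurement_matrix G w)"
    by (simp_all add: lam_matrix_def boundary_measurement_matrix_def)
  fix r c assume "r < dim_row (boundary_measurement_matrix G w)" "c < dim_col (boundary_measurement_matrix G w)"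
  then have r: "r < card (sources G)" and c: "c < nb G" by (auto simp: boundary_measurement_matrix_def)
  define i where "i = pick (sources G) r"
  have i: "i \<in> sources G" "card {a \<in> sources G. a < i} = r"
    using card_less_pick[OF finite_sources r] by (auto simp: i_def)
  have nth: "sorted_list_of_set (sources G) ! r = i"
    unfolding i_def by (rule sorted_list_nth_pick[OF finite_sources r])
  have B: "boundary_measurement_matrix G w $$ (r, c) = (if c \<in> sources G then (if c = i then 1 else 0)
     else (-1) ^ card (between i c) * boundary_measurement G w i c)"
    using r c nth by (simp add: boundary_measurement_matrix_def mat_of_rows_def between_def)
  have A: "lam_matrix G z $$ (r, c) = (if c \<in> sinks G then
     - (lam_sign G \<epsilon> (boundary_edge G i) * w (boundary_edge G i) * cof (boundary_edge G i) (boundary_edge G c) w / gdet w)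
     else if c = i then 1 else 0)"
    using lam_matrix_sink[OF g z i(1) c] i(2) by simp
  show "lam_matrix G z $$ (r, c) = boundary_measurement_matrix G w $$ (r, c)"
  proof (cases "c \<in> sinks G")
    case True
    let ?\<sigma> = "(-1::real) ^ card (between i c)"
    have cs: "c \<notin> sources G" using True by (simp add: sinks_def)
    have sq: "?\<sigma> * ?\<sigma> = 1" by (simp flip: power_mult_distrib)
    have "boundary_measurement G w i c = (- ?\<sigma>) * lam_sign G \<epsilon> (boundary_edge G i) * w (boundary_edge G i)
        * cof (boundary_edge G i) (boundary_edge G c) w / gdet w"
    \<comment> \<open>The constant is \<open>- ?\<sigma>\<close>: on every walk the winding sign and
      the product of the edge signs differ by this factor, which depends only on the ends.\<close>
    proof (rule walk_series_value[OF g i(1) True])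
      fix p assume p: "walk G i c p"
      have "prod_list (map (lam_sign G \<epsilon>) p) = - (?\<sigma> * (-1) powi Wind G i c p)"
        using walk_sign_geometric[OF l source_edge(1)[OF i(1)] c p]
          walk_geometric_sign[OF p source_edge(1)[OF i(1)] c] by simp
      then show "(-1) powi Wind G i c p = - ?\<sigma> * prod_list (map (lam_sign G \<epsilon>) p)"
        using sq by (simp add: mult.assoc[symmetric])
    qed
    then have "?\<sigma> * boundary_measurement G w i c = - (?\<sigma> * ?\<sigma>) * (lam_sign G \<epsilon> (boundary_edge G i) * w (boundary_edge G i)
        * cof (boundary_edge G i) (boundary_edge G c) w / gdet w)" by simp
    then show ?thesis unfolding A B sq using True cs by simp
  next
    case False
    then have "c \<in> sources G" using c by (simp add: sinks_def)
    then show ?thesis unfolding A B using False by simp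
  qed
qed

end

theorem mainTheorem7:
  fixes G :: plabic and \<epsilon> :: "edge \<Rightarrow> nat"
  assumes "plabic_graph G" and "PBDTP G" and "signature G \<epsilon>"
  shows "(AE w in weight_measure G. lam_uniquely_solvable G w \<epsilon>) \<and>
    ((AE w in weight_measure G. positive_weights G w \<longrightarrow>
        (\<forall>z. lam_solution G w \<epsilon> (unit_vec (nb G)) z \<longrightarrow> totally_nonnegative (lam_matrix G z))) \<longrightarrow>
      (\<forall>l. gauge_direction G l \<longrightarrow> equivalent_signatures G \<epsilon> (geometric_signature G l)) \<and>
      (\<forall>w. positive_weights G w \<longrightarrow> lam_uniquely_solvable G w \<epsilon>) \<and>
      (\<forall>w. positive_weights G w \<longrightarrow>
        (\<forall>z. lam_solution G w \<epsilon> (unit_vec (nb G)) z \<longrightarrow>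
          lam_matrix G z = boundary_measurement_matrix G w)))"
proof -
  interpret lam_net G \<epsilon> by unfold_locales (use assms in auto)
  show ?thesis
  proof (intro conjI impI)
    show "AE w in weight_measure G. lam_uniquely_solvable G w \<epsilon>" by (rule AE_lam_uniquely_solvable)
    assume tnn: "AE w in weight_measure G. positive_weights G w \<longrightarrow>
        (\<forall>z. lam_solution G w \<epsilon> (unit_vec (nb G)) z \<longrightarrow> totally_nonnegative (lam_matrix G z))"
    interpret tnn_net G \<epsilon> by unfold_locales (rule tnn)
    show "\<forall>l. gauge_direction G l \<longrightarrow> equivalent_signatures G \<epsilon> (geometric_signature G l)"
      using equivalent_signaturesI walk_sign_geometric by blast
    show "\<forall>w. positive_weights G w \<longrightarrow> lam_uniquely_solvable G w \<epsilon>"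
      using gdet_lam_uniquely_solvable positive_gdet by blast
    show "\<forall>w. positive_weights G w \<longrightarrow> (\<forall>z. lam_solution G w \<epsilon> (unit_vec (nb G)) z \<longrightarrow>
        lam_matrix G z = boundary_measurement_matrix G w)"
      using lam_matrix_boundary_measurement by blast
  qed
qed

end
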